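(* Let $\Omega\subset\mathbb{R}^3$ be a smooth bounded domain, let $\lambda\in\mathbb{R}$, $k\in\mathbb{N}$, and let $\beta_0>0$, $C>0$. For every $\beta\geq\beta_0$ let $(u_\beta,v_\beta)$ be a solution of $$-\Delta u+\lambda u=u^3-\beta uv^2,\qquad -\Delta v+\lambda v=v^3-\beta vu^2,\qquad u,v\in H^1_0(\Omega),$$ with $u_\beta>0$, $v_\beta>0$ in $\Omega$ and $u_\beta\neq v_\beta$, such that the Morse index of $(u_\beta,v_\beta)$ with respect to $I_\beta$ is at most $k$ and $\|u_\beta\|_{H^1_0(\Omega)}+\|v_\beta\|_{H^1_0(\Omega)}\leq C$. Let $(u,v)$ be such that $u_\beta\to u$ and $v_\beta\to v$ in $H^1_0(\Omega)$ as $\beta\to+\infty$. Then the number of connected components of the set $\{x\in\Omega:\ u(x)+v(x)>0\}$ is less than or equal to $k$.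
   Context: Solutions are weak solutions, and $\|u\|_{H^1_0(\Omega)}^2=\int_\Omega|\nabla u|^2$. The functional $I_\beta:H^1_0(\Omega)\times H^1_0(\Omega)\to\mathbb{R}$ is $$I_\beta(u,v)=\frac12\int_\Omega(|\nabla u|^2+|\nabla v|^2+\lambda u^2+\lambda v^2)-\frac14\int_\Omega(u^4+v^4)+\frac\beta2\int_\Omega u^2v^2 ,$$ whose critical points are the solutions of the system. The Morse index of a critical point $(u,v)$ is the maximal dimension of a linear subspace of $H^1_0(\Omega)\times H^1_0(\Omega)$ on which $(\varphi,\psi)\mapsto I_\beta''(u,v)(\varphi,\psi)(\varphi,\psi)$ is negative definite. By known results (families of positive solutions that are bounded in $L^\infty(\Omega)$ uniformly in $\beta$ are bounded in $C^{0,\alpha}(\overline\Omega)$ for every $\alpha\in(0,1)$), the limits $u,v$ are continuous on $\overline\Omega$; the set $\{u+v>0\}$ is understood for these continuous representatives and is open. *)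

theory Defs
  imports
    "HOL-Analysis.Analysis"
    "HOL-Library.Function_Algebras"
    "HOL-Library.Extended_Nat"
begin

(* Pointwise scalar multiplication; addition, subtraction and zero of functions come from
   Function_Algebras.  Subspaces, spans and dimensions of sets of functions, and of sets of
   pairs of functions, are then the library notions for the class real_vector. *)
instantiation "fun" :: (type, real_vector) real_vector
begin

definition "scaleR_fun c f = (\<lambda>x. c *\<^sub>R f x)"

instance
  by standard (auto simp: scaleR_fun_def fun_eq_iff algebra_simps)

end

primrec ck_on :: "nat \<Rightarrow> (real^'n) set \<Rightarrow> (real^'n \<Rightarrow> real) \<Rightarrow> bool" where
  "ck_on 0 S f \<longleftrightarrow> continuous_on S f"
| "ck_on (Suc k) S f \<longleftrightarrow> (\<forall>x\<in>S. f differentiable (at x)) \<and>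
     (\<forall>h. ck_on k S (\<lambda>x. frechet_derivative f (at x) h))"

definition smooth_on :: "(real^'n) set \<Rightarrow> (real^'n \<Rightarrow> real) \<Rightarrow> bool" where
  "smooth_on S f \<longleftrightarrow> (\<forall>k. ck_on k S f)"

(* Near each boundary point the domain is, up to relabelling (i) and reorienting (s) the
   coordinate axes, the region above the graph of a smooth function g of the other coordinates;
   g is written as a function on the whole space that does not depend on the i-th coordinate. *)
definition smooth_boundary :: "(real^'n) set \<Rightarrow> bool" where
  "smooth_boundary \<Omega> \<longleftrightarrow>
     (\<forall>p\<in>frontier \<Omega>. \<exists>r>0. \<exists>i. \<exists>s\<in>{-1, 1}. \<exists>g.
        smooth_on UNIV g \<and>
        (\<forall>x y. (\<forall>j. j \<noteq> i \<longrightarrow> x $ j = y $ j) \<longrightarrow> g x = g y) \<and>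
        \<Omega> \<inter> ball p r = {x \<in> ball p r. s * x $ i > g x})"

definition smooth_bounded_domain :: "(real^'n) set \<Rightarrow> bool" where
  "smooth_bounded_domain \<Omega> \<longleftrightarrow>
     open \<Omega> \<and> connected \<Omega> \<and> \<Omega> \<noteq> {} \<and> bounded \<Omega> \<and> smooth_boundary \<Omega>"

definition test_fun :: "(real^'n) set \<Rightarrow> (real^'n \<Rightarrow> real) \<Rightarrow> bool" where
  "test_fun \<Omega> \<phi> \<longleftrightarrow> smooth_on UNIV \<phi> \<and>
     compact (closure {x. \<phi> x \<noteq> 0}) \<and> closure {x. \<phi> x \<noteq> 0} \<subseteq> \<Omega>"

definition grad :: "(real^'n \<Rightarrow> real) \<Rightarrow> real^'n \<Rightarrow> real^'n" where
  "grad \<phi> x = (\<chi> i. frechet_derivative \<phi> (at x) (axis i 1))"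

definition L2 :: "(real^'n) set \<Rightarrow> (real^'n \<Rightarrow> 'b::euclidean_space) \<Rightarrow> bool" where
  "L2 \<Omega> f \<longleftrightarrow> f \<in> borel_measurable (lebesgue_on \<Omega>) \<and>
     integrable (lebesgue_on \<Omega>) (\<lambda>x. (norm (f x))\<^sup>2)"

definition weak_grad ::
    "(real^'n) set \<Rightarrow> (real^'n \<Rightarrow> real) \<Rightarrow> (real^'n \<Rightarrow> real^'n) \<Rightarrow> bool" where
  "weak_grad \<Omega> u g \<longleftrightarrow> L2 \<Omega> g \<and>
     (\<forall>\<phi>. test_fun \<Omega> \<phi> \<longrightarrow>
        integral\<^sup>L (lebesgue_on \<Omega>) (\<lambda>x. u x *\<^sub>R grad \<phi> x) =
        - integral\<^sup>L (lebesgue_on \<Omega>) (\<lambda>x. \<phi> x *\<^sub>R g x))"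

(* Elements of the Sobolev spaces are represented by functions.  Their values off \<Omega> and on null
   sets are irrelevant: only integrals over \<Omega> and almost-everywhere statements are used below. *)
definition H1 :: "(real^'n) set \<Rightarrow> (real^'n \<Rightarrow> real) set" where
  "H1 \<Omega> = {u. L2 \<Omega> u \<and> (\<exists>g. weak_grad \<Omega> u g)}"

definition wgrad :: "(real^'n) set \<Rightarrow> (real^'n \<Rightarrow> real) \<Rightarrow> real^'n \<Rightarrow> real^'n" where
  "wgrad \<Omega> u = (SOME g. weak_grad \<Omega> u g)"

definition H1_norm :: "(real^'n) set \<Rightarrow> (real^'n \<Rightarrow> real) \<Rightarrow> real" where
  "H1_norm \<Omega> u =
     sqrt (integral\<^sup>L (lebesgue_on \<Omega>) (\<lambda>x. (u x)\<^sup>2 + (norm (wgrad \<Omega> u x))\<^sup>2))"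

definition H10 :: "(real^'n) set \<Rightarrow> (real^'n \<Rightarrow> real) set" where
  "H10 \<Omega> = {u \<in> H1 \<Omega>. \<exists>\<phi> :: nat \<Rightarrow> real^'n \<Rightarrow> real.
     (\<forall>m. test_fun \<Omega> (\<phi> m)) \<and> (\<lambda>m. H1_norm \<Omega> (u - \<phi> m)) \<longlonglongrightarrow> 0}"

definition H10_norm :: "(real^'n) set \<Rightarrow> (real^'n \<Rightarrow> real) \<Rightarrow> real" where
  "H10_norm \<Omega> u = sqrt (integral\<^sup>L (lebesgue_on \<Omega>) (\<lambda>x. (norm (wgrad \<Omega> u x))\<^sup>2))"

definition weak_solution ::
    "(real^3) set \<Rightarrow> real \<Rightarrow> real \<Rightarrow> (real^3 \<Rightarrow> real) \<Rightarrow> (real^3 \<Rightarrow> real) \<Rightarrow> bool" where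
  "weak_solution \<Omega> lam \<beta> u v \<longleftrightarrow> u \<in> H10 \<Omega> \<and> v \<in> H10 \<Omega> \<and>
     (\<forall>\<phi>\<in>H10 \<Omega>.
        integral\<^sup>L (lebesgue_on \<Omega>) (\<lambda>x. wgrad \<Omega> u x \<bullet> wgrad \<Omega> \<phi> x + lam * u x * \<phi> x) =
        integral\<^sup>L (lebesgue_on \<Omega>) (\<lambda>x. ((u x)^3 - \<beta> * u x * (v x)\<^sup>2) * \<phi> x)) \<and>
     (\<forall>\<psi>\<in>H10 \<Omega>.
        integral\<^sup>L (lebesgue_on \<Omega>) (\<lambda>x. wgrad \<Omega> v x \<bullet> wgrad \<Omega> \<psi> x + lam * v x * \<psi> x) =
        integral\<^sup>L (lebesgue_on \<Omega>) (\<lambda>x. ((v x)^3 - \<beta> * v x * (u x)\<^sup>2) * \<psi> x))"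

definition energy ::
    "(real^3) set \<Rightarrow> real \<Rightarrow> real \<Rightarrow> (real^3 \<Rightarrow> real) \<times> (real^3 \<Rightarrow> real) \<Rightarrow> real" where
  "energy \<Omega> lam \<beta> = (\<lambda>(u, v).
     1/2 * integral\<^sup>L (lebesgue_on \<Omega>) (\<lambda>x. (norm (wgrad \<Omega> u x))\<^sup>2 + (norm (wgrad \<Omega> v x))\<^sup>2
              + lam * (u x)\<^sup>2 + lam * (v x)\<^sup>2)
     - 1/4 * integral\<^sup>L (lebesgue_on \<Omega>) (\<lambda>x. (u x)^4 + (v x)^4)
     + \<beta>/2 * integral\<^sup>L (lebesgue_on \<Omega>) (\<lambda>x. (u x)\<^sup>2 * (v x)\<^sup>2))"

(* The energy is a continuous polynomial on the product of two copies of H10, so its first and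
   second derivatives there are given by (iterated) directional derivatives. *)
definition dir_deriv :: "('a::real_vector \<Rightarrow> real) \<Rightarrow> 'a \<Rightarrow> 'a \<Rightarrow> real" where
  "dir_deriv F w h = deriv (\<lambda>t. F (w + t *\<^sub>R h)) 0"

definition dir_deriv2 :: "('a::real_vector \<Rightarrow> real) \<Rightarrow> 'a \<Rightarrow> 'a \<Rightarrow> 'a \<Rightarrow> real" where
  "dir_deriv2 F w h k = dir_deriv (\<lambda>w'. dir_deriv F w' h) w k"

(* An element of X that vanishes almost everywhere gives the value 0 to the second derivative, so
   it lies in a negative definite W only if it is the zero function.  Hence W embeds into the
   space of almost-everywhere classes, and its dimension is that of the space of classes.
   The supremum is over finite-dimensional subspaces because dim is 0 on the others; it is infinite
   if there is an infinite-dimensional negative definite subspace. *)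
definition morse_index ::
    "'a::real_vector set \<Rightarrow> ('a \<Rightarrow> real) \<Rightarrow> 'a \<Rightarrow> enat" where
  "morse_index X F w = Sup {enat (dim W) | W.
     subspace W \<and> W \<subseteq> X \<and> (\<exists>B. finite B \<and> W = span B) \<and>
     (\<forall>h\<in>W. h \<noteq> 0 \<longrightarrow> dir_deriv2 F w h h < 0)}"

definition continuous_rep ::
    "(real^'n) set \<Rightarrow> (real^'n \<Rightarrow> real) \<Rightarrow> (real^'n \<Rightarrow> real) \<Rightarrow> bool" where
  "continuous_rep \<Omega> u uc \<longleftrightarrow>
     continuous_on (closure \<Omega>) uc \<and> (AE x in lebesgue_on \<Omega>. uc x = u x)"

end

theory Submission
  imports Defs "HOL-Computational_Algebra.Polynomial"
begin

text \<open>
  The theorem rests on a lower bound for the Morse index that does not see the coupling parameter.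
  For a solution \<open>(U, V)\<close> and a test function \<open>A\<close>, consider the direction \<open>(A U, - A V)\<close>.  Testing
  the two equations with \<open>A\<^sup>2 U\<close> and \<open>A\<^sup>2 V\<close> removes the gradients of \<open>U\<close> and \<open>V\<close> from the second
  variation, and the coupling terms add up to \<open>- 4 \<beta>\<close> times the integral of \<open>A\<^sup>2 U\<^sup>2 V\<^sup>2\<close>.  Hence the
  second variation is at most
  \<open>\<integral> (U\<^sup>2 + V\<^sup>2) |grad A|\<^sup>2 - 2 (U\<^sup>4 + V\<^sup>4) A\<^sup>2\<close>, called \<open>cutoff_form\<close> below
  (\<open>second_variation_le_cutoff_form\<close>).  The form is additive over test functions with disjoint
  supports, so the directions given by disjointly supported cutoffs on which it is negative span a
  negative definite space whose dimension is their number (\<open>morse_index_ge_cutoffs\<close>).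

  Negativity of the form for a fixed cutoff passes from the limit \<open>(u, v)\<close> to \<open>(U, V)\<close> for large
  \<open>\<beta>\<close>, by convergence in the mean alone (\<open>eventually_cutoff_form_neg\<close>).  It therefore suffices to
  find, for every component \<open>\<omega>\<close> of \<open>{u + v > 0}\<close>, a cutoff supported in \<open>\<omega>\<close> on which the form of the
  limit is negative (\<open>component_cutoff\<close>).  A step function of \<open>u + v\<close> at a low level \<open>\<epsilon>\<close>, restricted
  to \<open>\<omega>\<close>, does this: on the layer \<open>{\<epsilon> < u + v < 2 \<epsilon>}\<close> the factor \<open>u\<^sup>2 + v\<^sup>2\<close> compensates the
  slope \<open>1 / \<epsilon>\<close>, so the gradient term is bounded by the Dirichlet integral of \<open>u + v\<close> over a set
  that shrinks to the empty set, while the quartic term converges to a positive multiple of the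
  integral of \<open>u\<^sup>4 + v\<^sup>4\<close> over \<open>\<omega>\<close>.  The support of this cutoff is compact in \<open>\<omega>\<close> because the
  continuous representatives vanish on the boundary of the domain
  (\<open>continuous_rep_boundary_zero\<close>).

  The analysis behind this is elementary.  Integration by parts, the Poincare inequality and
  the vanishing on the boundary all come from translating test functions
  (\<open>integral_grad_eq_0\<close>, \<open>translation_inequality\<close>); weak gradients are unique because smooth bumps approximate indicators
  of boxes (\<open>fundamental_lemma\<close>); and fourth powers are integrable by Ladyzhenskaya's inequality, so
  the energy is a polynomial along lines, whose second derivative can be read off.
\<close>

section \<open>Smooth functions\<close>

lemma frechet_derivative_eqI:
  "(f has_derivative f') (at x) \<Longrightarrow> frechet_derivative f (at x) = f'"
  using frechet_derivative_at by metis

lemma ck_on_Suc_D: "ck_on (Suc k) UNIV f \<Longrightarrow> ck_on k UNIV f"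
proof (induction k arbitrary: f)
  case 0
  then show ?case
    by (auto intro!: continuous_at_imp_continuous_on differentiable_imp_continuous_within)
next
  case (Suc k)
  then show ?case by (auto simp del: ck_on.simps(2) simp: ck_on.simps(2)[of "Suc k"] ck_on.simps(2)[of k])
qed

lemma ck_on_SucI:
  assumes "\<And>x. (f has_derivative f' x) (at x)" "\<And>h. ck_on k UNIV (\<lambda>x. f' x h)"
  shows "ck_on (Suc k) UNIV f"
  using assms frechet_derivative_eqI[OF assms(1)] by (auto simp: differentiable_def)

lemma ck_on_Suc_has_derivative:
  "ck_on (Suc k) UNIV f \<Longrightarrow> (f has_derivative frechet_derivative f (at x)) (at x)"
  by (auto simp: frechet_derivative_works[symmetric])

lemma ck_on_const: "ck_on k UNIV (\<lambda>x. c)"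
proof (induction k arbitrary: c)
  case (Suc k)
  show ?case by (rule ck_on_SucI[where f'="\<lambda>x h. 0"]) (auto simp: Suc)
qed auto

lemma ck_on_linear: "bounded_linear l \<Longrightarrow> ck_on k UNIV l"
proof (cases k)
  case (Suc j)
  assume "bounded_linear l"
  then show ?thesis unfolding Suc
    by (intro ck_on_SucI[where f'="\<lambda>x. l"] bounded_linear_imp_has_derivative ck_on_const)
qed (auto simp: linear_continuous_on)

lemma ck_on_add: "ck_on k UNIV f \<Longrightarrow> ck_on k UNIV g \<Longrightarrow> ck_on k UNIV (\<lambda>x. f x + g x)"
proof (induction k arbitrary: f g)
  case (Suc k)
  show ?case
    by (rule ck_on_SucI[OF has_derivative_add[OF Suc.prems[THEN ck_on_Suc_has_derivative]]])
      (use Suc in auto)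
qed (auto intro: continuous_intros)

lemma ck_on_mult: "ck_on k UNIV f \<Longrightarrow> ck_on k UNIV g \<Longrightarrow> ck_on k UNIV (\<lambda>x. f x * g x)"
proof (induction k arbitrary: f g)
  case (Suc k)
  show ?case
    by (rule ck_on_SucI[OF has_derivative_mult[OF Suc.prems[THEN ck_on_Suc_has_derivative]]])
      (use Suc in \<open>auto intro!: ck_on_add Suc.IH simp del: ck_on.simps(2) dest: ck_on_Suc_D\<close>, auto)
qed (auto intro: continuous_intros)

text \<open>A function of one variable enters only through the sequence of all its derivatives, so that
  the chain rule stays inside the same class.\<close>

definition deriv_chain :: "(nat \<Rightarrow> real \<Rightarrow> real) \<Rightarrow> bool" where
  "deriv_chain F \<longleftrightarrow> (\<forall>n t. (F n has_real_derivative F (Suc n) t) (at t))"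

lemma ck_on_compose:
  assumes F: "deriv_chain F"
  shows "ck_on k UNIV w \<Longrightarrow> ck_on k UNIV (\<lambda>x. F n (w x))"
proof (induction k arbitrary: w n)
  case 0
  have "continuous_on UNIV (F n)"
    using F by (auto simp: deriv_chain_def intro!: continuous_at_imp_continuous_on DERIV_isCont)
  then show ?case using 0 by (auto intro: continuous_on_compose2)
next
  case (Suc k)
  have "((\<lambda>x. F n (w x)) has_derivative (\<lambda>h. F (Suc n) (w x) * frechet_derivative w (at x) h)) (at x)" for x
    using F has_derivative_compose[OF ck_on_Suc_has_derivative[OF Suc.prems], of "F n"]
    by (auto simp: deriv_chain_def has_field_derivative_def)
  then show ?case
    by (rule ck_on_SucI) (use Suc in \<open>auto intro!: ck_on_mult Suc.IH simp del: ck_on.simps(2) dest: ck_on_Suc_D\<close>, auto)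
qed

lemma smooth_on_const: "smooth_on UNIV (\<lambda>x. c)"
  by (simp add: smooth_on_def ck_on_const)
lemma smooth_on_linear: "bounded_linear l \<Longrightarrow> smooth_on UNIV l"
  by (simp add: smooth_on_def ck_on_linear)
lemma smooth_on_add: "smooth_on UNIV f \<Longrightarrow> smooth_on UNIV g \<Longrightarrow> smooth_on UNIV (\<lambda>x. f x + g x)"
  by (simp add: smooth_on_def ck_on_add)
lemma smooth_on_mult: "smooth_on UNIV f \<Longrightarrow> smooth_on UNIV g \<Longrightarrow> smooth_on UNIV (\<lambda>x. f x * g x)"
  by (simp add: smooth_on_def ck_on_mult)
lemma smooth_on_compose: "deriv_chain F \<Longrightarrow> smooth_on UNIV w \<Longrightarrow> smooth_on UNIV (\<lambda>x. F n (w x))"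
  by (simp add: smooth_on_def ck_on_compose)
lemma smooth_on_uminus: "smooth_on UNIV f \<Longrightarrow> smooth_on UNIV (\<lambda>x. - f x)"
  using smooth_on_mult[OF smooth_on_const[of "-1"], of f] by simp
lemma smooth_on_diff: "smooth_on UNIV f \<Longrightarrow> smooth_on UNIV g \<Longrightarrow> smooth_on UNIV (\<lambda>x. f x - g x)"
  using smooth_on_add[OF _ smooth_on_uminus, of f g] by simp
lemma smooth_on_sum: "(\<And>i. i \<in> I \<Longrightarrow> smooth_on UNIV (f i)) \<Longrightarrow> smooth_on UNIV (\<lambda>x. \<Sum>i\<in>I. f i x)"
  by (induction I rule: infinite_finite_induct) (auto intro: smooth_on_const smooth_on_add)
lemma smooth_on_prod: "(\<And>i. i \<in> I \<Longrightarrow> smooth_on UNIV (f i)) \<Longrightarrow> smooth_on UNIV (\<lambda>x. \<Prod>i\<in>I. f i x)"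
  by (induction I rule: infinite_finite_induct) (auto intro: smooth_on_const smooth_on_mult)

lemmas smooth_intros = smooth_on_const smooth_on_add smooth_on_mult smooth_on_uminus smooth_on_diff smooth_on_sum smooth_on_prod

lemma smooth_on_nth: "smooth_on UNIV (\<lambda>x::real^'n. x $ i)"
  by (intro smooth_on_linear bounded_linear_vec_nth)

lemma smooth_on_has_derivative:
  "smooth_on UNIV f \<Longrightarrow> (f has_derivative frechet_derivative f (at x)) (at x)"
  using ck_on_Suc_has_derivative smooth_on_def by blast

lemma smooth_on_continuous: "smooth_on UNIV f \<Longrightarrow> continuous_on UNIV f"
  by (auto simp: smooth_on_def dest: spec[of _ 0])

lemma smooth_on_derivative: "smooth_on UNIV f \<Longrightarrow> smooth_on UNIV (\<lambda>x. frechet_derivative f (at x) h)"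
  unfolding smooth_on_def by (metis ck_on.simps(2))

subsection \<open>Gradients\<close>

lemma grad_inner:
  assumes "(f has_derivative f') (at x)"
  shows "f' h = grad f x \<bullet> h"
proof -
  interpret bounded_linear f' using assms by (rule has_derivative_bounded_linear)
  have "f' h = f' (\<Sum>i\<in>UNIV. h $ i *\<^sub>R axis i 1)"
    by (simp add: basis_expansion scalar_mult_eq_scaleR[symmetric])
  also have "\<dots> = (\<Sum>i\<in>UNIV. h $ i * f' (axis i 1))"
    by (simp add: sum scaleR)
  also have "\<dots> = grad f x \<bullet> h"
    using frechet_derivative_eqI[OF assms]
    by (simp add: grad_def inner_vec_def mult.commute)
  finally show ?thesis .
qed

lemma grad_eqI:
  assumes "(f has_derivative (\<lambda>h. g \<bullet> h)) (at x)"
  shows "grad f x = g"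
  using grad_inner[OF assms] by (metis vector_eq_rdot inner_commute)

lemma smooth_has_derivative_grad:
  "smooth_on UNIV f \<Longrightarrow> (f has_derivative (\<lambda>h. grad f x \<bullet> h)) (at x)"
  using grad_inner[OF smooth_on_has_derivative[of f x]] smooth_on_has_derivative[of f x]
  by (metis (no_types, lifting) ext)

lemma smooth_grad_nth: "smooth_on UNIV f \<Longrightarrow> smooth_on UNIV (\<lambda>x. grad f x $ i)"
  using smooth_on_derivative by (simp add: grad_def)

lemma continuous_grad: "smooth_on UNIV f \<Longrightarrow> continuous_on UNIV (grad f)"
  by (subst continuous_on_componentwise)
    (auto simp: Basis_vec_def inner_axis intro: smooth_on_continuous smooth_grad_nth)

lemma grad_add: "smooth_on UNIV f \<Longrightarrow> smooth_on UNIV g \<Longrightarrow> grad (\<lambda>x. f x + g x) x = grad f x + grad g x"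
  by (rule grad_eqI, rule has_derivative_eq_rhs, rule has_derivative_add)
   (auto dest: smooth_has_derivative_grad simp: inner_add_left)

lemma grad_mult: "smooth_on UNIV f \<Longrightarrow> smooth_on UNIV g \<Longrightarrow>
    grad (\<lambda>x. f x * g x) x = f x *\<^sub>R grad g x + g x *\<^sub>R grad f x"
  by (rule grad_eqI, rule has_derivative_eq_rhs, rule has_derivative_mult)
   (auto dest: smooth_has_derivative_grad simp: inner_add_left)

lemma grad_const: "grad (\<lambda>x. c) x = 0"
  by (rule grad_eqI) simp

lemma grad_cmult: "smooth_on UNIV f \<Longrightarrow> grad (\<lambda>x. c * f x) x = c *\<^sub>R grad f x"
  by (subst grad_mult) (auto intro: smooth_intros simp: grad_const)

lemma grad_sum: "(\<And>i. i \<in> I \<Longrightarrow> smooth_on UNIV (f i)) \<Longrightarrow> grad (\<lambda>x. \<Sum>i\<in>I. f i x) x = (\<Sum>i\<in>I. grad (f i) x)"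
  by (induction I rule: infinite_finite_induct) (auto simp: grad_const grad_add smooth_intros)

lemma grad_compose:
  assumes "\<And>t. (F has_real_derivative F' t) (at t)" "smooth_on UNIV w"
  shows "grad (\<lambda>x. F (w x)) x = F' (w x) *\<^sub>R grad w x"
proof (rule grad_eqI)
  have "(F has_derivative (*) (F' (w x))) (at (w x))"
    using assms(1)[of "w x"] by (simp add: has_field_derivative_def)
  from has_derivative_compose[OF smooth_has_derivative_grad[OF assms(2)] this]
  show "((\<lambda>x. F (w x)) has_derivative (\<bullet>) (F' (w x) *\<^sub>R grad w x)) (at x)"
    by (rule has_derivative_eq_rhs) (simp add: fun_eq_iff)
qed

subsection \<open>Flat functions, bumps and steps\<close>

text \<open>The class of these functions is closed under differentiation, which makes the basic flat
  function \<open>exp (- 1 / t)\<close> smooth at the origin.\<close>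

definition flat :: "real poly \<Rightarrow> real \<Rightarrow> real" where
  "flat p t = (if t > 0 then poly p (1 / t) * exp (- (1 / t)) else 0)"

lemma poly_exp_decay: "((\<lambda>y. poly p y * exp (- y)) \<longlongrightarrow> (0::real)) at_top"
proof -
  have "((\<lambda>y. \<Sum>i\<le>degree p. coeff p i * (y ^ i / exp y)) \<longlongrightarrow> (\<Sum>i\<le>degree p. coeff p i * 0)) at_top"
    by (intro tendsto_intros tendsto_power_div_exp_0)
  then show ?thesis
    by (simp add: poly_altdef exp_minus sum_distrib_right sum_divide_distrib divide_inverse mult.assoc)
qed

lemma flat_at_right: "(flat p \<longlongrightarrow> 0) (at_right 0)"
proof -
  have "((\<lambda>t. poly p (inverse t) * exp (- inverse t)) \<longlongrightarrow> 0) (at_right (0::real))"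
    by (rule filterlim_compose[OF poly_exp_decay filterlim_inverse_at_top_right])
  moreover have "eventually (\<lambda>t. poly p (inverse t) * exp (- inverse t) = flat p t) (at_right (0::real))"
    using eventually_at_right_less[of 0] by eventually_elim (simp add: flat_def inverse_eq_divide)
  ultimately show ?thesis using Lim_transform_eventually by blast
qed

lemma flat_deriv:
  "(flat p has_real_derivative flat (pCons 0 (pCons 0 (p - pderiv p))) t) (at t)"
proof -
  consider "t > 0" | "t < 0" | "t = 0" by linarith
  then show ?thesis
  proof cases
    case 1
    have d: "((\<lambda>s. 1 / s) has_real_derivative - (1 / t\<^sup>2)) (at t)"
      using 1 by (auto intro!: derivative_eq_intros simp: power2_eq_square)
    have "((\<lambda>s. poly p (1 / s) * exp (- (1 / s))) has_real_derivative
       poly (pderiv p) (1 / t) * - (1 / t\<^sup>2) * exp (- (1 / t))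
         + exp (- (1 / t)) * - (- (1 / t\<^sup>2)) * poly p (1 / t)) (at t)"
      by (intro DERIV_mult DERIV_chain2[OF poly_DERIV d] DERIV_fun_exp DERIV_minus d)
    then have "((\<lambda>t. poly p (1 / t) * exp (- (1 / t))) has_real_derivative
       flat (pCons 0 (pCons 0 (p - pderiv p))) t) (at t)"
      by (rule DERIV_cong) (use 1 in \<open>simp add: flat_def power2_eq_square divide_inverse algebra_simps\<close>)
    then show ?thesis
      by (rule DERIV_cong_ev[OF refl _ refl, THEN iffD1, rotated])
        (use eventually_nhds_in_open[of "{0<..}" t] 1 in \<open>auto elim!: eventually_mono simp: flat_def\<close>)
  next
    case 2
    have "((\<lambda>t. 0) has_real_derivative flat (pCons 0 (pCons 0 (p - pderiv p))) t) (at t)"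
      using 2 by (simp add: flat_def)
    then show ?thesis
      by (rule DERIV_cong_ev[OF refl _ refl, THEN iffD1, rotated])
        (use eventually_nhds_in_open[of "{..<0}" t] 2 in \<open>auto elim!: eventually_mono simp: flat_def\<close>)
  next
    case 3
    have "((\<lambda>s. flat p s / s) \<longlongrightarrow> 0) (at_right 0)"
      by (rule Lim_transform_eventually[OF flat_at_right[of "pCons 0 p"]])
        (use eventually_at_right_less[of 0] in \<open>eventually_elim, auto simp: flat_def\<close>)
    moreover have "((\<lambda>s. flat p s / s) \<longlongrightarrow> 0) (at_left 0)"
      by (rule Lim_transform_eventually[of "\<lambda>_. 0"]) (auto simp: flat_def eventually_at_filter)
    ultimately have "((\<lambda>s. flat p s / s) \<longlongrightarrow> 0) (at 0)"
      using filterlim_at_split by blast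
    then show ?thesis using 3 by (simp add: has_field_derivative_iff flat_def)
  qed
qed

definition ramp :: "real \<Rightarrow> real" where
  "ramp t = (if t > 0 then exp (- (1 / t)) else 0)"

definition ramp_deriv :: "real \<Rightarrow> real" where
  "ramp_deriv t = flat (pCons 0 (pCons 0 1)) t"

lemma deriv_chain_flat:
  "deriv_chain (\<lambda>n. flat (((\<lambda>p. pCons 0 (pCons 0 (p - pderiv p))) ^^ n) p))"
  by (auto simp: deriv_chain_def flat_deriv)

lemma ramp_flat: "ramp = flat 1"
  by (auto simp: ramp_def flat_def)

lemma ramp_has_deriv: "(ramp has_real_derivative ramp_deriv t) (at t)"
  using flat_deriv[of 1 t] by (simp add: ramp_flat ramp_deriv_def pderiv_1)

lemma smooth_ramp: "smooth_on UNIV w \<Longrightarrow> smooth_on UNIV (\<lambda>x. ramp (w x))"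
  using smooth_on_compose[OF deriv_chain_flat[of 1], of w 0] by (simp add: ramp_flat)

lemma ramp_bounds: "0 \<le> ramp t" "ramp t \<le> 1" "t \<le> 0 \<Longrightarrow> ramp t = 0" "t > 0 \<Longrightarrow> ramp t > 0"
  by (auto simp: ramp_def)

lemma continuous_ramp_deriv: "continuous_on A ramp_deriv"
  unfolding ramp_deriv_def
  by (intro continuous_at_imp_continuous_on ballI DERIV_isCont[OF flat_deriv])

lemma continuous_ramp: "continuous_on A ramp"
  by (intro continuous_at_imp_continuous_on ballI DERIV_isCont[OF ramp_has_deriv])

text \<open>For \<open>t \<le> 0\<close> the inner ramp is at least its value at 1, so the outer one is applied to a
  nonpositive number; for \<open>t \<ge> 1\<close> the inner ramp vanishes.  Compared with the usual quotient of two
  ramps, this needs no division.\<close>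

definition step :: "real \<Rightarrow> real" where
  "step t = ramp (exp (-1) - ramp (1 - t))"

definition step_deriv :: "real \<Rightarrow> real" where
  "step_deriv t = ramp_deriv (exp (-1) - ramp (1 - t)) * ramp_deriv (1 - t)"

definition step_top :: real where
  "step_top = ramp (exp (-1))"

lemma step_top_pos: "step_top > 0"
  by (simp add: step_top_def ramp_bounds)

lemma step_le_0: "t \<le> 0 \<Longrightarrow> step t = 0"
  by (auto simp: step_def ramp_def divide_simps)

lemma step_ge_1: "t \<ge> 1 \<Longrightarrow> step t = step_top"
  by (auto simp: step_def step_top_def ramp_bounds)

lemma step_bounds: "0 \<le> step t" "step t \<le> 1"
  by (auto simp: step_def ramp_bounds)

lemma step_has_deriv: "(step has_real_derivative step_deriv t) (at t)"
  unfolding step_def[abs_def] step_deriv_def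
  by (auto intro!: derivative_eq_intros DERIV_chain2[OF ramp_has_deriv])

lemma smooth_step: "smooth_on UNIV w \<Longrightarrow> smooth_on UNIV (\<lambda>x. step (w x))"
  unfolding step_def by (intro smooth_ramp smooth_on_diff smooth_on_const)

lemma continuous_step_deriv: "continuous_on A step_deriv"
  unfolding step_deriv_def[abs_def]
  by (intro continuous_intros continuous_on_compose2[OF continuous_ramp_deriv[of UNIV]]
      continuous_on_compose2[OF continuous_ramp[of UNIV]]) auto

lemma continuous_step: "continuous_on A step"
  by (intro continuous_at_imp_continuous_on ballI DERIV_isCont[OF step_has_deriv])

lemma step_deriv_outside: "t \<le> 0 \<or> t \<ge> 1 \<Longrightarrow> step_deriv t = 0"
  by (auto simp: step_deriv_def ramp_deriv_def flat_def ramp_def divide_simps)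

lemma step_deriv_bounded: "\<exists>S\<ge>0. \<forall>t. \<bar>step_deriv t\<bar> \<le> S"
proof -
  have "bounded (step_deriv ` {0..1})"
    by (intro compact_imp_bounded compact_continuous_image continuous_step_deriv) auto
  then obtain S where S: "\<forall>t\<in>{0..1}. \<bar>step_deriv t\<bar> \<le> S" by (auto simp: bounded_iff)
  have "\<bar>step_deriv t\<bar> \<le> max S 0" for t
    using S step_deriv_outside[of t] by (cases "t \<in> {0..1}") force+
  then show ?thesis by (intro exI[of _ "max S 0"]) auto
qed

section \<open>Test functions\<close>

lemma test_fun_smooth: "test_fun \<Omega> \<phi> \<Longrightarrow> smooth_on UNIV \<phi>"
  by (simp add: test_fun_def)

lemma test_funI_support:
  assumes "smooth_on UNIV f" "compact K" "K \<subseteq> \<Omega>" "\<And>x. x \<notin> K \<Longrightarrow> f x = 0"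
  shows "test_fun \<Omega> f"
proof -
  have "closure {x. f x \<noteq> 0} \<subseteq> K"
    using assms by (intro closure_minimal compact_imp_closed) auto
  then show ?thesis
    using assms compact_Int_closed[of K "closure {x. f x \<noteq> 0}"]
    by (auto simp: test_fun_def Int_absorb1)
qed

lemma test_fun_mono: "test_fun \<Omega> \<phi> \<Longrightarrow> \<Omega> \<subseteq> \<Omega>' \<Longrightarrow> test_fun \<Omega>' \<phi>"
  by (auto simp: test_fun_def)

lemma test_fun_support:
  fixes \<phi> :: "real^'a \<Rightarrow> real"
  assumes "test_fun \<Omega> \<phi>"
  obtains K where "compact K" "K \<subseteq> \<Omega>" "\<And>x. x \<notin> K \<Longrightarrow> \<phi> x = 0" "\<And>x. x \<notin> K \<Longrightarrow> grad \<phi> x = 0"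
proof -
  define K where "K = closure {x. \<phi> x \<noteq> 0}"
  have z: "\<phi> x = 0" if "x \<notin> K" for x
    using that closure_subset[of "{x. \<phi> x \<noteq> 0}"] by (auto simp: K_def)
  have g: "grad \<phi> x = 0" if "x \<notin> K" for x
  proof (rule grad_eqI)
    have "((\<lambda>_::real^'a. 0::real) has_derivative (\<bullet>) 0) (at x)"
      by (rule has_derivative_eq_rhs[OF has_derivative_const]) (rule ext, rule inner_zero_left[symmetric])
    then show "(\<phi> has_derivative (\<bullet>) 0) (at x)"
    proof (rule has_derivative_transform_within_open[where s="- K"])
      show "open (- K)" unfolding K_def by (intro open_Compl closed_closure)
      show "x \<in> - K" using that by blast
      show "0 = \<phi> y" if "y \<in> - K" for y using z[of y] that by (metis ComplD)
    qed
  qed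
  show ?thesis
  proof (rule that[OF _ _ z g])
    show "compact K" "K \<subseteq> \<Omega>" using assms by (simp_all add: K_def test_fun_def)
  qed
qed

lemma test_fun_zero_outside: "test_fun \<Omega> \<phi> \<Longrightarrow> x \<notin> \<Omega> \<Longrightarrow> \<phi> x = 0"
  and grad_zero_outside: "test_fun \<Omega> \<phi> \<Longrightarrow> x \<notin> \<Omega> \<Longrightarrow> grad \<phi> x = 0"
  using test_fun_support by blast+

lemma test_fun_mult_smooth:
  assumes "test_fun \<Omega> \<phi>" "smooth_on UNIV g"
  shows "test_fun \<Omega> (\<lambda>x. \<phi> x * g x)"
proof -
  obtain K where "compact K" "K \<subseteq> \<Omega>" "\<And>x. x \<notin> K \<Longrightarrow> \<phi> x = 0"
    using test_fun_support[OF assms(1)] by metis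
  then show ?thesis
    using assms by (intro test_funI_support[of _ K]) (auto intro: smooth_on_mult test_fun_smooth)
qed

lemma test_fun_mult: "test_fun \<Omega> \<phi> \<Longrightarrow> test_fun \<Omega> \<psi> \<Longrightarrow> test_fun \<Omega> (\<lambda>x. \<phi> x * \<psi> x)"
  by (intro test_fun_mult_smooth test_fun_smooth)

lemma test_fun_cmult: "test_fun \<Omega> \<phi> \<Longrightarrow> test_fun \<Omega> (\<lambda>x. c * \<phi> x)"
  using test_fun_mult_smooth[of \<Omega> \<phi> "\<lambda>_. c"] by (simp add: smooth_on_const mult.commute)

lemma test_fun_zero: "test_fun \<Omega> (\<lambda>x. 0)"
  by (simp add: test_fun_def smooth_on_const)

lemma test_fun_add:
  assumes "test_fun \<Omega> \<phi>" "test_fun \<Omega> \<psi>"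
  shows "test_fun \<Omega> (\<lambda>x. \<phi> x + \<psi> x)"
proof -
  obtain K where "compact K" "K \<subseteq> \<Omega>" "\<And>x. x \<notin> K \<Longrightarrow> \<phi> x = 0"
    using test_fun_support[OF assms(1)] by metis
  moreover obtain L where "compact L" "L \<subseteq> \<Omega>" "\<And>x. x \<notin> L \<Longrightarrow> \<psi> x = 0"
    using test_fun_support[OF assms(2)] by metis
  ultimately show ?thesis
    using assms by (intro test_funI_support[of _ "K \<union> L"]) (auto intro: smooth_on_add test_fun_smooth)
qed

lemma test_fun_sum: "(\<And>i. i \<in> I \<Longrightarrow> test_fun \<Omega> (f i)) \<Longrightarrow> test_fun \<Omega> (\<lambda>x. \<Sum>i\<in>I. f i x)"
  by (induction I rule: infinite_finite_induct) (auto intro: test_fun_zero test_fun_add)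

lemma integrable_compact_support:
  fixes f :: "'a::euclidean_space \<Rightarrow> 'b::{banach, second_countable_topology}"
  assumes "continuous_on UNIV f" "compact K" "\<And>x. x \<notin> K \<Longrightarrow> f x = 0"
  shows "integrable lborel f"
proof -
  have "integrable lborel (\<lambda>x. indicator K x *\<^sub>R f x)"
    using borel_integrable_compact[OF assms(2), of f] assms(1) continuous_on_subset by blast
  moreover have "(\<lambda>x. indicator K x *\<^sub>R f x) = f" using assms(3) by (auto simp: indicator_def fun_eq_iff)
  ultimately show ?thesis by simp
qed

lemma bounded_compact_support:
  fixes f :: "'a::topological_space \<Rightarrow> 'b::real_normed_vector"
  assumes "continuous_on UNIV f" "compact K" "\<And>x. x \<notin> K \<Longrightarrow> f x = 0"
  shows "\<exists>M\<ge>0. \<forall>x. norm (f x) \<le> M"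
proof -
  have "bounded (f ` K)"
    using assms by (intro compact_imp_bounded compact_continuous_image) (auto intro: continuous_on_subset)
  then obtain M where M: "\<forall>x\<in>K. norm (f x) \<le> M" by (auto simp: bounded_iff)
  have "norm (f x) \<le> max M 0" for x
    using M assms(3)[of x] by (cases "x \<in> K") force+
  then show ?thesis by (intro exI[of _ "max M 0"]) auto
qed

lemma test_fun_bounded: "test_fun \<Omega> \<phi> \<Longrightarrow> \<exists>M\<ge>0. \<forall>x. \<bar>\<phi> x\<bar> \<le> M"
  using bounded_compact_support[of \<phi>] smooth_on_continuous[OF test_fun_smooth]
  by (metis real_norm_def test_fun_support)

lemma grad_bounded: "test_fun \<Omega> \<phi> \<Longrightarrow> \<exists>M\<ge>0. \<forall>x. norm (grad \<phi> x) \<le> M"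
  using bounded_compact_support[of "grad \<phi>"] continuous_grad[OF test_fun_smooth]
  by (metis test_fun_support)

lemma test_fun_lipschitz:
  assumes "test_fun \<Omega> \<phi>"
  shows "\<exists>M\<ge>0. \<forall>x y. \<bar>\<phi> y - \<phi> x\<bar> \<le> M * norm (y - x)"
proof -
  obtain M where M: "M \<ge> 0" "\<And>x. norm (grad \<phi> x) \<le> M" using grad_bounded[OF assms] by blast
  have "norm (\<phi> y - \<phi> x) \<le> M * norm (y - x)" for x y
  proof (rule differentiable_bound[of UNIV])
    fix z
    show "(\<phi> has_derivative (\<lambda>h. grad \<phi> z \<bullet> h)) (at z within UNIV)"
      using smooth_has_derivative_grad[OF test_fun_smooth[OF assms]] by simp
    show "onorm (\<lambda>h. grad \<phi> z \<bullet> h) \<le> M"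
      by (rule onorm_bound) (use M in \<open>auto intro!: order_trans[OF Cauchy_Schwarz_ineq2] mult_right_mono\<close>)
  qed auto
  then show ?thesis using M(1) by auto
qed

subsection \<open>Bumps on boxes and cutoffs\<close>

text \<open>As \<open>n\<close> grows this product approximates the indicator of the box from below.\<close>

definition box_bump :: "real \<Rightarrow> real^'n \<Rightarrow> real^'n \<Rightarrow> real^'n \<Rightarrow> real" where
  "box_bump n a b x = (\<Prod>i\<in>UNIV. ramp (n * (x $ i - a $ i)) * ramp (n * (b $ i - x $ i)))"

lemma smooth_box_bump: "smooth_on UNIV (box_bump n a b)"
  unfolding box_bump_def[abs_def]
  by (intro smooth_intros smooth_ramp smooth_on_nth)

lemma box_bump_pos: "n > 0 \<Longrightarrow> x \<in> box a b \<Longrightarrow> box_bump n a b x > 0"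
  unfolding box_bump_def by (intro prod_pos mult_pos_pos ballI ramp_bounds) (auto simp: mem_box_cart)

lemma box_bump_zero: "n \<ge> 0 \<Longrightarrow> x \<notin> box a b \<Longrightarrow> box_bump n a b x = 0"
proof -
  assume n: "n \<ge> 0" and "x \<notin> box a b"
  then obtain i where "x $ i \<le> a $ i \<or> b $ i \<le> x $ i" by (auto simp: mem_box_cart not_less)
  then have "ramp (n * (x $ i - a $ i)) * ramp (n * (b $ i - x $ i)) = 0"
    using n by (auto intro!: ramp_bounds(3) mult_nonneg_nonpos)
  then show ?thesis unfolding box_bump_def by (intro prod_zero) auto
qed

lemma box_bump_bounds: "0 \<le> box_bump n a b x" "box_bump n a b x \<le> 1"
  unfolding box_bump_def
  by (auto intro!: prod_nonneg prod_le_1 mult_le_one mult_nonneg_nonneg ramp_bounds)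

lemma test_fun_box_bump: "n \<ge> 0 \<Longrightarrow> cbox a b \<subseteq> \<Omega> \<Longrightarrow> test_fun \<Omega> (box_bump n a b)"
  by (rule test_funI_support[of _ "cbox a b"])
    (use box_subset_cbox in \<open>auto intro!: smooth_box_bump box_bump_zero\<close>)

lemma ramp_scaled_tendsto: "(\<lambda>n. ramp (real n * t)) \<longlonglongrightarrow> of_bool (t > 0)"
proof (cases "t > 0")
  case True
  have "(\<lambda>n. exp (- ((1 / t) * inverse (real n)))) \<longlonglongrightarrow> exp (- ((1 / t) * 0))"
    by (intro tendsto_intros lim_inverse_n)
  moreover have "eventually (\<lambda>n. exp (- ((1 / t) * inverse (real n))) = ramp (real n * t)) sequentially"
    using eventually_gt_at_top[of 0] by eventually_elim (use True in \<open>simp add: ramp_def field_simps\<close>)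
  ultimately show ?thesis using True by (auto intro: Lim_transform_eventually)
next
  case False
  then show ?thesis by (simp add: ramp_bounds mult_nonneg_nonpos)
qed

lemma box_bump_tendsto: "(\<lambda>n. box_bump (real n) a b x) \<longlonglongrightarrow> indicator (box a b) x"
proof -
  have "(\<lambda>n. box_bump (real n) a b x) \<longlonglongrightarrow>
      (\<Prod>i\<in>UNIV. of_bool (x $ i - a $ i > 0) * of_bool (b $ i - x $ i > 0))"
    unfolding box_bump_def by (intro tendsto_prod tendsto_mult ramp_scaled_tendsto)
  also have "(\<Prod>i\<in>UNIV. of_bool (x $ i - a $ i > 0) * of_bool (b $ i - x $ i > 0)) = (indicator (box a b) x :: real)"
  proof (cases "x \<in> box a b")
    case True
    then show ?thesis by (auto simp: mem_box_cart intro!: prod.neutral)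
  next
    case False
    then have "\<exists>i. (of_bool (x $ i - a $ i > 0) * of_bool (b $ i - x $ i > 0) :: real) = 0"
      by (auto simp: mem_box_cart)
    then show ?thesis using False by (auto intro!: prod_zero)
  qed
  finally show ?thesis .
qed

text \<open>Finitely many bumps supported in the open set have a sum bounded below on the compact set; a
  step function flattens that sum to a constant near the compact set.\<close>

lemma smooth_cutoff:
  fixes K :: "(real^'n) set"
  assumes "compact K" "open \<omega>" "K \<subseteq> \<omega>"
  obtains \<theta> N where "test_fun \<omega> \<theta>" "open N" "K \<subseteq> N" "\<And>x. x \<in> N \<Longrightarrow> \<theta> x = 1"
proof (cases "K = {}")
  case True
  then show ?thesis using that[of "\<lambda>_. 0" "{}"] by (auto simp: test_fun_zero)
next
  case False
  have "\<forall>x\<in>K. \<exists>a b. x \<in> box a b \<and> cbox a b \<subseteq> \<omega>"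
  proof
    fix x assume "x \<in> K"
    then have "x \<in> \<omega>" using assms by auto
    then show "\<exists>a b. x \<in> box a b \<and> cbox a b \<subseteq> \<omega>"
      using open_contains_cbox[OF assms(2)] by metis
  qed
  then obtain a b where ab: "\<And>x. x \<in> K \<Longrightarrow> x \<in> box (a x) (b x)" "\<And>x. x \<in> K \<Longrightarrow> cbox (a x) (b x) \<subseteq> \<omega>"
    by metis
  obtain J where J: "J \<subseteq> K" "finite J" "K \<subseteq> (\<Union>x\<in>J. box (a x) (b x))"
    by (rule compactE_image[OF assms(1), of K "\<lambda>x. box (a x) (b x)"]) (use ab in auto)
  define S where "S x = (\<Sum>y\<in>J. box_bump 1 (a y) (b y) x)" for x
  have smS: "smooth_on UNIV S" unfolding S_def[abs_def] by (intro smooth_on_sum smooth_box_bump)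
  have Spos: "S x > 0" if xK: "x \<in> K" for x
  proof -
    obtain y where "y \<in> J" "x \<in> box (a y) (b y)" using xK J(3) by blast
    then show ?thesis unfolding S_def using J(2)
      by (intro sum_pos2[of J y] box_bump_pos box_bump_bounds) auto
  qed
  obtain z where z: "z \<in> K" "\<And>x. x \<in> K \<Longrightarrow> S z \<le> S x"
    using continuous_attains_inf[OF assms(1) False, of S] smooth_on_continuous[OF smS] continuous_on_subset by blast
  define c where "c = S z"
  have c: "c > 0" using Spos z by (simp add: c_def)
  \<comment> \<open>The factor \<open>2 / c\<close> saturates the step where \<open>S > c / 2\<close>, an open set containing \<open>K\<close>.\<close>
  define \<theta> where "\<theta> x = (1 / step_top) * step ((2 / c) * S x)" for x
  show ?thesis
  proof (rule that[of \<theta> "{x. S x > c / 2}"])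
    show "test_fun \<omega> \<theta>"
    proof (rule test_funI_support[of _ "\<Union>y\<in>J. cbox (a y) (b y)"])
      show "smooth_on UNIV \<theta>" unfolding \<theta>_def[abs_def]
        by (intro smooth_on_mult smooth_on_const smooth_step smS)
      show "compact (\<Union>y\<in>J. cbox (a y) (b y))" using J by auto
      show "(\<Union>y\<in>J. cbox (a y) (b y)) \<subseteq> \<omega>" using J(1) ab(2) by blast
      fix x assume "x \<notin> (\<Union>y\<in>J. cbox (a y) (b y))"
      then have "S x = 0" unfolding S_def using box_subset_cbox by (intro sum.neutral ballI box_bump_zero) auto
      then show "\<theta> x = 0" by (simp add: \<theta>_def step_le_0)
    qed
    show "open {x. S x > c / 2}"
      by (intro open_Collect_less continuous_on_const smooth_on_continuous smS)
    show "K \<subseteq> {x. S x > c / 2}" using z c by (force simp: c_def)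
    show "\<theta> x = 1" if "x \<in> {x. S x > c / 2}" for x
      using that c step_top_pos by (auto simp: \<theta>_def step_ge_1 field_simps)
  qed
qed

subsection \<open>Difference quotients\<close>

lemma lborel_integral_translate:
  fixes f :: "'a::euclidean_space \<Rightarrow> 'b::{banach, second_countable_topology}"
  assumes "f \<in> borel_measurable borel"
  shows "(\<integral>x. f (x + h) \<partial>lborel) = (\<integral>x. f x \<partial>lborel)"
proof -
  have "(\<integral>x. f x \<partial>lborel) = (\<integral>x. f x \<partial>distr lborel borel ((+) h))" by (simp add: lborel_distr_plus)
  also have "\<dots> = (\<integral>x. f (h + x) \<partial>lborel)" using assms by (intro integral_distr) auto
  finally show ?thesis by (simp add: add.commute)
qed

lemma diff_quotient_tendsto:
  assumes "smooth_on UNIV \<phi>"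
  shows "(\<lambda>n. real (Suc n) * (\<phi> (x + (1 / real (Suc n)) *\<^sub>R h) - \<phi> x)) \<longlonglongrightarrow> grad \<phi> x \<bullet> h"
proof -
  have "((\<lambda>t. \<phi> (x + t *\<^sub>R h)) has_derivative (\<lambda>t. grad \<phi> x \<bullet> (t *\<^sub>R h))) (at 0)"
    by (rule has_derivative_compose[of "\<lambda>t. x + t *\<^sub>R h" _ 0 UNIV \<phi>, simplified])
      (auto intro!: derivative_eq_intros simp: smooth_has_derivative_grad[OF assms, of x])
  then have "((\<lambda>t. \<phi> (x + t *\<^sub>R h)) has_real_derivative (grad \<phi> x \<bullet> h)) (at 0)"
    
    unfolding has_field_derivative_def by (rule has_derivative_eq_rhs) (simp add: fun_eq_iff)
  then have "((\<lambda>t. (\<phi> (x + t *\<^sub>R h) - \<phi> x) / t) \<longlongrightarrow> grad \<phi> x \<bullet> h) (at 0)"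
    by (simp add: has_field_derivative_iff)
  moreover have "filterlim (\<lambda>n. 1 / real (Suc n)) (at 0) sequentially"
    using LIMSEQ_inverse_real_of_nat by (auto simp: filterlim_at inverse_eq_divide simp del: of_nat_Suc)
  ultimately have "(\<lambda>n. (\<phi> (x + (1 / real (Suc n)) *\<^sub>R h) - \<phi> x) / (1 / real (Suc n))) \<longlonglongrightarrow> grad \<phi> x \<bullet> h"
    by (rule filterlim_compose)
  then show ?thesis by (simp add: mult.commute)
qed

lemma diff_quotient_dominated:
  assumes "test_fun \<Omega> \<phi>"
  obtains M R where "M \<ge> 0" "\<And>n x. \<bar>real (Suc n) * (\<phi> (x + (1 / real (Suc n)) *\<^sub>R h) - \<phi> x)\<bar> \<le> M * indicator (cball 0 R) x"
proof -
  obtain L where L: "L \<ge> 0" "\<And>x y. \<bar>\<phi> y - \<phi> x\<bar> \<le> L * norm (y - x)" using test_fun_lipschitz[OF assms] by blast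
  obtain K where K: "compact K" "\<And>x. x \<notin> K \<Longrightarrow> \<phi> x = 0" using test_fun_support[OF assms] by metis
  obtain r where "\<forall>x\<in>K. norm x \<le> r" using compact_imp_bounded[OF K(1)] by (auto simp: bounded_iff)
  then have r: "K \<subseteq> cball 0 r" by auto
  have "\<bar>real (Suc n) * (\<phi> (x + (1 / real (Suc n)) *\<^sub>R h) - \<phi> x)\<bar> \<le> (L * norm h) * indicator (cball 0 (r + norm h)) x" for n x
  proof (cases "x \<in> cball 0 (r + norm h)")
    case True
    have "\<bar>real (Suc n) * (\<phi> (x + (1 / real (Suc n)) *\<^sub>R h) - \<phi> x)\<bar> \<le> real (Suc n) * (L * norm ((1 / real (Suc n)) *\<^sub>R h))"
      unfolding abs_mult using L(2)[of "x + (1 / real (Suc n)) *\<^sub>R h" x] by (intro mult_mono) auto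
    also have "\<dots> = L * norm h" by simp
    finally show ?thesis using True by simp
  next
    case False
    have "norm x \<le> norm (x + (1 / real (Suc n)) *\<^sub>R h) + norm ((1 / real (Suc n)) *\<^sub>R h)"
      using norm_triangle_ineq4[of "x + (1 / real (Suc n)) *\<^sub>R h" "(1 / real (Suc n)) *\<^sub>R h"] by simp
    moreover have "norm ((1 / real (Suc n)) *\<^sub>R h) \<le> norm h"
      by (simp add: divide_le_eq mult_le_cancel_left1)
    ultimately have "x + (1 / real (Suc n)) *\<^sub>R h \<notin> K" "x \<notin> K"
      using r False by (auto simp: subset_iff) (smt (verit) norm_ge_zero)+
    then show ?thesis using K False by simp
  qed
  then show ?thesis using that L(1) by (metis mult_nonneg_nonneg norm_ge_zero)
qed

text \<open>Integrals of difference quotients vanish by translation invariance; this replaces the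
  divergence theorem.\<close>

lemma integral_grad_eq_0:
  assumes "test_fun \<Omega> \<phi>"
  shows "(\<integral>x. grad \<phi> x \<bullet> h \<partial>lborel) = 0"
proof -
  have sm: "smooth_on UNIV \<phi>" using assms by (rule test_fun_smooth)
  have [measurable]: "\<phi> \<in> borel_measurable borel" "grad \<phi> \<in> borel_measurable borel"
    using sm by (auto intro: borel_measurable_continuous_onI smooth_on_continuous continuous_grad)
  obtain K where K: "compact K" "\<And>x. x \<notin> K \<Longrightarrow> \<phi> x = 0" using test_fun_support[OF assms] by metis
  have int: "integrable lborel \<phi>"
    using K by (intro integrable_compact_support[of _ K] smooth_on_continuous sm)
  obtain M R where MR: "M \<ge> 0" "\<And>n x. \<bar>real (Suc n) * (\<phi> (x + (1 / real (Suc n)) *\<^sub>R h) - \<phi> x)\<bar> \<le> M * indicator (cball 0 R) x"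
    using diff_quotient_dominated[OF assms] by metis
  have "(\<lambda>n. \<integral>x. real (Suc n) * (\<phi> (x + (1 / real (Suc n)) *\<^sub>R h) - \<phi> x) \<partial>lborel) \<longlonglongrightarrow> (\<integral>x. grad \<phi> x \<bullet> h \<partial>lborel)"
  proof (rule integral_dominated_convergence[where w="\<lambda>x. M * indicator (cball 0 R) x"])
    show "integrable lborel (\<lambda>x. M * indicator (cball 0 R) x)"
      by (intro integrable_mult_right integrable_real_indicator) (use emeasure_lborel_cball_finite[of 0 R] in auto)
  qed (use MR diff_quotient_tendsto[OF sm] in auto)
  moreover have "(\<integral>x. real (Suc n) * (\<phi> (x + (1 / real (Suc n)) *\<^sub>R h) - \<phi> x) \<partial>lborel) = 0" for n
  proof -
    have "integrable lborel (\<lambda>x. \<phi> (x + (1 / real (Suc n)) *\<^sub>R h))"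
      using integrable_distr[of "(+) ((1 / real (Suc n)) *\<^sub>R h)" lborel borel \<phi>] int
      by (simp add: lborel_distr_plus add.commute)
    then show ?thesis
      using int lborel_integral_translate[of \<phi>] by simp
  qed
  ultimately have "(\<lambda>n::nat. 0) \<longlonglongrightarrow> (\<integral>x. grad \<phi> x \<bullet> h \<partial>lborel)" by (simp only:)
  then show ?thesis by (rule LIMSEQ_unique[OF _ tendsto_const])
qed

text \<open>The increment over \<open>h\<close> is cut into equal pieces that contribute the same amount by
  translation invariance, so the bound follows from the pointwise limit of difference quotients.\<close>

lemma translation_inequality:
  assumes "test_fun \<Omega> \<phi>"
  shows "(\<integral>x. (\<phi> (x + h) - \<phi> x)\<^sup>2 \<partial>lborel) \<le> (\<integral>x. (grad \<phi> x \<bullet> h)\<^sup>2 \<partial>lborel)"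
proof -
  have sm: "smooth_on UNIV \<phi>" using assms by (rule test_fun_smooth)
  have [measurable]: "\<phi> \<in> borel_measurable borel" "grad \<phi> \<in> borel_measurable borel"
    using sm by (auto intro: borel_measurable_continuous_onI smooth_on_continuous continuous_grad)
  obtain M R where MR: "M \<ge> 0" "\<And>n x. \<bar>real (Suc n) * (\<phi> (x + (1 / real (Suc n)) *\<^sub>R h) - \<phi> x)\<bar> \<le> M * indicator (cball 0 R) x"
    using diff_quotient_dominated[OF assms] by metis
  have w: "integrable lborel (\<lambda>x. M\<^sup>2 * indicator (cball 0 R) x)"
    by (intro integrable_mult_right integrable_real_indicator) (use emeasure_lborel_cball_finite[of 0 R] in auto)
  define q where "q n x = real (Suc n) * (\<phi> (x + (1 / real (Suc n)) *\<^sub>R h) - \<phi> x)" for n x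
  have [measurable]: "q n \<in> borel_measurable borel" for n unfolding q_def by measurable
  have qb: "(q n x)\<^sup>2 \<le> M\<^sup>2 * indicator (cball 0 R) x" for n x
    using power_mono[OF MR(2)[of n x], of 2] by (auto simp: q_def power_mult_distrib indicator_def)
  have lim: "(\<lambda>n. \<integral>x. (q n x)\<^sup>2 \<partial>lborel) \<longlonglongrightarrow> (\<integral>x. (grad \<phi> x \<bullet> h)\<^sup>2 \<partial>lborel)"
  proof (rule integral_dominated_convergence[OF _ _ w])
    show "AE x in lborel. (\<lambda>n. (q n x)\<^sup>2) \<longlonglongrightarrow> (grad \<phi> x \<bullet> h)\<^sup>2"
      unfolding q_def by (intro AE_I2 tendsto_power diff_quotient_tendsto sm)
  qed (use qb in auto)
  have int: "integrable lborel (\<lambda>x. (q n x)\<^sup>2)" for n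
    by (rule Bochner_Integration.integrable_bound[OF w]) (use qb in auto)
  have le: "(\<integral>x. (\<phi> (x + h) - \<phi> x)\<^sup>2 \<partial>lborel) \<le> (\<integral>x. (q n x)\<^sup>2 \<partial>lborel)" for n
  proof -
    let ?N = "real (Suc n)"
    let ?y = "\<lambda>j. (real j / ?N) *\<^sub>R h"
    have intj: "integrable lborel (\<lambda>x. (q n (x + ?y j))\<^sup>2)" for j
      using integrable_distr[of "(+) (?y j)" lborel borel "\<lambda>x. (q n x)\<^sup>2"] int[of n]
      by (simp add: lborel_distr_plus add.commute)
    have pt: "(\<phi> (x + h) - \<phi> x)\<^sup>2 \<le> (1 / ?N) * (\<Sum>j<Suc n. (q n (x + ?y j))\<^sup>2)" for x
    proof -
      have "\<phi> (x + ?y (Suc j)) - \<phi> (x + ?y j) = q n (x + ?y j) / ?N" for j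
      proof -
        have "x + ?y (Suc j) = x + ?y j + (1 / ?N) *\<^sub>R h"
          by (simp add: scaleR_add_left[symmetric] add_divide_distrib[symmetric] add.assoc add.commute[of 1])
        then show ?thesis by (simp add: q_def add.assoc del: of_nat_Suc)
      qed
      then have "\<phi> (x + h) - \<phi> x = (\<Sum>j<Suc n. q n (x + ?y j) / ?N)"
        using sum_lessThan_telescope[of "\<lambda>j. \<phi> (x + ?y j)" "Suc n"] by simp
      also have "\<dots> = (\<Sum>j<Suc n. q n (x + ?y j)) / ?N" by (rule sum_divide_distrib[symmetric])
      finally have "(\<phi> (x + h) - \<phi> x)\<^sup>2 = (\<Sum>j<Suc n. 1 * q n (x + ?y j))\<^sup>2 / ?N\<^sup>2"
        by (simp add: power_divide)
      also have "\<dots> \<le> ((\<Sum>j<Suc n. 1\<^sup>2) * (\<Sum>j<Suc n. (q n (x + ?y j))\<^sup>2)) / ?N\<^sup>2"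
        by (intro divide_right_mono Cauchy_Schwarz_ineq_sum) auto
      also have "\<dots> = (1 / ?N) * (\<Sum>j<Suc n. (q n (x + ?y j))\<^sup>2)"
        by (simp add: power2_eq_square field_simps del: of_nat_Suc sum.lessThan_Suc)
      finally show ?thesis .
    qed
    have "(\<integral>x. (\<phi> (x + h) - \<phi> x)\<^sup>2 \<partial>lborel) \<le> (\<integral>x. (1 / ?N) * (\<Sum>j<Suc n. (q n (x + ?y j))\<^sup>2) \<partial>lborel)"
    proof (rule integral_mono')
      show "integrable lborel (\<lambda>x. (1 / ?N) * (\<Sum>j<Suc n. (q n (x + ?y j))\<^sup>2))"
        using intj by (intro integrable_mult_right Bochner_Integration.integrable_sum)
      show "0 \<le> (1 / ?N) * (\<Sum>j<Suc n. (q n (x + ?y j))\<^sup>2)" for x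
        by (rule order_trans[OF _ pt]) simp
    qed (rule pt)
    also have "\<dots> = (1 / ?N) * (\<Sum>j<Suc n. \<integral>x. (q n (x + ?y j))\<^sup>2 \<partial>lborel)"
      using intj by (simp add: Bochner_Integration.integral_sum del: sum.lessThan_Suc of_nat_Suc)
    also have "\<dots> = (1 / ?N) * (\<Sum>j<Suc n. \<integral>x. (q n x)\<^sup>2 \<partial>lborel)"
      by (subst lborel_integral_translate[of "\<lambda>x. (q n x)\<^sup>2"]) auto
    also have "\<dots> = (\<integral>x. (q n x)\<^sup>2 \<partial>lborel)" by (simp del: sum.lessThan_Suc of_nat_Suc)
    finally show ?thesis .
  qed
  show ?thesis by (rule LIMSEQ_le_const[OF lim]) (use le in auto)
qed

section \<open>Square integrable functions\<close>

lemma L2_measurable [measurable_dest]: "L2 \<Omega> f \<Longrightarrow> f \<in> borel_measurable (lebesgue_on \<Omega>)"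
  by (simp add: L2_def)

lemma L2_integrable_sq: "L2 \<Omega> f \<Longrightarrow> integrable (lebesgue_on \<Omega>) (\<lambda>x. (norm (f x))\<^sup>2)"
  by (simp add: L2_def)

lemma L2_integrable_sq_real: "L2 \<Omega> f \<Longrightarrow> integrable (lebesgue_on \<Omega>) (\<lambda>x. (f x :: real)\<^sup>2)"
  using L2_integrable_sq[of \<Omega> f] by simp

lemma L2_bound:
  fixes f :: "real^'n \<Rightarrow> 'b::euclidean_space"
  assumes "f \<in> borel_measurable (lebesgue_on \<Omega>)" "integrable (lebesgue_on \<Omega>) w"
    "AE x in lebesgue_on \<Omega>. (norm (f x))\<^sup>2 \<le> w x"
  shows "L2 \<Omega> f"
proof -
  note [measurable] = assms(1)
  have "integrable (lebesgue_on \<Omega>) (\<lambda>x. (norm (f x))\<^sup>2)"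
    by (rule Bochner_Integration.integrable_bound[OF assms(2)]) (use assms(3) in auto)
  then show ?thesis using assms(1) by (simp add: L2_def)
qed

lemma norm_add_sq_le: "(norm (a + b))\<^sup>2 \<le> 2 * (norm a)\<^sup>2 + 2 * (norm b)\<^sup>2"
proof -
  have "(norm (a + b))\<^sup>2 \<le> (norm a + norm b)\<^sup>2" by (intro power_mono norm_triangle_ineq) auto
  also have "\<dots> \<le> 2 * (norm a)\<^sup>2 + 2 * (norm b)\<^sup>2"
    using sum_squares_bound[of "norm a" "norm b"] by (simp add: power2_sum)
  finally show ?thesis .
qed

lemma L2_add: "L2 \<Omega> f \<Longrightarrow> L2 \<Omega> g \<Longrightarrow> L2 \<Omega> (\<lambda>x. f x + g x)"
  by (rule L2_bound[where w="\<lambda>x. 2 * (norm (f x))\<^sup>2 + 2 * (norm (g x))\<^sup>2"])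
    (auto intro!: AE_I2 norm_add_sq_le borel_measurable_add L2_measurable integrable_mult_right L2_integrable_sq)

lemma L2_bounded_mult:
  fixes h :: "real^'n \<Rightarrow> real"
  assumes "L2 \<Omega> f" and h: "h \<in> borel_measurable (lebesgue_on \<Omega>)" "\<And>x. \<bar>h x\<bar> \<le> B"
  shows "L2 \<Omega> (\<lambda>x. h x *\<^sub>R f x)"
proof (rule L2_bound[where w="\<lambda>x. B\<^sup>2 * (norm (f x))\<^sup>2"])
  show "AE x in lebesgue_on \<Omega>. (norm (h x *\<^sub>R f x))\<^sup>2 \<le> B\<^sup>2 * (norm (f x))\<^sup>2"
  proof (intro AE_I2)
    fix x
    show "(norm (h x *\<^sub>R f x))\<^sup>2 \<le> B\<^sup>2 * (norm (f x))\<^sup>2"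
      using power_mono[OF h(2)[of x], of 2] by (auto simp: power_mult_distrib intro!: mult_right_mono)
  qed
qed (use assms in \<open>auto intro!: borel_measurable_scaleR L2_measurable L2_integrable_sq integrable_mult_right\<close>)

lemma L2_scale: "L2 \<Omega> f \<Longrightarrow> L2 \<Omega> (\<lambda>x. c *\<^sub>R f x)" for c :: real
  by (rule L2_bounded_mult[where B="\<bar>c\<bar>"]) auto

lemma L2_diff: "L2 \<Omega> f \<Longrightarrow> L2 \<Omega> g \<Longrightarrow> L2 \<Omega> (\<lambda>x. f x - g x)"
  using L2_add[OF _ L2_scale[of \<Omega> g "-1"], of f] by simp

lemma L2_cong_AE:
  assumes "L2 \<Omega> f" "AE x in lebesgue_on \<Omega>. g x = f x" "g \<in> borel_measurable (lebesgue_on \<Omega>)"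
  shows "L2 \<Omega> g"
  by (rule L2_bound[OF assms(3) L2_integrable_sq[OF assms(1)]]) (use assms(2) in auto)

lemma L2_nth:
  fixes f :: "real^'n \<Rightarrow> real^'m"
  assumes "L2 \<Omega> f" shows "L2 \<Omega> (\<lambda>x. f x $ i)"
  by (rule L2_bound[OF _ L2_integrable_sq[OF assms]])
    (use assms component_le_norm_cart in
      \<open>auto intro!: AE_I2 power_mono simp: abs_le_square_iff[symmetric] cart_eq_inner_axis dest: L2_measurable\<close>)

lemma integrable_L2_product:
  assumes "L2 \<Omega> f" "L2 \<Omega> g"
  shows "integrable (lebesgue_on \<Omega>) (\<lambda>x. norm (f x) * norm (g x))"
proof (rule Bochner_Integration.integrable_bound)
  note [measurable] = assms[THEN L2_measurable]
  show "integrable (lebesgue_on \<Omega>) (\<lambda>x. (norm (f x))\<^sup>2 + (norm (g x))\<^sup>2)"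
    using assms by (intro Bochner_Integration.integrable_add L2_integrable_sq)
  show "(\<lambda>x. norm (f x) * norm (g x)) \<in> borel_measurable (lebesgue_on \<Omega>)" by measurable
  have "norm (f x) * norm (g x) \<le> (norm (f x))\<^sup>2 + (norm (g x))\<^sup>2" for x
    using sum_squares_bound[of "norm (f x)" "norm (g x)"] mult_nonneg_nonneg[OF norm_ge_zero norm_ge_zero, of "f x" "g x"]
    by linarith
  then show "AE x in lebesgue_on \<Omega>. norm (norm (f x) * norm (g x)) \<le> norm ((norm (f x))\<^sup>2 + (norm (g x))\<^sup>2)"
    by (intro AE_I2) auto
qed

lemma integrable_L2_inner:
  assumes "L2 \<Omega> f" "L2 \<Omega> g"
  shows "integrable (lebesgue_on \<Omega>) (\<lambda>x. f x \<bullet> g x)"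
proof (rule Bochner_Integration.integrable_bound[OF integrable_L2_product[OF assms]])
  note [measurable] = assms[THEN L2_measurable]
  show "(\<lambda>x. f x \<bullet> g x) \<in> borel_measurable (lebesgue_on \<Omega>)" by measurable
qed (auto intro!: AE_I2 Cauchy_Schwarz_ineq2)

lemma integrable_L2_mult:
  "L2 \<Omega> f \<Longrightarrow> L2 \<Omega> g \<Longrightarrow> integrable (lebesgue_on \<Omega>) (\<lambda>x. f x * (g x :: real))"
  using integrable_L2_inner[of \<Omega> f g] by simp

lemma integrable_L2_scaleR:
  assumes "L2 \<Omega> f" "L2 \<Omega> g"
  shows "integrable (lebesgue_on \<Omega>) (\<lambda>x. (f x :: real) *\<^sub>R g x)"
proof (rule Bochner_Integration.integrable_bound[OF integrable_L2_product[OF assms]])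
  note [measurable] = assms[THEN L2_measurable]
  show "(\<lambda>x. f x *\<^sub>R g x) \<in> borel_measurable (lebesgue_on \<Omega>)" by measurable
qed auto

lemma L2_Cauchy_Schwarz:
  assumes "L2 \<Omega> f" "L2 \<Omega> g"
  shows "(\<integral>x. norm (f x) * norm (g x) \<partial>lebesgue_on \<Omega>)\<^sup>2
    \<le> (\<integral>x. (norm (f x))\<^sup>2 \<partial>lebesgue_on \<Omega>) * (\<integral>x. (norm (g x))\<^sup>2 \<partial>lebesgue_on \<Omega>)"
proof -
  note [measurable] = assms[THEN L2_measurable]
  let ?M = "lebesgue_on \<Omega>"
  have "(\<integral>\<^sup>+x. ennreal (norm (f x)) * ennreal (norm (g x)) \<partial>?M)\<^sup>2
    \<le> (\<integral>\<^sup>+x. (ennreal (norm (f x)))\<^sup>2 \<partial>?M) * (\<integral>\<^sup>+x. (ennreal (norm (g x)))\<^sup>2 \<partial>?M)"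
    by (intro Cauchy_Schwarz_nn_integral) measurable
  then have "(ennreal (\<integral>x. norm (f x) * norm (g x) \<partial>?M))\<^sup>2
    \<le> ennreal (\<integral>x. (norm (f x))\<^sup>2 \<partial>?M) * ennreal (\<integral>x. (norm (g x))\<^sup>2 \<partial>?M)"
    using integrable_L2_product[OF assms] assms[THEN L2_integrable_sq]
    by (simp add: ennreal_mult[symmetric] ennreal_power nn_integral_eq_integral)
  then show ?thesis by (simp add: ennreal_mult[symmetric] ennreal_power)
qed

subsection \<open>Convergence in the mean\<close>

text \<open>The filter is arbitrary because limits are taken both along sequences of test functions and
  as the coupling parameter tends to infinity; functions need to be square integrable only
  eventually.\<close>

definition L2_lim ::
  "(real^'n) set \<Rightarrow> 'a filter \<Rightarrow> ('a \<Rightarrow> real^'n \<Rightarrow> 'b::euclidean_space) \<Rightarrow> (real^'n \<Rightarrow> 'b) \<Rightarrow> bool" where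
  "L2_lim \<Omega> F f l \<longleftrightarrow> eventually (\<lambda>m. L2 \<Omega> (f m)) F \<and> L2 \<Omega> l \<and>
     ((\<lambda>m. \<integral>x. (norm (f m x - l x))\<^sup>2 \<partial>lebesgue_on \<Omega>) \<longlongrightarrow> 0) F"

lemma L2_limD:
  assumes "L2_lim \<Omega> F f l"
  shows "eventually (\<lambda>m. L2 \<Omega> (f m)) F" "L2 \<Omega> l"
    "((\<lambda>m. \<integral>x. (norm (f m x - l x))\<^sup>2 \<partial>lebesgue_on \<Omega>) \<longlongrightarrow> 0) F"
  using assms by (auto simp: L2_lim_def)

lemma L2_limI_bound:
  assumes "eventually (\<lambda>m. L2 \<Omega> (f m)) F" "L2 \<Omega> l"
    and "eventually (\<lambda>m. (\<integral>x. (norm (f m x - l x))\<^sup>2 \<partial>lebesgue_on \<Omega>) \<le> e m) F" "(e \<longlongrightarrow> 0) F"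
  shows "L2_lim \<Omega> F f l"
  unfolding L2_lim_def
  by (intro conjI assms tendsto_sandwich[OF _ assms(3) tendsto_const assms(4)]) auto

lemma L2_lim_const: "L2 \<Omega> l \<Longrightarrow> L2_lim \<Omega> F (\<lambda>_. l) l"
  by (simp add: L2_lim_def)

lemma L2_lim_add:
  assumes "L2_lim \<Omega> F f l" "L2_lim \<Omega> F f' l'"
  shows "L2_lim \<Omega> F (\<lambda>m x. f m x + f' m x) (\<lambda>x. l x + l' x)"
proof (rule L2_limI_bound)
  let ?e = "\<lambda>f l m. \<integral>x. (norm (f m x - l x))\<^sup>2 \<partial>lebesgue_on \<Omega>"
  note L = L2_limD[OF assms(1)] L2_limD[OF assms(2)]
  show "eventually (\<lambda>m. L2 \<Omega> (\<lambda>x. f m x + f' m x)) F"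
    using L(1,4) by eventually_elim (rule L2_add)
  show "L2 \<Omega> (\<lambda>x. l x + l' x)" using L by (intro L2_add)
  show "eventually (\<lambda>m. ?e (\<lambda>m x. f m x + f' m x) (\<lambda>x. l x + l' x) m \<le> 2 * ?e f l m + 2 * ?e f' l' m) F"
    using L(1,4)
  proof eventually_elim
    case (elim m)
    have i: "integrable (lebesgue_on \<Omega>) (\<lambda>x. (norm (f m x - l x))\<^sup>2)"
      "integrable (lebesgue_on \<Omega>) (\<lambda>x. (norm (f' m x - l' x))\<^sup>2)"
      using elim L by (auto intro!: L2_integrable_sq L2_diff)
    have "?e (\<lambda>m x. f m x + f' m x) (\<lambda>x. l x + l' x) m
      \<le> (\<integral>x. 2 * (norm (f m x - l x))\<^sup>2 + 2 * (norm (f' m x - l' x))\<^sup>2 \<partial>lebesgue_on \<Omega>)"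
      using norm_add_sq_le[of "f m _ - l _" "f' m _ - l' _"]
      by (intro integral_mono') (auto intro!: Bochner_Integration.integrable_add integrable_mult_right i simp: algebra_simps)
    then show ?case using i by simp
  qed
  show "((\<lambda>m. 2 * ?e f l m + 2 * ?e f' l' m) \<longlongrightarrow> 0) F"
    using tendsto_add[OF tendsto_mult[OF tendsto_const[of 2] L(3)] tendsto_mult[OF tendsto_const[of 2] L(6)]] by simp
qed

lemma L2_lim_bounded_mult:
  fixes h :: "real^'n \<Rightarrow> real"
  assumes "L2_lim \<Omega> F f l" and h: "h \<in> borel_measurable (lebesgue_on \<Omega>)" "\<And>x. \<bar>h x\<bar> \<le> B"
  shows "L2_lim \<Omega> F (\<lambda>m x. h x *\<^sub>R f m x) (\<lambda>x. h x *\<^sub>R l x)"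
proof (rule L2_limI_bound)
  let ?e = "\<lambda>f l m. \<integral>x. (norm (f m x - l x))\<^sup>2 \<partial>lebesgue_on \<Omega>"
  note L = L2_limD[OF assms(1)]
  show "eventually (\<lambda>m. L2 \<Omega> (\<lambda>x. h x *\<^sub>R f m x)) F"
    using L(1) by eventually_elim (rule L2_bounded_mult[OF _ h])
  show "L2 \<Omega> (\<lambda>x. h x *\<^sub>R l x)" by (rule L2_bounded_mult[OF L(2) h])
  show "eventually (\<lambda>m. ?e (\<lambda>m x. h x *\<^sub>R f m x) (\<lambda>x. h x *\<^sub>R l x) m \<le> B\<^sup>2 * ?e f l m) F"
    using L(1)
  proof eventually_elim
    case (elim m)
    have i: "integrable (lebesgue_on \<Omega>) (\<lambda>x. (norm (f m x - l x))\<^sup>2)"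
      using elim L by (auto intro!: L2_integrable_sq L2_diff)
    have "(norm (h x *\<^sub>R f m x - h x *\<^sub>R l x))\<^sup>2 \<le> B\<^sup>2 * (norm (f m x - l x))\<^sup>2" for x
      using power_mono[OF h(2)[of x], of 2]
      by (auto simp: scaleR_diff_right[symmetric] power_mult_distrib intro!: mult_right_mono)
    then have "?e (\<lambda>m x. h x *\<^sub>R f m x) (\<lambda>x. h x *\<^sub>R l x) m \<le> (\<integral>x. B\<^sup>2 * (norm (f m x - l x))\<^sup>2 \<partial>lebesgue_on \<Omega>)"
      using i by (intro integral_mono') auto
    then show ?case by simp
  qed
  show "((\<lambda>m. B\<^sup>2 * ?e f l m) \<longlongrightarrow> 0) F"
    using tendsto_mult[OF tendsto_const L(3)] by simp
qed

lemma L2_lim_product: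
  assumes "L2_lim \<Omega> F f l" "L2 \<Omega> g"
  shows "((\<lambda>m. \<integral>x. norm (f m x - l x) * norm (g x) \<partial>lebesgue_on \<Omega>) \<longlongrightarrow> 0) F"
proof -
  let ?P = "\<lambda>m. \<integral>x. norm (f m x - l x) * norm (g x) \<partial>lebesgue_on \<Omega>"
  let ?G = "\<integral>x. (norm (g x))\<^sup>2 \<partial>lebesgue_on \<Omega>"
  note L = L2_limD[OF assms(1)]
  have "((\<lambda>m. (?P m)\<^sup>2) \<longlongrightarrow> 0) F"
  proof (rule tendsto_sandwich[OF _ _ tendsto_const])
    show "eventually (\<lambda>m. (?P m)\<^sup>2 \<le> (\<integral>x. (norm (f m x - l x))\<^sup>2 \<partial>lebesgue_on \<Omega>) * ?G) F"
      using L(1) by eventually_elim (intro L2_Cauchy_Schwarz L2_diff L(2) assms)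
    show "((\<lambda>m. (\<integral>x. (norm (f m x - l x))\<^sup>2 \<partial>lebesgue_on \<Omega>) * ?G) \<longlongrightarrow> 0) F"
      using tendsto_mult[OF L(3) tendsto_const] by simp
  qed auto
  then have "((\<lambda>m. sqrt ((?P m)\<^sup>2)) \<longlongrightarrow> sqrt 0) F" by (rule tendsto_real_sqrt)
  then show ?thesis by (simp add: tendsto_rabs_zero_iff)
qed

lemma L2_lim_scaleR_integral:
  assumes "L2_lim \<Omega> F f l" "L2 \<Omega> g"
  shows "((\<lambda>m. \<integral>x. (g x :: real) *\<^sub>R f m x \<partial>lebesgue_on \<Omega>) \<longlongrightarrow> (\<integral>x. g x *\<^sub>R l x \<partial>lebesgue_on \<Omega>)) F"
proof -
  note L = L2_limD[OF assms(1)]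
  have "((\<lambda>m. (\<integral>x. g x *\<^sub>R f m x \<partial>lebesgue_on \<Omega>) - (\<integral>x. g x *\<^sub>R l x \<partial>lebesgue_on \<Omega>)) \<longlongrightarrow> 0) F"
  proof (rule Lim_null_comparison[OF _ L2_lim_product[OF assms]])
    show "eventually (\<lambda>m. norm ((\<integral>x. g x *\<^sub>R f m x \<partial>lebesgue_on \<Omega>) - (\<integral>x. g x *\<^sub>R l x \<partial>lebesgue_on \<Omega>))
       \<le> (\<integral>x. norm (f m x - l x) * norm (g x) \<partial>lebesgue_on \<Omega>)) F"
      using L(1)
    proof eventually_elim
      case (elim m)
      have "(\<integral>x. g x *\<^sub>R f m x \<partial>lebesgue_on \<Omega>) - (\<integral>x. g x *\<^sub>R l x \<partial>lebesgue_on \<Omega>)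
         = (\<integral>x. g x *\<^sub>R (f m x - l x) \<partial>lebesgue_on \<Omega>)"
        using elim L(2) assms(2)
        by (simp add: scaleR_diff_right integrable_L2_scaleR Bochner_Integration.integral_diff)
      also have "norm \<dots> \<le> (\<integral>x. norm (g x *\<^sub>R (f m x - l x)) \<partial>lebesgue_on \<Omega>)" by (rule integral_norm_bound)
      finally show ?case by (simp add: mult.commute)
    qed
  qed
  then show ?thesis by (rule LIM_zero_cancel)
qed

text \<open>Expanding \<open>norm p\<^sup>2 - norm q\<^sup>2\<close> around \<open>q\<close> leaves a quadratic error and a product that
  the Cauchy-Schwarz inequality controls.\<close>

lemma L2_lim_weighted_sq:
  fixes a :: "real^'n \<Rightarrow> real" and f :: "'a \<Rightarrow> real^'n \<Rightarrow> 'b::euclidean_space"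
  assumes "L2_lim \<Omega> F f l" and a: "a \<in> borel_measurable (lebesgue_on \<Omega>)" "\<And>x. \<bar>a x\<bar> \<le> A"
  shows "((\<lambda>m. \<integral>x. a x * (norm (f m x))\<^sup>2 \<partial>lebesgue_on \<Omega>) \<longlongrightarrow> (\<integral>x. a x * (norm (l x))\<^sup>2 \<partial>lebesgue_on \<Omega>)) F"
proof -
  note L = L2_limD[OF assms(1)]
  have A: "A \<ge> 0" using a(2) abs_ge_zero order_trans by blast
  let ?e = "\<lambda>m. \<integral>x. (norm (f m x - l x))\<^sup>2 \<partial>lebesgue_on \<Omega>"
  let ?p = "\<lambda>m. \<integral>x. norm (f m x - l x) * norm (l x) \<partial>lebesgue_on \<Omega>"
  have ai: "integrable (lebesgue_on \<Omega>) (\<lambda>x. a x * (norm (g x))\<^sup>2)" if "L2 \<Omega> g" for g :: "real^'n \<Rightarrow> 'b"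
  proof (rule Bochner_Integration.integrable_bound)
    show "integrable (lebesgue_on \<Omega>) (\<lambda>x. A * (norm (g x))\<^sup>2)" using that by (intro integrable_mult_right L2_integrable_sq)
    show "(\<lambda>x. a x * (norm (g x))\<^sup>2) \<in> borel_measurable (lebesgue_on \<Omega>)"
      using a(1) that[THEN L2_measurable] by measurable
  qed (use a A in \<open>auto intro!: AE_I2 mult_right_mono simp: abs_mult\<close>)
  have pt: "\<bar>(norm p)\<^sup>2 - (norm q)\<^sup>2\<bar> \<le> (norm (p - q))\<^sup>2 + 2 * (norm (p - q) * norm q)" for p q :: 'b
  proof -
    have "(norm p)\<^sup>2 = (norm (p - q))\<^sup>2 + 2 * ((p - q) \<bullet> q) + (norm q)\<^sup>2"
      by (simp add: power2_norm_eq_inner inner_diff_left inner_diff_right inner_commute)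
    moreover have "0 \<le> (norm (p - q))\<^sup>2" by simp
    ultimately show ?thesis using Cauchy_Schwarz_ineq2[of "p - q" q] by linarith
  qed
  have "((\<lambda>m. (\<integral>x. a x * (norm (f m x))\<^sup>2 \<partial>lebesgue_on \<Omega>) - (\<integral>x. a x * (norm (l x))\<^sup>2 \<partial>lebesgue_on \<Omega>)) \<longlongrightarrow> 0) F"
  proof (rule Lim_null_comparison)
    show "((\<lambda>m. A * (?e m + 2 * ?p m)) \<longlongrightarrow> 0) F"
      using tendsto_mult[OF tendsto_const[of A] tendsto_add[OF L(3) tendsto_mult[OF tendsto_const[of 2] L2_lim_product[OF assms(1) L(2)]]]] by simp
    show "eventually (\<lambda>m. norm ((\<integral>x. a x * (norm (f m x))\<^sup>2 \<partial>lebesgue_on \<Omega>) - (\<integral>x. a x * (norm (l x))\<^sup>2 \<partial>lebesgue_on \<Omega>))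
        \<le> A * (?e m + 2 * ?p m)) F"
      using L(1)
    proof eventually_elim
      case (elim m)
      have i: "integrable (lebesgue_on \<Omega>) (\<lambda>x. (norm (f m x - l x))\<^sup>2)"
        "integrable (lebesgue_on \<Omega>) (\<lambda>x. norm (f m x - l x) * norm (l x))"
        using elim L by (auto intro!: L2_integrable_sq L2_diff integrable_L2_product)
      have "(\<integral>x. a x * (norm (f m x))\<^sup>2 \<partial>lebesgue_on \<Omega>) - (\<integral>x. a x * (norm (l x))\<^sup>2 \<partial>lebesgue_on \<Omega>)
         = (\<integral>x. a x * (norm (f m x))\<^sup>2 - a x * (norm (l x))\<^sup>2 \<partial>lebesgue_on \<Omega>)"
        using ai elim L by simp
      also have "norm \<dots> \<le> (\<integral>x. norm (a x * (norm (f m x))\<^sup>2 - a x * (norm (l x))\<^sup>2) \<partial>lebesgue_on \<Omega>)" by (rule integral_norm_bound)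
      also have "\<dots> \<le> (\<integral>x. A * ((norm (f m x - l x))\<^sup>2 + 2 * (norm (f m x - l x) * norm (l x))) \<partial>lebesgue_on \<Omega>)"
      proof (rule integral_mono')
        show "norm (a x * (norm (f m x))\<^sup>2 - a x * (norm (l x))\<^sup>2) \<le> A * ((norm (f m x - l x))\<^sup>2 + 2 * (norm (f m x - l x) * norm (l x)))" for x
          unfolding right_diff_distrib[symmetric] real_norm_def abs_mult
          using a(2)[of x] pt[of "f m x" "l x"] A by (intro mult_mono) auto
      qed (use i A in \<open>auto intro!: Bochner_Integration.integrable_add integrable_mult_right\<close>)
      also have "\<dots> = A * (?e m + 2 * ?p m)" using i by simp
      finally show ?case .
    qed
  qed
  then show ?thesis by (rule LIM_zero_cancel)
qed

lemma L2_mult_bounded_vector: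
  fixes k :: "real^'n \<Rightarrow> 'b::euclidean_space"
  assumes "L2 \<Omega> f" and k: "k \<in> borel_measurable (lebesgue_on \<Omega>)" "\<And>x. norm (k x) \<le> B"
  shows "L2 \<Omega> (\<lambda>x. (f x :: real) *\<^sub>R k x)"
proof (rule L2_bound[where w="\<lambda>x. B\<^sup>2 * (norm (f x))\<^sup>2"])
  show "AE x in lebesgue_on \<Omega>. (norm (f x *\<^sub>R k x))\<^sup>2 \<le> B\<^sup>2 * (norm (f x))\<^sup>2"
  proof (intro AE_I2)
    fix x
    show "(norm (f x *\<^sub>R k x))\<^sup>2 \<le> B\<^sup>2 * (norm (f x))\<^sup>2"
      using mult_right_mono[OF power_mono[OF k(2)[of x], of 2], of "(f x)\<^sup>2"] by (simp add: power_mult_distrib mult.commute)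
  qed
  show "(\<lambda>x. f x *\<^sub>R k x) \<in> borel_measurable (lebesgue_on \<Omega>)"
    by (intro borel_measurable_scaleR L2_measurable assms)
  show "integrable (lebesgue_on \<Omega>) (\<lambda>x. B\<^sup>2 * (norm (f x))\<^sup>2)"
    by (intro integrable_mult_right L2_integrable_sq assms)
qed

lemma L2_lim_mult_bounded_vector:
  fixes k :: "real^'n \<Rightarrow> 'b::euclidean_space"
  assumes "L2_lim \<Omega> F f l" and k: "k \<in> borel_measurable (lebesgue_on \<Omega>)" "\<And>x. norm (k x) \<le> B"
  shows "L2_lim \<Omega> F (\<lambda>m x. (f m x :: real) *\<^sub>R k x) (\<lambda>x. l x *\<^sub>R k x)"
proof (rule L2_limI_bound)
  note L = L2_limD[OF assms(1)]
  show "eventually (\<lambda>m. L2 \<Omega> (\<lambda>x. f m x *\<^sub>R k x)) F"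
    using L(1) by eventually_elim (rule L2_mult_bounded_vector[OF _ k])
  show "L2 \<Omega> (\<lambda>x. l x *\<^sub>R k x)" by (rule L2_mult_bounded_vector[OF L(2) k])
  show "eventually (\<lambda>m. (\<integral>x. (norm (f m x *\<^sub>R k x - l x *\<^sub>R k x))\<^sup>2 \<partial>lebesgue_on \<Omega>)
      \<le> B\<^sup>2 * (\<integral>x. (norm (f m x - l x))\<^sup>2 \<partial>lebesgue_on \<Omega>)) F"
    using L(1)
  proof eventually_elim
    case (elim m)
    have i: "integrable (lebesgue_on \<Omega>) (\<lambda>x. (norm (f m x - l x))\<^sup>2)"
      by (intro L2_integrable_sq L2_diff elim L)
    have "(norm (f m x *\<^sub>R k x - l x *\<^sub>R k x))\<^sup>2 \<le> B\<^sup>2 * (norm (f m x - l x))\<^sup>2" for x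
      using mult_right_mono[OF power_mono[OF k(2)[of x], of 2], of "(f m x - l x)\<^sup>2"]
      by (simp add: scaleR_diff_left[symmetric] power_mult_distrib mult.commute)
    then have "(\<integral>x. (norm (f m x *\<^sub>R k x - l x *\<^sub>R k x))\<^sup>2 \<partial>lebesgue_on \<Omega>)
        \<le> (\<integral>x. B\<^sup>2 * (norm (f m x - l x))\<^sup>2 \<partial>lebesgue_on \<Omega>)"
      using i by (intro integral_mono') auto
    then show ?case by simp
  qed
  show "((\<lambda>m. B\<^sup>2 * (\<integral>x. (norm (f m x - l x))\<^sup>2 \<partial>lebesgue_on \<Omega>)) \<longlongrightarrow> 0) F"
    using tendsto_mult[OF tendsto_const L(3)] by simp
qed

lemma L2_lim_integral_scaleR:
  assumes "L2_lim \<Omega> F f l" "L2 \<Omega> g"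
  shows "((\<lambda>m. \<integral>x. (f m x :: real) *\<^sub>R g x \<partial>lebesgue_on \<Omega>) \<longlongrightarrow> (\<integral>x. l x *\<^sub>R g x \<partial>lebesgue_on \<Omega>)) F"
proof -
  note L = L2_limD[OF assms(1)]
  have "((\<lambda>m. (\<integral>x. f m x *\<^sub>R g x \<partial>lebesgue_on \<Omega>) - (\<integral>x. l x *\<^sub>R g x \<partial>lebesgue_on \<Omega>)) \<longlongrightarrow> 0) F"
  proof (rule Lim_null_comparison[OF _ L2_lim_product[OF assms]])
    show "eventually (\<lambda>m. norm ((\<integral>x. f m x *\<^sub>R g x \<partial>lebesgue_on \<Omega>) - (\<integral>x. l x *\<^sub>R g x \<partial>lebesgue_on \<Omega>))
       \<le> (\<integral>x. norm (f m x - l x) * norm (g x) \<partial>lebesgue_on \<Omega>)) F"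
      using L(1)
    proof eventually_elim
      case (elim m)
      have "(\<integral>x. f m x *\<^sub>R g x \<partial>lebesgue_on \<Omega>) - (\<integral>x. l x *\<^sub>R g x \<partial>lebesgue_on \<Omega>)
         = (\<integral>x. (f m x - l x) *\<^sub>R g x \<partial>lebesgue_on \<Omega>)"
        using elim L(2) assms(2)
        by (simp add: scaleR_diff_left integrable_L2_scaleR Bochner_Integration.integral_diff)
      also have "norm \<dots> \<le> (\<integral>x. norm ((f m x - l x) *\<^sub>R g x) \<partial>lebesgue_on \<Omega>)" by (rule integral_norm_bound)
      finally show ?case by simp
    qed
  qed
  then show ?thesis by (rule LIM_zero_cancel)
qed

lemma L2_lim_AE_subseq:
  fixes f :: "nat \<Rightarrow> real^'n \<Rightarrow> real"
  assumes lim: "L2_lim \<Omega> sequentially f l" and L: "\<And>m. L2 \<Omega> (f m)"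
  obtains r :: "nat \<Rightarrow> nat" where "strict_mono r" "AE x in lebesgue_on \<Omega>. (\<lambda>n. f (r n) x) \<longlonglongrightarrow> l x"
proof -
  let ?M = "lebesgue_on \<Omega>"
  have d: "L2 \<Omega> (\<lambda>x. f m x - l x)" for m using L L2_limD(2)[OF lim] by (intro L2_diff)
  have "\<exists>r. strict_mono r \<and> (AE x in ?M. (\<lambda>n. (norm (f (r n) x - l x))\<^sup>2) \<longlonglongrightarrow> 0)"
    using tendsto_L1_AE_subseq[of ?M "\<lambda>m x. (norm (f m x - l x))\<^sup>2"] L2_integrable_sq[OF d] L2_limD(3)[OF lim] by auto
  then obtain r :: "nat \<Rightarrow> nat" where r: "strict_mono r" "AE x in ?M. (\<lambda>n. (norm (f (r n) x - l x))\<^sup>2) \<longlonglongrightarrow> 0" by blast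
  have "AE x in ?M. (\<lambda>n. f (r n) x) \<longlonglongrightarrow> l x"
    using r(2)
  proof eventually_elim
    case (elim x)
    have "(\<lambda>n. sqrt ((norm (f (r n) x - l x))\<^sup>2)) \<longlonglongrightarrow> sqrt 0" using elim by (rule tendsto_real_sqrt)
    then have "(\<lambda>n. f (r n) x - l x) \<longlonglongrightarrow> 0" by (simp add: tendsto_rabs_zero_iff)
    then show ?case by (rule LIM_zero_cancel)
  qed
  with r(1) show ?thesis by (rule that)
qed

lemma L2_lim_subseq:
  assumes "L2_lim \<Omega> sequentially f l" "strict_mono (r :: nat \<Rightarrow> nat)"
  shows "L2_lim \<Omega> sequentially (\<lambda>n. f (r n)) l"
proof -
  note L = L2_limD[OF assms(1)] and s = filterlim_subseq[OF assms(2)]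
  show ?thesis unfolding L2_lim_def
    using eventually_compose_filterlim[OF L(1) s] L(2) filterlim_compose[OF L(3) s] by simp
qed

lemma L2_lim_cong_AE:
  assumes lim: "L2_lim \<Omega> F f l" and AE: "AE x in lebesgue_on \<Omega>. l' x = l x"
    and m: "l' \<in> borel_measurable (lebesgue_on \<Omega>)"
  shows "L2_lim \<Omega> F f l'"
proof -
  note L = L2_limD[OF lim]
  have "eventually (\<lambda>m. (\<integral>x. (norm (f m x - l' x))\<^sup>2 \<partial>lebesgue_on \<Omega>) = (\<integral>x. (norm (f m x - l x))\<^sup>2 \<partial>lebesgue_on \<Omega>)) F"
    using L(1)
  proof eventually_elim
    case (elim k)
    note [measurable] = elim[THEN L2_measurable] L(2)[THEN L2_measurable] m
    show ?case by (rule integral_cong_AE) (use AE in auto)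
  qed
  then have "((\<lambda>m. \<integral>x. (norm (f m x - l' x))\<^sup>2 \<partial>lebesgue_on \<Omega>) \<longlongrightarrow> 0) F"
    using L(3) by (simp add: tendsto_cong)
  then show ?thesis using L(1) L2_cong_AE[OF L(2) AE m] by (simp add: L2_lim_def)
qed

text \<open>The multipliers converge only almost everywhere, so the product is split: the increment of
  the second factor is small in the mean, and the rest is handled by dominated convergence.\<close>

lemma L2_lim_mult_dominated:
  fixes a :: "nat \<Rightarrow> real^'n \<Rightarrow> real" and f :: "nat \<Rightarrow> real^'n \<Rightarrow> 'b::euclidean_space"
  assumes lim: "L2_lim \<Omega> sequentially f l"
    and m [measurable]: "\<And>k. a k \<in> borel_measurable (lebesgue_on \<Omega>)" "a0 \<in> borel_measurable (lebesgue_on \<Omega>)"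
    and b: "\<And>k x. \<bar>a k x\<bar> \<le> A" "\<And>x. \<bar>a0 x\<bar> \<le> A"
    and conv: "AE x in lebesgue_on \<Omega>. (\<lambda>k. a k x) \<longlonglongrightarrow> a0 x"
  shows "L2_lim \<Omega> sequentially (\<lambda>k x. a k x *\<^sub>R f k x) (\<lambda>x. a0 x *\<^sub>R l x)"
proof -
  let ?M = "lebesgue_on \<Omega>"
  note L = L2_limD[OF lim]
  note [measurable] = L(2)[THEN L2_measurable]
  have Ll: "L2 \<Omega> (\<lambda>x. a k x *\<^sub>R l x)" for k by (rule L2_bounded_mult[OF L(2) m(1) b(1)])
  have L0: "L2 \<Omega> (\<lambda>x. a0 x *\<^sub>R l x)" by (rule L2_bounded_mult[OF L(2) m(2) b(2)])
  have 1: "L2_lim \<Omega> sequentially (\<lambda>k x. a k x *\<^sub>R (f k x - l x)) (\<lambda>x. 0)"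
  proof (rule L2_limI_bound)
    show "eventually (\<lambda>k. L2 \<Omega> (\<lambda>x. a k x *\<^sub>R (f k x - l x))) sequentially"
      using L(1) by eventually_elim (intro L2_bounded_mult[OF _ m(1) b(1)] L2_diff L(2))
    show "L2 \<Omega> (\<lambda>x. 0 :: 'b)" by (simp add: L2_def)
    show "eventually (\<lambda>k. (\<integral>x. (norm (a k x *\<^sub>R (f k x - l x) - 0))\<^sup>2 \<partial>?M) \<le> A\<^sup>2 * (\<integral>x. (norm (f k x - l x))\<^sup>2 \<partial>?M)) sequentially"
      using L(1)
    proof eventually_elim
      case (elim k)
      have i: "integrable ?M (\<lambda>x. (norm (f k x - l x))\<^sup>2)" by (intro L2_integrable_sq L2_diff elim L(2))
      have "(norm (a k x *\<^sub>R (f k x - l x) - 0))\<^sup>2 \<le> A\<^sup>2 * (norm (f k x - l x))\<^sup>2" for x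
        using mult_right_mono[OF power_mono[OF b(1)[of k x], of 2], of "(norm (f k x - l x))\<^sup>2"]
        by (simp add: power_mult_distrib)
      then have "(\<integral>x. (norm (a k x *\<^sub>R (f k x - l x) - 0))\<^sup>2 \<partial>?M) \<le> (\<integral>x. A\<^sup>2 * (norm (f k x - l x))\<^sup>2 \<partial>?M)"
        using i by (intro integral_mono') auto
      then show ?case by simp
    qed
    show "(\<lambda>k. A\<^sup>2 * (\<integral>x. (norm (f k x - l x))\<^sup>2 \<partial>?M)) \<longlonglongrightarrow> 0"
      using tendsto_mult[OF tendsto_const L(3)] by simp
  qed
  have "(\<lambda>k. \<integral>x. (norm (a k x *\<^sub>R l x - a0 x *\<^sub>R l x))\<^sup>2 \<partial>?M) \<longlonglongrightarrow> (\<integral>x. 0 \<partial>?M)"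
  proof (rule integral_dominated_convergence[where w="\<lambda>x. (2 * A)\<^sup>2 * (norm (l x))\<^sup>2"])
    show "integrable ?M (\<lambda>x. (2 * A)\<^sup>2 * (norm (l x))\<^sup>2)" by (intro integrable_mult_right L2_integrable_sq L(2))
    show "AE x in ?M. (\<lambda>k. (norm (a k x *\<^sub>R l x - a0 x *\<^sub>R l x))\<^sup>2) \<longlonglongrightarrow> 0"
      using conv
    proof eventually_elim
      case (elim x)
      have "(\<lambda>k. (norm (a k x *\<^sub>R l x - a0 x *\<^sub>R l x))\<^sup>2) \<longlonglongrightarrow> (norm (a0 x *\<^sub>R l x - a0 x *\<^sub>R l x))\<^sup>2"
        by (intro tendsto_intros elim)
      then show ?case by simp
    qed
    show "AE x in ?M. norm ((norm (a k x *\<^sub>R l x - a0 x *\<^sub>R l x))\<^sup>2) \<le> (2 * A)\<^sup>2 * (norm (l x))\<^sup>2" for k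
    proof (intro AE_I2)
      fix x
      have "\<bar>a k x - a0 x\<bar> \<le> 2 * A" using b(1)[of k x] b(2)[of x] by linarith
      then show "norm ((norm (a k x *\<^sub>R l x - a0 x *\<^sub>R l x))\<^sup>2) \<le> (2 * A)\<^sup>2 * (norm (l x))\<^sup>2"
        using mult_right_mono[OF power_mono[of "\<bar>a k x - a0 x\<bar>" "2 * A" 2], of "(norm (l x))\<^sup>2"]
        by (simp add: scaleR_diff_left[symmetric] power_mult_distrib)
    qed
  qed measurable
  then have 2: "L2_lim \<Omega> sequentially (\<lambda>k x. a k x *\<^sub>R l x) (\<lambda>x. a0 x *\<^sub>R l x)"
    using Ll L0 by (simp add: L2_lim_def)
  have "(\<lambda>k x. a k x *\<^sub>R (f k x - l x) + a k x *\<^sub>R l x) = (\<lambda>k x. a k x *\<^sub>R f k x)"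
    by (simp add: scaleR_diff_right fun_eq_iff)
  then show ?thesis using L2_lim_add[OF 1 2] by simp
qed

subsection \<open>Test functions under the restricted Lebesgue measure\<close>

lemma continuous_measurable_lebesgue_on:
  fixes f :: "'a::euclidean_space \<Rightarrow> 'b::topological_space"
  shows "continuous_on UNIV f \<Longrightarrow> f \<in> borel_measurable (lebesgue_on \<Omega>)"
  by (intro measurable_restrict_space1 measurable_completion) (simp add: borel_measurable_continuous_onI)

lemma smooth_measurable: "smooth_on UNIV f \<Longrightarrow> f \<in> borel_measurable (lebesgue_on \<Omega>)"
  by (intro continuous_measurable_lebesgue_on smooth_on_continuous)

lemma grad_measurable: "smooth_on UNIV f \<Longrightarrow> grad f \<in> borel_measurable (lebesgue_on \<Omega>)"
  by (intro continuous_measurable_lebesgue_on continuous_grad)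

lemma lebesgue_on_compact_support:
  fixes f :: "'a::euclidean_space \<Rightarrow> 'b::{banach, second_countable_topology}"
  assumes f: "continuous_on UNIV f" "compact K" "\<And>x. x \<notin> K \<Longrightarrow> f x = 0"
    and \<Omega>: "\<Omega> \<in> sets lebesgue" "K \<subseteq> \<Omega>"
  shows "integrable (lebesgue_on \<Omega>) f" "integral\<^sup>L (lebesgue_on \<Omega>) f = integral\<^sup>L lborel f"
proof -
  have eq: "(\<lambda>x. indicator \<Omega> x *\<^sub>R f x) = f"
    using \<Omega>(2) f(3) by (auto simp: fun_eq_iff indicator_def)
  have m: "f \<in> borel_measurable lborel"
    using f(1) by (simp add: borel_measurable_continuous_onI)
  show "integrable (lebesgue_on \<Omega>) f"
    using integrable_compact_support[OF f] \<Omega>(1) m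
    by (subst integrable_restrict_space) (auto simp: eq integrable_completion)
  show "integral\<^sup>L (lebesgue_on \<Omega>) f = integral\<^sup>L lborel f"
    using \<Omega>(1) m by (subst integral_restrict_space) (auto simp: eq integral_completion)
qed

lemma test_fun_L2:
  assumes "test_fun \<Omega> \<phi>" "\<Omega> \<in> sets lebesgue"
  shows "L2 \<Omega> \<phi>" "L2 \<Omega> (grad \<phi>)"
proof -
  have sm: "smooth_on UNIV \<phi>" using assms by (auto dest: test_fun_smooth)
  obtain K where K: "compact K" "K \<subseteq> \<Omega>" "\<And>x. x \<notin> K \<Longrightarrow> \<phi> x = 0" "\<And>x. x \<notin> K \<Longrightarrow> grad \<phi> x = 0"
    using test_fun_support[OF assms(1)] by metis
  have "integrable (lebesgue_on \<Omega>) (\<lambda>x. (norm (\<phi> x))\<^sup>2)" "integrable (lebesgue_on \<Omega>) (\<lambda>x. (norm (grad \<phi> x))\<^sup>2)"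
    using K assms by (auto intro!: lebesgue_on_compact_support[of _ K] continuous_intros smooth_on_continuous[OF sm] continuous_grad[OF sm])
  then show "L2 \<Omega> \<phi>" "L2 \<Omega> (grad \<phi>)"
    using sm by (auto simp: L2_def smooth_measurable grad_measurable)
qed

lemma test_fun_integration_by_parts:
  assumes "test_fun \<Omega> \<phi>" "test_fun \<Omega> \<psi>" "\<Omega> \<in> sets lebesgue"
  shows "(\<integral>x. \<psi> x *\<^sub>R grad \<phi> x \<partial>lebesgue_on \<Omega>) = - (\<integral>x. \<phi> x *\<^sub>R grad \<psi> x \<partial>lebesgue_on \<Omega>)"
proof -
  have sm: "smooth_on UNIV \<phi>" "smooth_on UNIV \<psi>" using assms by (auto dest: test_fun_smooth)
  have i: "integrable (lebesgue_on \<Omega>) (\<lambda>x. \<phi> x *\<^sub>R grad \<psi> x)" "integrable (lebesgue_on \<Omega>) (\<lambda>x. \<psi> x *\<^sub>R grad \<phi> x)"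
    using assms by (auto intro!: integrable_L2_scaleR test_fun_L2)
  have t: "test_fun \<Omega> (\<lambda>x. \<phi> x * \<psi> x)" using assms by (intro test_fun_mult)
  obtain K where K: "compact K" "K \<subseteq> \<Omega>" "\<And>x. x \<notin> K \<Longrightarrow> grad (\<lambda>x. \<phi> x * \<psi> x) x = 0"
    using test_fun_support[OF t] by metis
  have "(\<integral>x. grad (\<lambda>x. \<phi> x * \<psi> x) x \<partial>lebesgue_on \<Omega>) = (\<integral>x. grad (\<lambda>x. \<phi> x * \<psi> x) x \<partial>lborel)"
    using K assms by (intro lebesgue_on_compact_support[of _ K] continuous_grad test_fun_smooth[OF t])
  also have "\<dots> = 0"
  proof -
    have int: "integrable lborel (grad (\<lambda>x. \<phi> x * \<psi> x))"
      using K by (intro integrable_compact_support[of _ K] continuous_grad test_fun_smooth[OF t])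
    have "(\<integral>x. grad (\<lambda>x. \<phi> x * \<psi> x) x \<partial>lborel) \<bullet> h = 0" for h
      using integral_grad_eq_0[OF t, of h] int by simp
    then show ?thesis by (metis inner_eq_zero_iff)
  qed
  finally have "(\<integral>x. \<phi> x *\<^sub>R grad \<psi> x + \<psi> x *\<^sub>R grad \<phi> x \<partial>lebesgue_on \<Omega>) = 0"
    by (simp add: grad_mult[OF sm])
  then show ?thesis using i by (simp add: eq_neg_iff_add_eq_0 add.commute)
qed

section \<open>Uniqueness of weak gradients\<close>

text \<open>Boxes form a generator of the Borel sets that is stable under intersection, so the integral
  vanishes over every Borel set.  Lebesgue measurable functions are first replaced by Borel
  representatives.\<close>

lemma integral_boxes_zero_imp_AE_zero:
  fixes h :: "'a::euclidean_space \<Rightarrow> real"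
  assumes h: "integrable lebesgue h"
    and box: "\<And>a b. (\<integral>x. indicator (box a b) x *\<^sub>R h x \<partial>lebesgue) = 0"
  shows "AE x in lebesgue. h x = 0"
proof -
  obtain h' where h': "h' \<in> borel_measurable lborel" "AE x in lborel. h x = h' x"
    using completion_ex_borel_measurable_real[of h lborel] h by auto
  note [measurable] = h'(1)
  have AE: "AE x in lebesgue. h x = h' x" using h'(2) by (rule AE_completion)
  have [measurable]: "h \<in> borel_measurable lebesgue" "h' \<in> borel_measurable lebesgue"
    using h h'(1) by (auto intro: measurable_completion)
  have int: "integrable lborel h'"
    using integrable_cong_AE[THEN iffD1, OF _ _ AE h] h'(1) by (simp add: integrable_completion)
  have transfer: "(\<integral>x. indicator A x *\<^sub>R h' x \<partial>lborel) = (\<integral>x. indicator A x *\<^sub>R h x \<partial>lebesgue)" if [measurable]: "A \<in> sets borel" for A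
  proof -
    have "(\<integral>x. indicator A x *\<^sub>R h x \<partial>lebesgue) = (\<integral>x. indicator A x *\<^sub>R h' x \<partial>lebesgue)"
    proof (rule integral_cong_AE)
      have [measurable]: "A \<in> sets lebesgue" by (simp add: that)
      show "(\<lambda>x. indicator A x *\<^sub>R h x) \<in> borel_measurable lebesgue"
        "(\<lambda>x. indicator A x *\<^sub>R h' x) \<in> borel_measurable lebesgue" by measurable
    qed (use AE in auto)
    then show ?thesis by (simp add: integral_completion)
  qed
  let ?G = "range (\<lambda>(a, b). box a b :: 'a set)"
  have total: "(\<integral>x. h' x \<partial>lborel) = 0"
  proof -
    have "(\<lambda>n. \<integral>x. indicator (box (- real n *\<^sub>R One) (real n *\<^sub>R One)) x *\<^sub>R h' x \<partial>lborel) \<longlonglongrightarrow> (\<integral>x. h' x \<partial>lborel)"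
    proof (rule integral_dominated_convergence[where w="\<lambda>x. norm (h' x)"])
      show "AE x in lborel. (\<lambda>n. indicator (box (- real n *\<^sub>R One) (real n *\<^sub>R One)) x *\<^sub>R h' x) \<longlonglongrightarrow> h' x"
      proof (intro AE_I2)
        fix x :: 'a
        have "eventually (\<lambda>n. real n > norm x) sequentially"
          using filterlim_real_sequentially by (simp add: filterlim_at_top_dense)
        then have "eventually (\<lambda>n. h' x = indicator (box (- real n *\<^sub>R One) (real n *\<^sub>R One)) x *\<^sub>R h' x) sequentially"
        proof eventually_elim
          case (elim n)
          have "\<bar>x \<bullet> i\<bar> < real n" if "i \<in> Basis" for i using Basis_le_norm[OF that, of x] elim by linarith
          then have "x \<in> box (- real n *\<^sub>R One) (real n *\<^sub>R One)" by (auto simp: mem_box abs_less_iff minus_less_iff)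
          then show ?case by simp
        qed
        then show "(\<lambda>n. indicator (box (- real n *\<^sub>R One) (real n *\<^sub>R One)) x *\<^sub>R h' x) \<longlonglongrightarrow> h' x"
          by (rule Lim_transform_eventually[OF tendsto_const])
      qed
    qed (use int in \<open>auto intro!: AE_I2 simp: indicator_def\<close>)
    then have "(\<lambda>n. 0) \<longlonglongrightarrow> (\<integral>x. h' x \<partial>lborel)" by (simp add: transfer[unfolded real_scaleR_def] box[unfolded real_scaleR_def])
    then show ?thesis by (rule LIMSEQ_unique[OF _ tendsto_const])
  qed
  have ii: "integrable lborel (\<lambda>x. indicator A x *\<^sub>R h' x)" if "A \<in> sets borel" for A
    using int that by (intro integrable_mult_indicator) auto
  have "(\<integral>x. indicator A x *\<^sub>R h' x \<partial>lborel) = 0" if A: "A \<in> sigma_sets UNIV ?G" for A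
  proof (rule sigma_sets_induct_disjoint[OF _ _ A])
    show "Int_stable ?G" by (auto simp: Int_stable_def box_Int_box)
    have sb: "B \<in> sets borel" if "B \<in> sigma_sets UNIV ?G" for B
      using that by (simp add: borel_eq_box sets_measure_of)
    show "(\<integral>x. indicator B x *\<^sub>R h' x \<partial>lborel) = 0" if "B \<in> ?G" for B
      using that box transfer by auto
    show "(\<integral>x. indicator (UNIV - B) x *\<^sub>R h' x \<partial>lborel) = 0"
      if "B \<in> sigma_sets UNIV ?G" "(\<integral>x. indicator B x *\<^sub>R h' x \<partial>lborel) = 0" for B
    proof -
      have "(\<integral>x. indicator (UNIV - B) x *\<^sub>R h' x \<partial>lborel) = (\<integral>x. h' x - indicator B x *\<^sub>R h' x \<partial>lborel)"
        by (intro Bochner_Integration.integral_cong) (auto simp: indicator_def)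
      then show ?thesis using that total int ii[OF sb] by (simp add: Bochner_Integration.integral_diff)
    qed
    show "(\<integral>x. indicator (\<Union>i. B i) x *\<^sub>R h' x \<partial>lborel) = 0"
      if B: "disjoint_family B" "range B \<subseteq> sigma_sets UNIV ?G" "\<And>i. (\<integral>x. indicator (B i) x *\<^sub>R h' x \<partial>lborel) = 0" for B :: "nat \<Rightarrow> 'a set"
    proof -
      have "set_lebesgue_integral lborel (\<Union>i. B i) h' = (\<Sum>i. set_lebesgue_integral lborel (B i) h')"
      proof (rule lebesgue_integral_countable_add)
        have Bb: "B i \<in> sets borel" for i using B(2) by (intro sb) blast
        show "B i \<in> sets lborel" for i using Bb by simp
        show "B i \<inter> B j = {}" if "i \<noteq> j" for i j using B(1) that by (auto simp: disjoint_family_on_def)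
        show "set_integrable lborel (\<Union> (range B)) h'"
          unfolding set_integrable_def by (intro ii sets.countable_UN) (use Bb in auto)
      qed
      then show ?thesis using B(3) by (simp add: set_lebesgue_integral_def)
    qed
  qed auto
  then have "(\<integral>x. indicator A x *\<^sub>R h' x \<partial>lborel) = 0" if "A \<in> sets borel" for A
    using that by (simp add: borel_eq_box sets_measure_of)
  then have "AE x in lborel. h' x = 0"
    using int by (intro density_unique_real) (auto simp: set_lebesgue_integral_def)
  then show ?thesis using h'(2) by (intro AE_completion) auto
qed

text \<open>The bumps on a box increase to its indicator, so orthogonality to test functions means
  that all integrals over small boxes vanish.\<close>

lemma fundamental_lemma:
  fixes \<Omega> :: "(real^'n) set"
  assumes \<Omega>: "open \<Omega>" and g: "L2 \<Omega> (g :: real^'n \<Rightarrow> real)"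
    and orth: "\<And>\<phi>. test_fun \<Omega> \<phi> \<Longrightarrow> (\<integral>x. \<phi> x * g x \<partial>lebesgue_on \<Omega>) = 0"
  shows "AE x in lebesgue_on \<Omega>. g x = 0"
proof -
  have \<Omega>m [measurable]: "\<Omega> \<in> sets lebesgue" using \<Omega> by simp
  note [measurable] = g[THEN L2_measurable]
  have ind: "integrable (lebesgue_on \<Omega>) (\<lambda>x. indicator (box a b) x * g x)"
    if "cbox a b \<subseteq> \<Omega>" for a b
  proof -
    have "(\<lambda>x. indicator \<Omega> x *\<^sub>R indicator (box a b) x :: real) = indicator (box a b)"
      using that box_subset_cbox[of a b] by (auto simp: indicator_def fun_eq_iff)
    moreover have "integrable lebesgue (indicator (box a b) :: real^'n \<Rightarrow> real)"
      by (simp add: emeasure_lborel_box_eq)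
    ultimately have "integrable (lebesgue_on \<Omega>) (indicator (box a b) :: real^'n \<Rightarrow> real)"
      by (subst integrable_restrict_space) simp_all
    moreover have "(\<lambda>x. (norm (indicator (box a b) x :: real))\<^sup>2) = indicator (box a b)"
      by (auto simp: indicator_def)
    ultimately have "L2 \<Omega> (indicator (box a b) :: real^'n \<Rightarrow> real)"
      by (simp add: L2_def borel_measurable_integrable)
    then show ?thesis using g by (rule integrable_L2_mult)
  qed
  have box0: "(\<integral>x. indicator (box a b) x * g x \<partial>lebesgue_on \<Omega>) = 0" if ab: "cbox a b \<subseteq> \<Omega>" for a b
  proof -
    have "(\<lambda>n. \<integral>x. box_bump (real n) a b x * g x \<partial>lebesgue_on \<Omega>) \<longlonglongrightarrow> (\<integral>x. indicator (box a b) x * g x \<partial>lebesgue_on \<Omega>)"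
    proof (rule integral_dominated_convergence[where w="\<lambda>x. norm (indicator (box a b) x * g x)"])
      show "(\<lambda>x. box_bump (real n) a b x * g x) \<in> borel_measurable (lebesgue_on \<Omega>)" for n
        by (intro borel_measurable_times smooth_measurable smooth_box_bump L2_measurable g)
      show "(\<lambda>x. indicator (box a b) x * g x) \<in> borel_measurable (lebesgue_on \<Omega>)"
        using ind[OF ab] by auto
      show "integrable (lebesgue_on \<Omega>) (\<lambda>x. norm (indicator (box a b) x * g x))"
        using ind[OF ab] by (rule integrable_norm)
      show "AE x in lebesgue_on \<Omega>. (\<lambda>n. box_bump (real n) a b x * g x) \<longlonglongrightarrow> indicator (box a b) x * g x"
        by (intro AE_I2 tendsto_mult box_bump_tendsto tendsto_const)
      show "AE x in lebesgue_on \<Omega>. norm (box_bump (real n) a b x * g x) \<le> norm (indicator (box a b) x * g x)" for n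
      proof (intro AE_I2)
        fix x
        show "norm (box_bump (real n) a b x * g x) \<le> norm (indicator (box a b) x * g x)"
          using box_bump_bounds[of "real n" a b x] box_bump_zero[of "real n" x a b]
          by (cases "x \<in> box a b") (auto simp: abs_mult intro!: mult_left_le_one_le)
      qed
    qed
    moreover have "(\<integral>x. box_bump (real n) a b x * g x \<partial>lebesgue_on \<Omega>) = 0" for n
      using ab by (intro orth test_fun_box_bump) auto
    ultimately have "(\<lambda>n::nat. 0) \<longlonglongrightarrow> (\<integral>x. indicator (box a b) x * g x \<partial>lebesgue_on \<Omega>)" by (simp only:)
    then show ?thesis by (rule LIMSEQ_unique[OF _ tendsto_const])
  qed
  have AEbox: "AE x in lebesgue. x \<in> box c d \<longrightarrow> g x = 0" if cd: "cbox c d \<subseteq> \<Omega>" for c d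
  proof -
    have eq: "indicator \<Omega> x *\<^sub>R (indicator (box c d) x * g x) = indicator (box c d) x * g x" for x
      using cd box_subset_cbox[of c d] by (auto simp: indicator_def)
    have "AE x in lebesgue. indicator (box c d) x * g x = 0"
    proof (rule integral_boxes_zero_imp_AE_zero)
      show "integrable lebesgue (\<lambda>x. indicator (box c d) x * g x)"
      proof -
        have "integrable lebesgue (\<lambda>x. indicator \<Omega> x *\<^sub>R (indicator (box c d) x * g x))"
          using ind[OF cd] by (subst (asm) integrable_restrict_space) simp_all
        then show ?thesis by (simp only: eq)
      qed
      fix a b :: "real^'n"
      obtain a' b' where ab': "box a b \<inter> box c d = box a' b'" by (rule that) (rule box_Int_box)
      have "(\<integral>x. indicator (box a b) x *\<^sub>R (indicator (box c d) x * g x) \<partial>lebesgue)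
          = (\<integral>x. indicator \<Omega> x *\<^sub>R (indicator (box a' b') x * g x) \<partial>lebesgue)"
      proof (intro Bochner_Integration.integral_cong refl)
        fix x
        show "indicator (box a b) x *\<^sub>R (indicator (box c d) x * g x) = indicator \<Omega> x *\<^sub>R (indicator (box a' b') x * g x)"
          using cd box_subset_cbox[of c d] by (auto simp: indicator_def ab'[symmetric])
      qed
      also have "\<dots> = (\<integral>x. indicator (box a' b') x * g x \<partial>lebesgue_on \<Omega>)"
        by (subst integral_restrict_space) simp_all
      also have "\<dots> = 0"
      proof (cases "box a' b' = {}")
        case False
        have "closure (box a' b') \<subseteq> closure (box c d)" using ab' by (intro closure_mono) auto
        also have "\<dots> \<subseteq> cbox c d" by (intro closure_minimal box_subset_cbox closed_cbox)
        finally have "cbox a' b' \<subseteq> \<Omega>" using cd False by (auto simp: closure_box)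
        then show ?thesis by (rule box0)
      qed simp
      finally show "(\<integral>x. indicator (box a b) x *\<^sub>R (indicator (box c d) x * g x) \<partial>lebesgue) = 0" .
    qed
    then show ?thesis by eventually_elim (auto simp: indicator_def split: if_splits)
  qed
  obtain D where D: "countable D" "D \<subseteq> Pow \<Omega>" "\<And>X. X \<in> D \<Longrightarrow> \<exists>a b. X = cbox a b" "\<Union>D = \<Omega>"
    by (rule open_countable_Union_open_cbox[OF \<Omega>]) (rule that)
  have "AE x in lebesgue. x \<in> X \<longrightarrow> g x = 0" if XD: "X \<in> D" for X
  proof -
    obtain c d where X: "X = cbox c d" using D(3)[OF XD] by blast
    have "cbox c d - box c d \<in> null_sets lebesgue"
      using negligible_frontier_interval by (simp add: negligible_iff_null_sets)
    then have "AE x in lebesgue. x \<notin> cbox c d - box c d" by (rule AE_not_in)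
    moreover have "AE x in lebesgue. x \<in> box c d \<longrightarrow> g x = 0" using D(2) XD X by (intro AEbox) auto
    ultimately show ?thesis unfolding X by eventually_elim auto
  qed
  then have "AE x in lebesgue. \<forall>X\<in>D. x \<in> X \<longrightarrow> g x = 0"
    by (intro AE_ball_countable[OF D(1), THEN iffD2] ballI)
  then have "AE x in lebesgue. x \<in> \<Omega> \<longrightarrow> g x = 0" by eventually_elim (use D(4) in blast)
  then show ?thesis by (subst AE_restrict_space_iff) simp_all
qed

lemma weak_grad_unique:
  fixes \<Omega> :: "(real^'n) set"
  assumes "open \<Omega>" "weak_grad \<Omega> u g" "weak_grad \<Omega> u h"
  shows "AE x in lebesgue_on \<Omega>. g x = h x"
proof -
  have gh: "L2 \<Omega> g" "L2 \<Omega> h" using assms by (auto simp: weak_grad_def)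
  have "AE x in lebesgue_on \<Omega>. (g x - h x) $ i = 0" for i
  proof (rule fundamental_lemma[OF assms(1)])
    show "L2 \<Omega> (\<lambda>x. (g x - h x) $ i)" using gh by (intro L2_nth L2_diff)
    fix \<phi> assume t: "test_fun \<Omega> \<phi>"
    have i: "integrable (lebesgue_on \<Omega>) (\<lambda>x. \<phi> x *\<^sub>R g x)" "integrable (lebesgue_on \<Omega>) (\<lambda>x. \<phi> x *\<^sub>R h x)"
      using test_fun_L2[OF t] gh assms(1) by (auto intro!: integrable_L2_scaleR)
    have "(\<integral>x. \<phi> x *\<^sub>R g x \<partial>lebesgue_on \<Omega>) = (\<integral>x. \<phi> x *\<^sub>R h x \<partial>lebesgue_on \<Omega>)"
      using assms(2,3) t by (simp add: weak_grad_def)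
    then have "(\<integral>x. \<phi> x *\<^sub>R (g x - h x) \<partial>lebesgue_on \<Omega>) = 0"
      using i by (simp add: scaleR_diff_right)
    moreover have "integrable (lebesgue_on \<Omega>) (\<lambda>x. \<phi> x *\<^sub>R (g x - h x))"
      using i by (simp add: scaleR_diff_right)
    ultimately have "(\<integral>x. (\<phi> x *\<^sub>R (g x - h x)) $ i \<partial>lebesgue_on \<Omega>) = 0"
      using integral_bounded_linear[OF bounded_linear_vec_nth, of "lebesgue_on \<Omega>" "\<lambda>x. \<phi> x *\<^sub>R (g x - h x)" i] by simp
    then show "(\<integral>x. \<phi> x * (g x - h x) $ i \<partial>lebesgue_on \<Omega>) = 0" by simp
  qed
  then have "AE x in lebesgue_on \<Omega>. \<forall>i. (g x - h x) $ i = 0" by (simp add: AE_all_countable)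
  then show ?thesis by eventually_elim (simp add: vec_eq_iff)
qed

section \<open>The space H10\<close>

text \<open>The pair of a function and its gradient as a limit of test functions and their gradients.
  Carrying the gradient along makes the relation linear and avoids the choice in
  \<^const>\<open>wgrad\<close>.\<close>

definition H10_pair :: "(real^'n) set \<Rightarrow> (real^'n \<Rightarrow> real) \<Rightarrow> (real^'n \<Rightarrow> real^'n) \<Rightarrow> bool" where
  "H10_pair \<Omega> u g \<longleftrightarrow> (\<exists>\<phi>. (\<forall>m::nat. test_fun \<Omega> (\<phi> m)) \<and>
     L2_lim \<Omega> sequentially \<phi> u \<and> L2_lim \<Omega> sequentially (\<lambda>m. grad (\<phi> m)) g)"

lemma H10_pairE:
  fixes \<Omega> :: "(real^'n) set"
  assumes "H10_pair \<Omega> u g"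
  obtains \<phi> :: "nat \<Rightarrow> real^'n \<Rightarrow> real" where "\<And>m. test_fun \<Omega> (\<phi> m)"
    "L2_lim \<Omega> sequentially \<phi> u" "L2_lim \<Omega> sequentially (\<lambda>m. grad (\<phi> m)) g"
  using assms by (auto simp: H10_pair_def)

lemma H10_pair_L2: "H10_pair \<Omega> u g \<Longrightarrow> L2 \<Omega> u" "H10_pair \<Omega> u g \<Longrightarrow> L2 \<Omega> g"
  by (auto simp: H10_pair_def L2_lim_def)

lemma H10_pair_test: "open \<Omega> \<Longrightarrow> test_fun \<Omega> \<phi> \<Longrightarrow> H10_pair \<Omega> \<phi> (grad \<phi>)"
  unfolding H10_pair_def by (intro exI[of _ "\<lambda>_. \<phi>"]) (auto intro!: L2_lim_const test_fun_L2)

lemma H10_pair_add: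
  fixes \<Omega> :: "(real^'n) set"
  assumes "H10_pair \<Omega> u g" "H10_pair \<Omega> v h"
  shows "H10_pair \<Omega> (\<lambda>x. u x + v x) (\<lambda>x. g x + h x)"
proof -
  obtain \<phi> :: "nat \<Rightarrow> real^'n \<Rightarrow> real" where 1: "\<And>m. test_fun \<Omega> (\<phi> m)"
    "L2_lim \<Omega> sequentially \<phi> u" "L2_lim \<Omega> sequentially (\<lambda>m. grad (\<phi> m)) g"
    using H10_pairE[OF assms(1)] by metis
  obtain \<psi> :: "nat \<Rightarrow> real^'n \<Rightarrow> real" where 2: "\<And>m. test_fun \<Omega> (\<psi> m)"
    "L2_lim \<Omega> sequentially \<psi> v" "L2_lim \<Omega> sequentially (\<lambda>m. grad (\<psi> m)) h"
    using H10_pairE[OF assms(2)] by metis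
  have "grad (\<lambda>x. \<phi> m x + \<psi> m x) = (\<lambda>x. grad (\<phi> m) x + grad (\<psi> m) x)" for m
    by (intro ext grad_add test_fun_smooth[OF 1(1)] test_fun_smooth[OF 2(1)])
  then show ?thesis unfolding H10_pair_def
    using 1 2 by (intro exI[of _ "\<lambda>m x. \<phi> m x + \<psi> m x"]) (auto intro!: test_fun_add L2_lim_add)
qed

lemma H10_pair_mult_smooth:
  fixes \<Omega> :: "(real^'n) set"
  assumes "open \<Omega>" "H10_pair \<Omega> u g" "smooth_on UNIV \<eta>" and b: "\<And>x. \<bar>\<eta> x\<bar> \<le> B" "\<And>x. norm (grad \<eta> x) \<le> B"
  shows "H10_pair \<Omega> (\<lambda>x. \<eta> x * u x) (\<lambda>x. \<eta> x *\<^sub>R g x + u x *\<^sub>R grad \<eta> x)"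
proof -
  obtain \<phi> :: "nat \<Rightarrow> real^'n \<Rightarrow> real" where 1: "\<And>m. test_fun \<Omega> (\<phi> m)"
    "L2_lim \<Omega> sequentially \<phi> u" "L2_lim \<Omega> sequentially (\<lambda>m. grad (\<phi> m)) g"
    using H10_pairE[OF assms(2)] by metis
  have eq: "grad (\<lambda>x. \<phi> m x * \<eta> x) = (\<lambda>x. \<eta> x *\<^sub>R grad (\<phi> m) x + \<phi> m x *\<^sub>R grad \<eta> x)" for m
    by (intro ext, subst grad_mult) (use assms 1(1) in \<open>auto intro: test_fun_smooth simp: add.commute\<close>)
  have m: "\<eta> \<in> borel_measurable (lebesgue_on \<Omega>)" using assms(3) by (rule smooth_measurable)
  have gm: "grad \<eta> \<in> borel_measurable (lebesgue_on \<Omega>)" using assms(3) by (rule grad_measurable)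
  have l1: "L2_lim \<Omega> sequentially (\<lambda>m x. \<eta> x *\<^sub>R \<phi> m x) (\<lambda>x. \<eta> x *\<^sub>R u x)"
    by (rule L2_lim_bounded_mult[OF 1(2) m b(1)])
  have l2: "L2_lim \<Omega> sequentially (\<lambda>m x. \<eta> x *\<^sub>R grad (\<phi> m) x) (\<lambda>x. \<eta> x *\<^sub>R g x)"
    by (rule L2_lim_bounded_mult[OF 1(3) m b(1)])
  have l3: "L2_lim \<Omega> sequentially (\<lambda>m x. \<phi> m x *\<^sub>R grad \<eta> x) (\<lambda>x. u x *\<^sub>R grad \<eta> x)"
    by (rule L2_lim_mult_bounded_vector[OF 1(2) gm b(2)])
  show ?thesis unfolding H10_pair_def
  proof (intro exI[of _ "\<lambda>m x. \<phi> m x * \<eta> x"] conjI allI)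
    show "test_fun \<Omega> (\<lambda>x. \<phi> m x * \<eta> x)" for m using 1(1) assms(3) by (rule test_fun_mult_smooth)
    show "L2_lim \<Omega> sequentially (\<lambda>m x. \<phi> m x * \<eta> x) (\<lambda>x. \<eta> x * u x)" using l1 by (simp add: mult.commute)
    show "L2_lim \<Omega> sequentially (\<lambda>m. grad (\<lambda>x. \<phi> m x * \<eta> x)) (\<lambda>x. \<eta> x *\<^sub>R g x + u x *\<^sub>R grad \<eta> x)"
      unfolding eq by (intro L2_lim_add l2 l3)
  qed
qed

lemma H10_pair_mult_test:
  fixes \<Omega> :: "(real^'n) set"
  assumes "open \<Omega>" "H10_pair \<Omega> u g" "test_fun \<Omega>' \<eta>"
  shows "H10_pair \<Omega> (\<lambda>x. \<eta> x * u x) (\<lambda>x. \<eta> x *\<^sub>R g x + u x *\<^sub>R grad \<eta> x)"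
proof -
  obtain A B where "\<forall>x. \<bar>\<eta> x\<bar> \<le> A" "\<forall>x. norm (grad \<eta> x) \<le> B"
    using test_fun_bounded[OF assms(3)] grad_bounded[OF assms(3)] by blast
  then have "\<bar>\<eta> x\<bar> \<le> max A B" "norm (grad \<eta> x) \<le> max A B" for x by (auto simp: le_max_iff_disj)
  then show ?thesis by (intro H10_pair_mult_smooth[where B="max A B"] assms test_fun_smooth[OF assms(3)])
qed

lemma H10_pair_scale:
  fixes \<Omega> :: "(real^'n) set"
  assumes "open \<Omega>" "H10_pair \<Omega> u g"
  shows "H10_pair \<Omega> (\<lambda>x. c * u x) (\<lambda>x. c *\<^sub>R g x)"
  using H10_pair_mult_smooth[OF assms smooth_on_const, of c "\<bar>c\<bar>"] by (simp add: grad_const)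

lemma H10_pair_diff:
  fixes \<Omega> :: "(real^'n) set"
  assumes "open \<Omega>" "H10_pair \<Omega> u g" "H10_pair \<Omega> v h"
  shows "H10_pair \<Omega> (\<lambda>x. u x - v x) (\<lambda>x. g x - h x)"
  using H10_pair_add[OF assms(2) H10_pair_scale[OF assms(1,3), of "-1"]] by simp

lemma H10_pair_weak_grad:
  fixes \<Omega> :: "(real^'n) set"
  assumes "open \<Omega>" "H10_pair \<Omega> u g"
  shows "weak_grad \<Omega> u g"
proof -
  obtain \<phi> :: "nat \<Rightarrow> real^'n \<Rightarrow> real" where 1: "\<And>m. test_fun \<Omega> (\<phi> m)"
    "L2_lim \<Omega> sequentially \<phi> u" "L2_lim \<Omega> sequentially (\<lambda>m. grad (\<phi> m)) g"
    using H10_pairE[OF assms(2)] by metis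
  have "(\<integral>x. u x *\<^sub>R grad \<psi> x \<partial>lebesgue_on \<Omega>) = - (\<integral>x. \<psi> x *\<^sub>R g x \<partial>lebesgue_on \<Omega>)" if t: "test_fun \<Omega> \<psi>" for \<psi>
  proof -
    obtain B where B: "\<And>x. norm (grad \<psi> x) \<le> B" using grad_bounded[OF t] by blast
    have L: "L2 \<Omega> \<psi>" "L2 \<Omega> (grad \<psi>)" using t assms(1) by (auto intro: test_fun_L2)
    have "(\<lambda>m. - (\<integral>x. \<psi> x *\<^sub>R grad (\<phi> m) x \<partial>lebesgue_on \<Omega>)) \<longlonglongrightarrow> - (\<integral>x. \<psi> x *\<^sub>R g x \<partial>lebesgue_on \<Omega>)"
      by (intro tendsto_minus L2_lim_scaleR_integral 1 L)
    moreover have "- (\<integral>x. \<psi> x *\<^sub>R grad (\<phi> m) x \<partial>lebesgue_on \<Omega>) = (\<integral>x. \<phi> m x *\<^sub>R grad \<psi> x \<partial>lebesgue_on \<Omega>)" for m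
      using test_fun_integration_by_parts[OF t 1(1)] assms(1) by simp
    ultimately have "(\<lambda>m. \<integral>x. \<phi> m x *\<^sub>R grad \<psi> x \<partial>lebesgue_on \<Omega>) \<longlonglongrightarrow> - (\<integral>x. \<psi> x *\<^sub>R g x \<partial>lebesgue_on \<Omega>)" by simp
    moreover have "(\<lambda>m. \<integral>x. \<phi> m x *\<^sub>R grad \<psi> x \<partial>lebesgue_on \<Omega>) \<longlonglongrightarrow> (\<integral>x. u x *\<^sub>R grad \<psi> x \<partial>lebesgue_on \<Omega>)"
      by (rule L2_lim_integral_scaleR[OF 1(2) L(2)])
    ultimately show ?thesis by (rule LIMSEQ_unique[symmetric])
  qed
  then show ?thesis 
    unfolding weak_grad_def by (intro conjI allI impI H10_pair_L2(2)[OF assms(2)])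
qed

lemma wgrad_weak_grad: "u \<in> H1 \<Omega> \<Longrightarrow> weak_grad \<Omega> u (wgrad \<Omega> u)"
  unfolding wgrad_def H1_def using someI_ex[of "weak_grad \<Omega> u"] by simp

lemma weak_grad_wgrad: "weak_grad \<Omega> u g \<Longrightarrow> weak_grad \<Omega> u (wgrad \<Omega> u)"
  unfolding wgrad_def using someI[of "weak_grad \<Omega> u"] by simp

lemma wgrad_AE_eq: "open \<Omega> \<Longrightarrow> weak_grad \<Omega> u g \<Longrightarrow> AE x in lebesgue_on \<Omega>. wgrad \<Omega> u x = g x"
  using weak_grad_unique weak_grad_wgrad by blast

lemma H1_norm_diff_test_sq:
  fixes \<Omega> :: "(real^'n) set"
  assumes \<Omega>: "open \<Omega>" and u: "L2 \<Omega> u" "weak_grad \<Omega> u g" and \<phi>: "test_fun \<Omega> \<phi>"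
  shows "(H1_norm \<Omega> (u - \<phi>))\<^sup>2 = (\<integral>x. (norm (\<phi> x - u x))\<^sup>2 \<partial>lebesgue_on \<Omega>)
      + (\<integral>x. (norm (grad \<phi> x - g x))\<^sup>2 \<partial>lebesgue_on \<Omega>)"
proof -
  have L: "L2 \<Omega> g" using u(2) by (simp add: weak_grad_def)
  have Lm: "L2 \<Omega> \<phi>" "L2 \<Omega> (grad \<phi>)" using \<phi> \<Omega> by (auto intro: test_fun_L2)
  have w\<phi>: "weak_grad \<Omega> \<phi> (grad \<phi>)" by (intro H10_pair_weak_grad H10_pair_test \<Omega> \<phi>)
  have w: "weak_grad \<Omega> (u - \<phi>) (\<lambda>x. g x - grad \<phi> x)"
    unfolding weak_grad_def
  proof (intro conjI allI impI)
    show "L2 \<Omega> (\<lambda>x. g x - grad \<phi> x)" using L Lm by (intro L2_diff)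
    fix \<psi> assume t: "test_fun \<Omega> \<psi>"
    have T: "L2 \<Omega> \<psi>" "L2 \<Omega> (grad \<psi>)" using t \<Omega> by (auto intro: test_fun_L2)
    show "(\<integral>x. (u - \<phi>) x *\<^sub>R grad \<psi> x \<partial>lebesgue_on \<Omega>) = - (\<integral>x. \<psi> x *\<^sub>R (g x - grad \<phi> x) \<partial>lebesgue_on \<Omega>)"
      using u w\<phi> t T L Lm
      by (simp add: weak_grad_def fun_diff_def scaleR_diff_left scaleR_diff_right integrable_L2_scaleR)
  qed
  have "wgrad \<Omega> (u - \<phi>) \<in> borel_measurable (lebesgue_on \<Omega>)"
    using weak_grad_wgrad[OF w] by (auto simp: weak_grad_def dest: L2_measurable)
  then have "(\<integral>x. ((u - \<phi>) x)\<^sup>2 + (norm (wgrad \<Omega> (u - \<phi>) x))\<^sup>2 \<partial>lebesgue_on \<Omega>) =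
      (\<integral>x. (norm (\<phi> x - u x))\<^sup>2 + (norm (grad \<phi> x - g x))\<^sup>2 \<partial>lebesgue_on \<Omega>)"
    using wgrad_AE_eq[OF \<Omega> w] u(1)[THEN L2_measurable] L[THEN L2_measurable] Lm[THEN L2_measurable]
    by (intro integral_cong_AE) (auto simp: fun_diff_def norm_minus_commute power2_commute)
  also have "\<dots> = (\<integral>x. (norm (\<phi> x - u x))\<^sup>2 \<partial>lebesgue_on \<Omega>) + (\<integral>x. (norm (grad \<phi> x - g x))\<^sup>2 \<partial>lebesgue_on \<Omega>)"
    using u(1) L Lm by (intro Bochner_Integration.integral_add L2_integrable_sq L2_diff)
  finally show ?thesis by (simp add: H1_norm_def)
qed

lemma H10_pair_imp_H10:
  fixes \<Omega> :: "(real^'n) set"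
  assumes "open \<Omega>" "H10_pair \<Omega> u g"
  shows "u \<in> H10 \<Omega>"
proof -
  obtain \<phi> :: "nat \<Rightarrow> real^'n \<Rightarrow> real" where 1: "\<And>m. test_fun \<Omega> (\<phi> m)"
    "L2_lim \<Omega> sequentially \<phi> u" "L2_lim \<Omega> sequentially (\<lambda>m. grad (\<phi> m)) g"
    using H10_pairE[OF assms(2)] by metis
  have L: "L2 \<Omega> u" "L2 \<Omega> g" using assms by (auto dest: H10_pair_L2)
  have "(\<lambda>m. (H1_norm \<Omega> (u - \<phi> m))\<^sup>2) \<longlonglongrightarrow> 0 + 0"
    unfolding H1_norm_diff_test_sq[OF assms(1) L(1) H10_pair_weak_grad[OF assms] 1(1)]
    by (intro tendsto_add L2_limD(3)[OF 1(2)] L2_limD(3)[OF 1(3)])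
  then have "(\<lambda>m. sqrt ((H1_norm \<Omega> (u - \<phi> m))\<^sup>2)) \<longlonglongrightarrow> sqrt (0 + 0)" by (rule tendsto_real_sqrt)
  then have "(\<lambda>m. H1_norm \<Omega> (u - \<phi> m)) \<longlonglongrightarrow> 0" by (simp add: tendsto_rabs_zero_iff)
  moreover have "u \<in> H1 \<Omega>"
    unfolding H1_def mem_Collect_eq by (intro conjI L(1) exI[of _ g] H10_pair_weak_grad assms)
  ultimately show ?thesis unfolding H10_def using 1(1) by blast
qed

lemma H10_imp_H10_pair:
  fixes \<Omega> :: "(real^'n) set"
  assumes "open \<Omega>" "u \<in> H10 \<Omega>"
  shows "H10_pair \<Omega> u (wgrad \<Omega> u)"
proof -
  obtain \<phi> :: "nat \<Rightarrow> real^'n \<Rightarrow> real" where \<phi>: "\<And>m. test_fun \<Omega> (\<phi> m)" "(\<lambda>m. H1_norm \<Omega> (u - \<phi> m)) \<longlonglongrightarrow> 0"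
    and u: "u \<in> H1 \<Omega>" using assms(2) by (auto simp: H10_def)
  have wu: "weak_grad \<Omega> u (wgrad \<Omega> u)" using u by (rule wgrad_weak_grad)
  have L: "L2 \<Omega> u" "L2 \<Omega> (wgrad \<Omega> u)" using u wu by (auto simp: H1_def weak_grad_def)
  let ?g = "wgrad \<Omega> u"
  have Lm: "L2 \<Omega> (\<phi> m)" "L2 \<Omega> (grad (\<phi> m))" for m using \<phi> assms(1) by (auto intro: test_fun_L2)
  note eq = H1_norm_diff_test_sq[OF assms(1) L(1) wu \<phi>(1)]
  have lim: "(\<lambda>m. (H1_norm \<Omega> (u - \<phi> m))\<^sup>2) \<longlonglongrightarrow> 0" using tendsto_power[OF \<phi>(2), of 2] by simp
  have "L2_lim \<Omega> sequentially \<phi> u"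
    by (rule L2_limI_bound[OF _ L(1) _ lim]) (auto simp: eq Lm)
  moreover have "L2_lim \<Omega> sequentially (\<lambda>m. grad (\<phi> m)) ?g"
    by (rule L2_limI_bound[OF _ L(2) _ lim]) (auto simp: eq Lm)
  ultimately show ?thesis using \<phi>(1) by (auto simp: H10_pair_def)
qed

lemma H10_pair_wgrad_AE:
  "open \<Omega> \<Longrightarrow> H10_pair \<Omega> u g \<Longrightarrow> AE x in lebesgue_on \<Omega>. wgrad \<Omega> u x = g x"
  by (intro wgrad_AE_eq H10_pair_weak_grad)

lemma H10_norm_sq:
  fixes \<Omega> :: "(real^'n) set"
  assumes "open \<Omega>" "H10_pair \<Omega> u g"
  shows "(H10_norm \<Omega> u)\<^sup>2 = (\<integral>x. (norm (g x))\<^sup>2 \<partial>lebesgue_on \<Omega>)"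
proof -
  have "wgrad \<Omega> u \<in> borel_measurable (lebesgue_on \<Omega>)"
    using H10_pair_L2(2)[OF H10_imp_H10_pair[OF assms(1) H10_pair_imp_H10[OF assms]]] by (rule L2_measurable)
  then have "(\<integral>x. (norm (wgrad \<Omega> u x))\<^sup>2 \<partial>lebesgue_on \<Omega>) = (\<integral>x. (norm (g x))\<^sup>2 \<partial>lebesgue_on \<Omega>)"
    using H10_pair_wgrad_AE[OF assms] H10_pair_L2(2)[OF assms(2), THEN L2_measurable]
    by (intro integral_cong_AE) auto
  then show ?thesis by (simp add: H10_norm_def)
qed

section \<open>Inequalities for functions in H10\<close>

lemma H10_pair_limit_le:
  fixes \<Omega> :: "(real^'n) set" and a :: "real^'n \<Rightarrow> real"
  assumes "open \<Omega>" "H10_pair \<Omega> u g" and a: "a \<in> borel_measurable (lebesgue_on \<Omega>)" "\<And>x. \<bar>a x\<bar> \<le> A"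
    and le: "\<And>\<phi>. test_fun \<Omega> \<phi> \<Longrightarrow>
      (\<integral>x. a x * (\<phi> x)\<^sup>2 \<partial>lebesgue_on \<Omega>) \<le> C * (\<integral>x. (norm (grad \<phi> x))\<^sup>2 \<partial>lborel)"
  shows "(\<integral>x. a x * (u x)\<^sup>2 \<partial>lebesgue_on \<Omega>) \<le> C * (\<integral>x. (norm (g x))\<^sup>2 \<partial>lebesgue_on \<Omega>)"
proof -
  obtain \<phi> :: "nat \<Rightarrow> real^'n \<Rightarrow> real" where 1: "\<And>m. test_fun \<Omega> (\<phi> m)"
    "L2_lim \<Omega> sequentially \<phi> u" "L2_lim \<Omega> sequentially (\<lambda>m. grad (\<phi> m)) g"
    using H10_pairE[OF assms(2)] by metis
  have "(\<lambda>m. \<integral>x. a x * (norm (\<phi> m x))\<^sup>2 \<partial>lebesgue_on \<Omega>) \<longlonglongrightarrow> (\<integral>x. a x * (norm (u x))\<^sup>2 \<partial>lebesgue_on \<Omega>)"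
    by (rule L2_lim_weighted_sq[OF 1(2) a])
  then have l1: "(\<lambda>m. \<integral>x. a x * (\<phi> m x)\<^sup>2 \<partial>lebesgue_on \<Omega>) \<longlonglongrightarrow> (\<integral>x. a x * (u x)\<^sup>2 \<partial>lebesgue_on \<Omega>)" by simp
  have "(\<lambda>m. \<integral>x. 1 * (norm (grad (\<phi> m) x))\<^sup>2 \<partial>lebesgue_on \<Omega>) \<longlonglongrightarrow> (\<integral>x. 1 * (norm (g x))\<^sup>2 \<partial>lebesgue_on \<Omega>)"
    by (rule L2_lim_weighted_sq[OF 1(3), where A=1]) auto
  then have l2: "(\<lambda>m. C * (\<integral>x. (norm (grad (\<phi> m) x))\<^sup>2 \<partial>lebesgue_on \<Omega>)) \<longlonglongrightarrow> C * (\<integral>x. (norm (g x))\<^sup>2 \<partial>lebesgue_on \<Omega>)"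
    by (intro tendsto_mult tendsto_const) simp
  show ?thesis
  proof (rule LIMSEQ_le[OF l1 l2], intro exI[of _ 0] allI impI)
    fix m
    obtain K where K: "compact K" "K \<subseteq> \<Omega>" "\<And>x. x \<notin> K \<Longrightarrow> grad (\<phi> m) x = 0"
      using test_fun_support[OF 1(1)] by metis
    have "(\<integral>x. (norm (grad (\<phi> m) x))\<^sup>2 \<partial>lebesgue_on \<Omega>) = (\<integral>x. (norm (grad (\<phi> m) x))\<^sup>2 \<partial>lborel)"
      using K assms(1) by (intro lebesgue_on_compact_support[of _ K] continuous_intros continuous_grad test_fun_smooth[OF 1(1)]) auto
    then show "(\<integral>x. a x * (\<phi> m x)\<^sup>2 \<partial>lebesgue_on \<Omega>) \<le> C * (\<integral>x. (norm (grad (\<phi> m) x))\<^sup>2 \<partial>lebesgue_on \<Omega>)"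
      using le[OF 1(1)] by simp
  qed
qed

lemma translation_inequality_norm:
  assumes "test_fun \<Omega> \<phi>"
  shows "(\<integral>x. (\<phi> (x + h) - \<phi> x)\<^sup>2 \<partial>lborel) \<le> (norm h)\<^sup>2 * (\<integral>x. (norm (grad \<phi> x))\<^sup>2 \<partial>lborel)"
proof -
  obtain K where K: "compact K" "K \<subseteq> \<Omega>" "\<And>x. x \<notin> K \<Longrightarrow> grad \<phi> x = 0"
    using test_fun_support[OF assms] by metis
  have i: "integrable lborel (\<lambda>x. (norm (grad \<phi> x))\<^sup>2)"
    using K by (intro integrable_compact_support[of _ K] continuous_intros continuous_grad test_fun_smooth[OF assms]) auto
  have "(\<integral>x. (grad \<phi> x \<bullet> h)\<^sup>2 \<partial>lborel) \<le> (\<integral>x. (norm h)\<^sup>2 * (norm (grad \<phi> x))\<^sup>2 \<partial>lborel)"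
  proof (rule integral_mono')
    show "(grad \<phi> x \<bullet> h)\<^sup>2 \<le> (norm h)\<^sup>2 * (norm (grad \<phi> x))\<^sup>2" for x
      using Cauchy_Schwarz_ineq[of "grad \<phi> x" h] by (simp add: power2_norm_eq_inner mult.commute)
  qed (use i in auto)
  then show ?thesis using translation_inequality[OF assms, of h] by simp
qed

lemma integrable_translated_increment:
  assumes "test_fun \<Omega> \<phi>"
  shows "integrable lborel (\<lambda>x. (\<phi> (x + h) - \<phi> x)\<^sup>2)"
proof -
  obtain K where K: "compact K" "K \<subseteq> \<Omega>" "\<And>x. x \<notin> K \<Longrightarrow> \<phi> x = 0"
    using test_fun_support[OF assms] by metis
  have c: "continuous_on UNIV \<phi>" by (intro smooth_on_continuous test_fun_smooth[OF assms])
  show ?thesis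
  proof (rule integrable_compact_support[of _ "K \<union> (\<lambda>x. - h + x) ` K"])
    show "continuous_on UNIV (\<lambda>x. (\<phi> (x + h) - \<phi> x)\<^sup>2)"
      by (intro continuous_intros continuous_on_compose2[OF c] c) auto
    show "compact (K \<union> (\<lambda>x. - h + x) ` K)" using K by (intro compact_Un compact_translation)
    fix x assume x: "x \<notin> K \<union> (\<lambda>x. - h + x) ` K"
    have "x + h \<notin> K"
    proof
      assume "x + h \<in> K"
      then have "- h + (x + h) \<in> (\<lambda>x. - h + x) ` K" by (rule imageI)
      then show False using x by simp
    qed
    then show "(\<phi> (x + h) - \<phi> x)\<^sup>2 = 0" using x K(3) by simp
  qed
qed

text \<open>A translation longer than the diameter separates the supports, so the square integral of the
  increment is twice that of the function.\<close>

lemma poincare: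
  fixes \<Omega> :: "(real^'n) set"
  assumes \<Omega>: "open \<Omega>" "bounded \<Omega>"
  shows "\<exists>C\<ge>0. \<forall>u g. H10_pair \<Omega> u g \<longrightarrow>
    (\<integral>x. (u x)\<^sup>2 \<partial>lebesgue_on \<Omega>) \<le> C * (\<integral>x. (norm (g x))\<^sup>2 \<partial>lebesgue_on \<Omega>)"
proof -
  obtain R where R: "R > 0" "\<And>x. x \<in> \<Omega> \<Longrightarrow> norm x \<le> R" using \<Omega>(2) by (metis bounded_pos)
  obtain i :: 'n where True by auto
  \<comment> \<open>Longer than the diameter \<open>2 * R\<close> of a ball that contains the domain.\<close>
  define h where "h = (2 * R + 1) *\<^sub>R axis i (1 :: real)"
  have nh: "norm h = 2 * R + 1" using R(1) by (simp add: h_def norm_axis_1)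
  have sep: "x \<notin> \<Omega> \<or> x + h \<notin> \<Omega>" for x
    using R(2)[of x] R(2)[of "x + h"] norm_triangle_ineq4[of "x + h" x] nh by auto
  have test: "(\<integral>x. 1 * (\<phi> x)\<^sup>2 \<partial>lebesgue_on \<Omega>) \<le> ((2 * R + 1)\<^sup>2 / 2) * (\<integral>x. (norm (grad \<phi> x))\<^sup>2 \<partial>lborel)"
    if t: "test_fun \<Omega> \<phi>" for \<phi>
  proof -
    obtain K where K: "compact K" "K \<subseteq> \<Omega>" "\<And>x. x \<notin> K \<Longrightarrow> \<phi> x = 0"
      using test_fun_support[OF t] by metis
    have c: "continuous_on UNIV (\<lambda>x. (\<phi> x)\<^sup>2)" by (intro continuous_intros smooth_on_continuous test_fun_smooth[OF t])
    have i: "integrable lborel (\<lambda>x. (\<phi> x)\<^sup>2)"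
      using K by (intro integrable_compact_support[OF c]) auto
    then have ih: "integrable lborel (\<lambda>x. (\<phi> (x + h))\<^sup>2)"
      using integrable_distr[of "(+) h" lborel borel "\<lambda>x. (\<phi> x)\<^sup>2"] by (simp add: lborel_distr_plus add.commute)
    have "(\<phi> (x + h) - \<phi> x)\<^sup>2 = (\<phi> (x + h))\<^sup>2 + (\<phi> x)\<^sup>2" for x
      using sep[of x] test_fun_zero_outside[OF t] by auto
    then have "(\<integral>x. (\<phi> (x + h) - \<phi> x)\<^sup>2 \<partial>lborel) = (\<integral>x. (\<phi> (x + h))\<^sup>2 \<partial>lborel) + (\<integral>x. (\<phi> x)\<^sup>2 \<partial>lborel)"
      using i ih by simp
    also have "(\<integral>x. (\<phi> (x + h))\<^sup>2 \<partial>lborel) = (\<integral>x. (\<phi> x)\<^sup>2 \<partial>lborel)"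
      using c by (intro lborel_integral_translate borel_measurable_continuous_onI)
    finally have "2 * (\<integral>x. (\<phi> x)\<^sup>2 \<partial>lborel) \<le> (2 * R + 1)\<^sup>2 * (\<integral>x. (norm (grad \<phi> x))\<^sup>2 \<partial>lborel)"
      using translation_inequality_norm[OF t, of h] nh by simp
    moreover have "(\<integral>x. (\<phi> x)\<^sup>2 \<partial>lebesgue_on \<Omega>) = (\<integral>x. (\<phi> x)\<^sup>2 \<partial>lborel)"
      using K \<Omega> by (intro lebesgue_on_compact_support[OF c]) auto
    ultimately show ?thesis by simp
  qed
  show ?thesis
  proof (intro exI[of _ "(2 * R + 1)\<^sup>2 / 2"] conjI allI impI)
    fix u g assume "H10_pair \<Omega> u g"
    from H10_pair_limit_le[OF \<Omega>(1) this, of "\<lambda>_. 1" 1, OF _ _ test]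
    show "(\<integral>x. (u x)\<^sup>2 \<partial>lebesgue_on \<Omega>) \<le> ((2 * R + 1)\<^sup>2 / 2) * (\<integral>x. (norm (g x))\<^sup>2 \<partial>lebesgue_on \<Omega>)"
      by simp
  qed simp
qed

subsection \<open>Vanishing on the boundary\<close>

text \<open>Near a boundary point where the continuous representative is nonzero, the layer of thickness
  \<open>\<delta>\<close> above the graph has volume at least of order \<open>\<delta>\<close>.  Translating by \<open>\<delta>\<close> moves the layer out of
  the domain, so its mass is at most of order \<open>\<delta>\<^sup>2\<close>; the two bounds are incompatible as
  \<open>\<delta>\<close> tends to 0.\<close>

lemma continuous_rep_boundary_zero:
  fixes \<Omega> :: "(real^'n) set"
  assumes \<Omega>: "open \<Omega>" "smooth_boundary \<Omega>" and u: "H10_pair \<Omega> u g"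
    and uc: "continuous_rep \<Omega> u uc" and p: "p \<in> frontier \<Omega>"
  shows "uc p = 0"
proof (rule ccontr)
  assume nz: "uc p \<noteq> 0"
  define c where "c = \<bar>uc p\<bar> / 2"
  have c: "c > 0" using nz by (simp add: c_def)
  have pcl: "p \<in> closure \<Omega>" "p \<notin> \<Omega>" using p \<Omega>(1) by (auto simp: frontier_def interior_open)
  have ucc: "continuous_on (closure \<Omega>) uc" and ucAE: "AE x in lebesgue_on \<Omega>. uc x = u x"
    using uc by (auto simp: continuous_rep_def)
  have "\<forall>x\<in>closure \<Omega>. \<forall>\<epsilon>>0. \<exists>d>0. \<forall>x'\<in>closure \<Omega>. dist x' x < d \<longrightarrow> dist (uc x') (uc x) < \<epsilon>"
    using ucc by (simp only: continuous_on_iff)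
  then have "\<exists>d>0. \<forall>x\<in>closure \<Omega>. dist x p < d \<longrightarrow> dist (uc x) (uc p) < c"
    using pcl(1) c by blast
  then obtain r1 where r1: "r1 > 0" "\<And>x. x \<in> closure \<Omega> \<Longrightarrow> dist x p < r1 \<Longrightarrow> dist (uc x) (uc p) < c"
    by blast
  have "\<exists>r>0. \<exists>i. \<exists>s\<in>{-1, 1}. \<exists>f. smooth_on UNIV f \<and> (\<forall>x y. (\<forall>j. j \<noteq> i \<longrightarrow> x $ j = y $ j) \<longrightarrow> f x = f y) \<and>
      \<Omega> \<inter> ball p r = {x \<in> ball p r. s * x $ i > f x}"
    using \<Omega>(2) p unfolding smooth_boundary_def by (rule bspec)
  then obtain r i s f where r: "r > 0" and s: "s \<in> {-1, 1 :: real}" and sf: "smooth_on UNIV f"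
    and indep0: "\<forall>x y. (\<forall>j. j \<noteq> i \<longrightarrow> x $ j = y $ j) \<longrightarrow> f x = f y"
    and graph: "\<Omega> \<inter> ball p r = {x \<in> ball p r. s * x $ i > f x}"
    by (elim exE conjE bexE) (rule that)
  have indep: "f x = f y" if "\<And>j. j \<noteq> i \<Longrightarrow> x $ j = y $ j" for x y
    using indep0 that by simp
  have ss: "s * s = 1" "\<bar>s\<bar> = 1" using s by auto
  have inOm: "x \<in> \<Omega> \<longleftrightarrow> s * x $ i > f x" if "x \<in> ball p r" for x
    using graph that by blast
  have fc: "continuous_on UNIV f" using sf by (rule smooth_on_continuous)
  have fp: "f p = s * p $ i"
  proof (rule antisym)
    show "s * p $ i \<le> f p" using inOm[of p] pcl r by simp
    show "f p \<le> s * p $ i"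
    proof (rule ccontr)
      assume "\<not> f p \<le> s * p $ i"
      then have "p \<in> {x. s * x $ i < f x} \<inter> ball p r" using r by simp
      moreover have "open ({x. s * x $ i < f x} \<inter> ball p r)"
        by (intro open_Int open_Collect_less continuous_intros fc) auto
      ultimately obtain x where "x \<in> \<Omega>" "x \<in> {x. s * x $ i < f x} \<inter> ball p r"
        using pcl(1) open_Int_closure_eq_empty by blast
      then show False using inOm[of x] by auto
    qed
  qed
  define r2 where "r2 = min r r1"
  have r2: "r2 > 0" "r2 \<le> r" "r2 \<le> r1" using r r1 by (auto simp: r2_def)
  \<comment> \<open>With these sizes every point of the cylinder at height at most \<open>a\<close> above or below the graph
    stays in the ball, see \<open>inball\<close>.\<close>
  define a where "a = r2 / 4"
  have a: "a > 0" using r2 by (simp add: a_def)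
  have "\<forall>x\<in>UNIV. \<forall>\<epsilon>>0. \<exists>d>0. \<forall>x'\<in>UNIV. dist x' x < d \<longrightarrow> dist (f x') (f x) < \<epsilon>"
    using fc by (simp only: continuous_on_iff)
  then have "\<exists>d>0. \<forall>x. dist x p < d \<longrightarrow> dist (f x) (f p) < a"
    using a by blast
  then obtain d where d: "d > 0" "\<And>x. dist x p < d \<Longrightarrow> dist (f x) (f p) < a"
    by blast
  define n where "n = real CARD('n)"
  have n: "n > 0" by (simp add: n_def)
  define \<rho> where "\<rho> = min d a / (2 * n)"
  have \<rho>: "\<rho> > 0" "n * \<rho> < d" "n * \<rho> < a" using d a n by (auto simp: \<rho>_def field_simps min_def)
  have norm_le: "norm z \<le> (\<Sum>j\<in>UNIV - {i}. \<bar>z $ j\<bar>) + \<bar>z $ i\<bar>" for z :: "real^'n"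
    using norm_le_l1_cart[of z] by (simp add: sum.remove[of UNIV i])
  define cyl where "cyl x \<longleftrightarrow> (\<forall>j. j \<noteq> i \<longrightarrow> \<bar>x $ j - p $ j\<bar> < \<rho>)" for x :: "real^'n"
  have cyl_sum: "(\<Sum>j\<in>UNIV - {i}. \<bar>z $ j - p $ j\<bar>) \<le> n * \<rho>" if "cyl z" for z
  proof -
    have "(\<Sum>j\<in>UNIV - {i}. \<bar>z $ j - p $ j\<bar>) \<le> (\<Sum>j\<in>UNIV - {i}. \<rho>)"
      using that by (intro sum_mono) (auto simp: cyl_def less_imp_le)
    also have "\<dots> \<le> n * \<rho>" using \<rho>(1) by (simp add: n_def card_Diff_singleton mult_right_mono)
    finally show ?thesis .
  qed
  have fclose: "\<bar>f x - f p\<bar> < a" if "cyl x" for x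
  proof -
    define x' where "x' = (\<chi> j. if j = i then p $ i else x $ j)"
    have "f x = f x'" by (rule indep) (simp add: x'_def)
    moreover have "dist x' p < d"
    proof -
      have "dist x' p \<le> (\<Sum>j\<in>UNIV - {i}. \<bar>(x' - p) $ j\<bar>) + \<bar>(x' - p) $ i\<bar>"
        unfolding dist_norm by (rule norm_le)
      also have "\<dots> = (\<Sum>j\<in>UNIV - {i}. \<bar>x $ j - p $ j\<bar>)"
        by (simp add: x'_def)
      also have "\<dots> < d" using cyl_sum[OF that] \<rho> by simp
      finally show ?thesis .
    qed
    ultimately show ?thesis using d(2) by (simp add: dist_real_def)
  qed
  have inball: "x \<in> ball p r2" if "cyl x" "\<bar>s * x $ i - f x\<bar> \<le> a" for x
  proof -
    have "\<bar>x $ i - p $ i\<bar> = \<bar>s * (x $ i - p $ i)\<bar>" using ss by (simp add: abs_mult)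
    also have "\<dots> = \<bar>(s * x $ i - f x) + (f x - f p)\<bar>" by (simp add: fp algebra_simps)
    also have "\<dots> < 2 * a" using that(2) fclose[OF that(1)] by linarith
    finally have 1: "\<bar>x $ i - p $ i\<bar> < 2 * a" .
    have "dist x p \<le> (\<Sum>j\<in>UNIV - {i}. \<bar>(x - p) $ j\<bar>) + \<bar>(x - p) $ i\<bar>"
      unfolding dist_norm by (rule norm_le)
    also have "\<dots> < n * \<rho> + 2 * a" using cyl_sum[OF that(1)] 1 by simp
    also have "\<dots> < r2" using \<rho> a by (simp add: a_def)
    finally show ?thesis by (simp add: dist_commute)
  qed
  define e where "e = s *\<^sub>R axis i (1 :: real)"
  have e: "norm e = 1" "e $ i = s" "\<And>j. j \<noteq> i \<Longrightarrow> e $ j = 0" using ss(2) by (simp_all add: e_def axis_def norm_axis_1[unfolded axis_def])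
  have cyl_shift: "cyl (x + t *\<^sub>R e) \<longleftrightarrow> cyl x" for x t by (auto simp: cyl_def e)
  have f_shift: "f (x + t *\<^sub>R e) = f x" for x t by (rule indep) (simp add: e)
  have h_shift: "s * (x + t *\<^sub>R e) $ i = s * x $ i + t" for x t using ss by (simp add: e algebra_simps)
  define L where "L \<delta> = {x. cyl x \<and> f x < s * x $ i \<and> s * x $ i \<le> f x + \<delta>}" for \<delta>
  have Lball: "L \<delta> \<subseteq> ball p r2" if "\<delta> \<le> a" for \<delta> using that by (auto simp: L_def intro!: inball)
  have LOm: "L \<delta> \<subseteq> \<Omega>" if "\<delta> \<le> a" for \<delta>
  proof
    fix x assume "x \<in> L \<delta>"
    then show "x \<in> \<Omega>" using inOm[of x] Lball[OF that] r2 by (auto simp: L_def)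
  qed
  have cylopen: "open {x. cyl x}"
  proof -
    have "{x. cyl x} = (\<Inter>j\<in>- {i}. {x. \<bar>x $ j - p $ j\<bar> < \<rho>})" by (auto simp: cyl_def)
    then show ?thesis by (auto intro!: open_INT open_Collect_less continuous_intros)
  qed
  have Lborel: "L \<delta> \<in> sets borel" for \<delta>
  proof -
    have "L \<delta> = {x. cyl x} \<inter> {x. f x < s * x $ i} \<inter> {x. s * x $ i \<le> f x + \<delta>}" by (auto simp: L_def)
    moreover have "open {x. f x < s * x $ i}" by (intro open_Collect_less continuous_intros fc)
    moreover have "closed {x. s * x $ i \<le> f x + \<delta>}" by (intro closed_Collect_le continuous_intros fc)
    ultimately show ?thesis using cylopen by (auto intro!: sets.Int borel_open borel_closed)
  qed
  have Lm: "L \<delta> \<in> lmeasurable" if "\<delta> \<le> a" for \<delta>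
    using Lborel bounded_subset[OF bounded_ball Lball[OF that]] by (intro bounded_set_imp_lmeasurable) auto
  define V where "V = measure lebesgue (L a)"
  have V: "V > 0"
  proof -
    let ?O = "{x. cyl x} \<inter> {x. f x < s * x $ i} \<inter> {x. s * x $ i < f x + a}"
    have "open ?O" by (intro open_Int cylopen open_Collect_less continuous_intros fc)
    moreover have "p + (a / 2) *\<^sub>R e \<in> ?O"
      using a \<rho>(1) by (auto simp: cyl_shift f_shift h_shift fp simp del: vector_add_component) (simp add: cyl_def)
    moreover have "?O \<subseteq> L a" by (auto simp: L_def)
    ultimately have "\<not> negligible (L a)" using open_not_negligible negligible_subset by blast
    then show ?thesis using Lm[of a] unfolding V_def by (simp add: negligible_iff_measure0 zero_less_measure_iff)
  qed
  have Vle: "V \<le> real N * measure lebesgue (L (a / real N))" if N: "N > 0" for N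
  proof -
    let ?\<delta> = "a / real N"
    have \<delta>: "?\<delta> > 0" using a N by simp
    \<comment> \<open>\<open>N\<close> vertical translates of the layer of thickness \<open>a / N\<close> cover the layer of thickness \<open>a\<close>.\<close>
    have "L a \<subseteq> (\<Union>k<N. (+) ((real k * ?\<delta>) *\<^sub>R e) ` L ?\<delta>)"
    proof
      fix x assume x: "x \<in> L a"
      define t where "t = s * x $ i - f x"
      have t: "0 < t" "t \<le> a" "cyl x" using x by (auto simp: L_def t_def)
      define k where "k = nat (\<lceil>t / ?\<delta>\<rceil> - 1)"
      have c0: "0 < t / ?\<delta>" by (intro divide_pos_pos t \<delta>)
      have cN: "t / ?\<delta> \<le> real N" by (subst pos_divide_le_eq[OF \<delta>]) (use t N in simp)
      have c1: "\<lceil>t / ?\<delta>\<rceil> \<ge> 1" using c0 by linarith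
      have c2: "\<lceil>t / ?\<delta>\<rceil> \<le> int N" using cN by (simp add: ceiling_le_iff)
      have rk: "real k = of_int \<lceil>t / ?\<delta>\<rceil> - 1" using c1 by (simp add: k_def)
      have kN: "k < N" unfolding k_def by (subst nat_less_iff) (use c1 c2 in linarith)+
      have "t / ?\<delta> \<le> real k + 1" "real k < t / ?\<delta>" using rk by linarith+
      then have k: "t \<le> real k * ?\<delta> + ?\<delta>" "real k * ?\<delta> < t" using \<delta>
        by (simp_all only: pos_divide_le_eq[OF \<delta>] pos_less_divide_eq[OF \<delta>] distrib_right mult_1)
      define y where "y = x + (- (real k * ?\<delta>)) *\<^sub>R e"
      have "y \<in> L ?\<delta>" unfolding L_def y_def mem_Collect_eq cyl_shift f_shift h_shift
        using t k by (auto simp: t_def)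
      moreover have "x = (real k * ?\<delta>) *\<^sub>R e + y" by (simp add: y_def)
      ultimately show "x \<in> (\<Union>k<N. (+) ((real k * ?\<delta>) *\<^sub>R e) ` L ?\<delta>)" using kN by blast
    qed
    moreover have \<delta>a: "?\<delta> \<le> a" using a N by (simp add: field_simps)
    moreover have mm: "(+) b ` L ?\<delta> \<in> lmeasurable" for b using Lm[OF \<delta>a] by (rule measurable_translation)
    ultimately have "V \<le> measure lebesgue (\<Union>k<N. (+) ((real k * ?\<delta>) *\<^sub>R e) ` L ?\<delta>)"
      unfolding V_def by (intro measure_mono_fmeasurable) (auto intro!: fmeasurable.finite_UN fmeasurableD Lm)
    also have "\<dots> \<le> (\<Sum>k<N. measure lebesgue ((+) ((real k * ?\<delta>) *\<^sub>R e) ` L ?\<delta>))"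
      using mm by (intro measure_UNION_le) auto
    also have "\<dots> = real N * measure lebesgue (L ?\<delta>)" by (simp add: measure_translation)
    finally show ?thesis .
  qed
  define G where "G = (\<integral>x. (norm (g x))\<^sup>2 \<partial>lebesgue_on \<Omega>)"
  have mass_le: "(\<integral>x. indicator (L \<delta>) x * (u x)\<^sup>2 \<partial>lebesgue_on \<Omega>) \<le> \<delta>\<^sup>2 * G" if \<delta>: "0 < \<delta>" "\<delta> \<le> a" for \<delta>
    unfolding G_def
  proof (rule H10_pair_limit_le[OF \<Omega>(1) u, where A=1])
    show "(indicator (L \<delta>) :: real^'n \<Rightarrow> real) \<in> borel_measurable (lebesgue_on \<Omega>)"
      using Lborel[of \<delta>] by (intro measurable_restrict_space1 borel_measurable_indicator) simp
    fix \<phi> assume t: "test_fun \<Omega> \<phi>"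
    obtain K where K: "compact K" "K \<subseteq> \<Omega>" "\<And>x. x \<notin> K \<Longrightarrow> \<phi> x = 0"
      using test_fun_support[OF t] by metis
    have [measurable]: "\<phi> \<in> borel_measurable borel"
      by (intro borel_measurable_continuous_onI smooth_on_continuous test_fun_smooth[OF t])
    have "(\<integral>x. indicator (L \<delta>) x * (\<phi> x)\<^sup>2 \<partial>lebesgue_on \<Omega>) = (\<integral>x. indicator \<Omega> x *\<^sub>R (indicator (L \<delta>) x * (\<phi> x)\<^sup>2) \<partial>lebesgue)"
      using \<Omega>(1) by (subst integral_restrict_space) auto
    also have "\<dots> = (\<integral>x. indicator (L \<delta>) x * (\<phi> x)\<^sup>2 \<partial>lebesgue)"
      using LOm[OF \<delta>(2)] by (intro Bochner_Integration.integral_cong) (auto simp: indicator_def)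
    also have "\<dots> = (\<integral>x. indicator (L \<delta>) x * (\<phi> x)\<^sup>2 \<partial>lborel)"
    proof (rule integral_completion)
      have [measurable]: "L \<delta> \<in> sets borel" by (rule Lborel)
      show "(\<lambda>x. indicator (L \<delta>) x * (\<phi> x)\<^sup>2) \<in> borel_measurable lborel"
        unfolding measurable_lborel1 by measurable
    qed
    \<comment> \<open>The translate by \<open>\<delta>\<close> of a point of the layer lies below the graph, hence outside the domain.\<close>
    also have "\<dots> \<le> (\<integral>x. (\<phi> (x + (- \<delta>) *\<^sub>R e) - \<phi> x)\<^sup>2 \<partial>lborel)"
    proof (rule integral_mono'[OF integrable_translated_increment[OF t]])
      fix x
      show "indicator (L \<delta>) x * (\<phi> x)\<^sup>2 \<le> (\<phi> (x + (- \<delta>) *\<^sub>R e) - \<phi> x)\<^sup>2"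
      proof (cases "x \<in> L \<delta>")
        case True
        then have xx: "cyl x" "f x < s * x $ i" "s * x $ i \<le> f x + \<delta>" by (auto simp: L_def)
        let ?y = "x + (- \<delta>) *\<^sub>R e"
        have "?y \<in> ball p r2"
        proof (rule inball)
          show "cyl ?y" using xx(1) by (simp only: cyl_shift)
          show "\<bar>s * ?y $ i - f ?y\<bar> \<le> a" unfolding f_shift h_shift using xx \<delta> by linarith
        qed
        moreover have "\<not> s * ?y $ i > f ?y" unfolding f_shift h_shift using xx by simp
        ultimately have "?y \<notin> \<Omega>" using inOm[of ?y] r2 by auto
        then show ?thesis using test_fun_zero_outside[OF t] True by simp
      qed simp
    qed simp
    also have "\<dots> \<le> (norm ((- \<delta>) *\<^sub>R e))\<^sup>2 * (\<integral>x. (norm (grad \<phi> x))\<^sup>2 \<partial>lborel)"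
      by (rule translation_inequality_norm[OF t])
    finally show "(\<integral>x. indicator (L \<delta>) x * (\<phi> x)\<^sup>2 \<partial>lebesgue_on \<Omega>) \<le> \<delta>\<^sup>2 * (\<integral>x. (norm (grad \<phi> x))\<^sup>2 \<partial>lborel)"
      using e by simp
  qed auto
  have mass_ge: "c\<^sup>2 * measure lebesgue (L \<delta>) \<le> (\<integral>x. indicator (L \<delta>) x * (u x)\<^sup>2 \<partial>lebesgue_on \<Omega>)" if \<delta>: "\<delta> \<le> a" for \<delta>
  proof -
    have Lsub: "L \<delta> \<in> sets (lebesgue_on \<Omega>)" using Lborel[of \<delta>] LOm[OF \<delta>] \<Omega>(1) by (simp add: sets_restrict_space_iff)
    have "c\<^sup>2 * measure lebesgue (L \<delta>) = (\<integral>x. c\<^sup>2 * indicator (L \<delta>) x \<partial>lebesgue_on \<Omega>)"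
      using Lsub LOm[OF \<delta>] \<Omega>(1) by (simp add: measure_restrict_space Int_absorb2)
    also have "\<dots> \<le> (\<integral>x. indicator (L \<delta>) x * (u x)\<^sup>2 \<partial>lebesgue_on \<Omega>)"
    proof (rule integral_mono_AE)
      show "integrable (lebesgue_on \<Omega>) (\<lambda>x. c\<^sup>2 * indicator (L \<delta>) x)"
        using Lm[OF \<delta>] Lsub \<Omega>(1) LOm[OF \<delta>]
        by (intro integrable_mult_right integrable_real_indicator) (auto simp: emeasure_restrict_space fmeasurable_def)
      show "integrable (lebesgue_on \<Omega>) (\<lambda>x. indicator (L \<delta>) x * (u x)\<^sup>2)"
        using integrable_mult_indicator[OF Lsub L2_integrable_sq_real[OF H10_pair_L2(1)[OF u]]] by simp
      show "AE x in lebesgue_on \<Omega>. c\<^sup>2 * indicator (L \<delta>) x \<le> indicator (L \<delta>) x * (u x)\<^sup>2"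
        using ucAE
      proof eventually_elim
        case (elim x)
        show ?case
        proof (cases "x \<in> L \<delta>")
          case True
          then have "x \<in> closure \<Omega>" "dist x p < r1"
            using LOm[OF \<delta>] Lball[OF \<delta>] r2 closure_subset by (auto simp: dist_commute)
          then have "dist (uc x) (uc p) < c" by (rule r1(2))
          then have "c \<le> \<bar>u x\<bar>" using elim unfolding dist_real_def c_def by linarith
          then have "c\<^sup>2 \<le> (u x)\<^sup>2" using c power_mono[of c "\<bar>u x\<bar>" 2] by simp
          then show ?thesis using True by simp
        qed simp
      qed
    qed
    finally show ?thesis .
  qed
  have bound: "c\<^sup>2 * V * real N \<le> a\<^sup>2 * G" if N: "N > 0" for N
  proof -
    have \<delta>: "0 < a / real N" "a / real N \<le> a" using a N by (auto simp: field_simps)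
    have "c\<^sup>2 * V \<le> real N * (c\<^sup>2 * measure lebesgue (L (a / real N)))"
      using mult_left_mono[OF Vle[OF N], of "c\<^sup>2"] by (simp add: mult.left_commute)
    also have "\<dots> \<le> real N * ((a / real N)\<^sup>2 * G)"
      using mass_ge[OF \<delta>(2)] mass_le[OF \<delta>] by (intro mult_left_mono) auto
    finally have "c\<^sup>2 * V \<le> real N * ((a / real N)\<^sup>2 * G)" .
    then show ?thesis using N by (simp add: field_simps power2_eq_square)
  qed
  have cV: "c\<^sup>2 * V > 0" using c V by simp
  obtain N :: nat where "real N > \<bar>a\<^sup>2 * G\<bar> / (c\<^sup>2 * V)" using reals_Archimedean2 by blast
  then have "\<bar>a\<^sup>2 * G\<bar> < c\<^sup>2 * V * real N" using cV by (simp add: field_simps)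
  moreover have "N > 0"
  proof (rule ccontr)
    assume "\<not> N > 0"
    then show False using calculation by simp
  qed
  ultimately show False using bound[of N] by linarith
qed

subsection \<open>The fourth power in dimension three\<close>

text \<open>Coordinates in reverse order, so that the outer integral runs over the heights \<open>z\<close> and the
  inner one over horizontal planes.\<close>

definition real3 :: "real \<times> real \<times> real \<Rightarrow> real^3" where
  "real3 = (\<lambda>(z, y, x). vector [x, y, z])"

lemma real3_nth [simp]: "real3 (z, y, x) $ 1 = x" "real3 (z, y, x) $ 2 = y" "real3 (z, y, x) $ 3 = z"
  by (simp_all add: real3_def)

lemma linear_real3: "bounded_linear real3"
  by (intro linear_conv_bounded_linear[THEN iffD1] linearI)
    (auto simp: vec_eq_iff forall_3 split_paired_all)

lemma continuous_real3: "continuous_on A real3"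
  using linear_real3 by (rule linear_continuous_on)

lemma lborel_real3: "distr lborel borel real3 = (lborel :: (real^3) measure)"
proof (rule lborel_eqI[symmetric])
  have [measurable]: "real3 \<in> borel_measurable borel"
    by (intro borel_measurable_continuous_onI continuous_real3)
  fix l u :: "real^3" assume lu: "\<And>b. b \<in> Basis \<Longrightarrow> l \<bullet> b \<le> u \<bullet> b"
  have le: "l $ i \<le> u $ i" for i
    using lu[of "axis i 1"] by (simp add: inner_axis axis_in_Basis_iff)
  have B: "(Basis :: (real^3) set) = {axis 1 1, axis 2 1, axis 3 1}"
    by (auto simp: Basis_vec_def exhaust_3) (metis exhaust_3)
  have ne: "axis 1 (1::real) \<noteq> (axis 2 1 :: real^3)" "axis 1 (1::real) \<noteq> (axis 3 1 :: real^3)" "axis 2 (1::real) \<noteq> (axis 3 1 :: real^3)"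
    by (auto simp: axis_eq_axis)
  have "real3 -` box l u = box (l $ 3) (u $ 3) \<times> box (l $ 2) (u $ 2) \<times> box (l $ 1) (u $ 1)"
    by (auto simp: mem_box_cart forall_3 box_real)
  then have "emeasure (distr lborel borel real3) (box l u)
     = emeasure (lborel \<Otimes>\<^sub>M lborel) (box (l $ 3) (u $ 3) \<times> (box (l $ 2) (u $ 2) \<times> box (l $ 1) (u $ 1)))"
    by (simp add: emeasure_distr lborel_prod)
  also have "\<dots> = emeasure lborel (box (l $ 3) (u $ 3)) * emeasure lborel (box (l $ 2) (u $ 2) \<times> box (l $ 1) (u $ 1))"
    by (rule lborel.emeasure_pair_measure_Times) (auto simp: borel_Times)
  also have "emeasure lborel (box (l $ 2) (u $ 2) \<times> box (l $ 1) (u $ 1))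
     = emeasure (lborel \<Otimes>\<^sub>M lborel) (box (l $ 2) (u $ 2) \<times> box (l $ 1) (u $ 1))" by (simp add: lborel_prod)
  also have "\<dots> = emeasure lborel (box (l $ 2) (u $ 2)) * emeasure lborel (box (l $ 1) (u $ 1))"
    by (rule lborel.emeasure_pair_measure_Times) auto
  finally show "emeasure (distr lborel borel real3) (box l u) = ennreal (\<Prod>b\<in>Basis. (u - l) \<bullet> b)"
    using le[of 1] le[of 2] le[of 3] ne
    by (simp add: B inner_axis ennreal_mult[symmetric] box_real mult.commute mult.left_commute)
qed simp

lemma nn_integral_real3:
  assumes "f \<in> borel_measurable (borel :: (real^3) measure)"
  shows "(\<integral>\<^sup>+v. f v \<partial>lborel) = (\<integral>\<^sup>+z. \<integral>\<^sup>+w. f (real3 (z, w)) \<partial>lborel \<partial>lborel)"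
proof -
  note [measurable] = assms
  have [measurable]: "real3 \<in> borel_measurable borel"
    by (intro borel_measurable_continuous_onI continuous_real3)
  have "(\<integral>\<^sup>+v. f v \<partial>lborel) = (\<integral>\<^sup>+v. f v \<partial>distr lborel borel real3)" by (simp add: lborel_real3)
  also have "\<dots> = (\<integral>\<^sup>+p. f (real3 p) \<partial>lborel)" by (rule nn_integral_distr) simp_all
  also have "\<dots> = (\<integral>\<^sup>+p. f (real3 p) \<partial>(lborel \<Otimes>\<^sub>M lborel))" by (simp add: lborel_prod)
  also have "\<dots> = (\<integral>\<^sup>+z. \<integral>\<^sup>+w. f (real3 (z, w)) \<partial>lborel \<partial>lborel)"
    by (rule lborel.nn_integral_fst[symmetric]) (simp add: lborel_prod)
  finally show ?thesis .
qed

lemma nn_integral_real2: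
  assumes "f \<in> borel_measurable (borel :: (real \<times> real) measure)"
  shows "(\<integral>\<^sup>+w. f w \<partial>lborel) = (\<integral>\<^sup>+y. \<integral>\<^sup>+x. f (y, x) \<partial>lborel \<partial>lborel)"
    "(\<integral>\<^sup>+w. f w \<partial>lborel) = (\<integral>\<^sup>+x. \<integral>\<^sup>+y. f (y, x) \<partial>lborel \<partial>lborel)"
proof -
  have m: "f \<in> borel_measurable (lborel \<Otimes>\<^sub>M lborel)" using assms by (simp add: lborel_prod)
  show 1: "(\<integral>\<^sup>+w. f w \<partial>lborel) = (\<integral>\<^sup>+y. \<integral>\<^sup>+x. f (y, x) \<partial>lborel \<partial>lborel)"
    by (subst lborel.nn_integral_fst[OF m]) (simp add: lborel_prod)
  show "(\<integral>\<^sup>+w. f w \<partial>lborel) = (\<integral>\<^sup>+x. \<integral>\<^sup>+y. f (y, x) \<partial>lborel \<partial>lborel)"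
    unfolding 1 by (rule lborel_pair.Fubini'[symmetric]) (use m in simp)
qed

text \<open>The square is the integral of its derivative from a point to the left of the support.\<close>

lemma square_le_line_integral:
  fixes h h' :: "real \<Rightarrow> real"
  assumes h: "\<And>t. (h has_real_derivative h' t) (at t)" "continuous_on UNIV h'"
    and supp: "\<And>t. \<bar>t\<bar> > R \<Longrightarrow> h t = 0"
  shows "ennreal ((h t)\<^sup>2) \<le> (\<integral>\<^sup>+s. ennreal (2 * (\<bar>h s\<bar> * \<bar>h' s\<bar>)) \<partial>lborel)"
proof -
  let ?a = "- \<bar>R\<bar> - 1"
  have hc: "continuous_on UNIV h"
    using h(1) by (intro continuous_at_imp_continuous_on ballI DERIV_isCont)
  show ?thesis
  proof (cases "?a \<le> t")
    case True
    let ?F = "\<lambda>s. indicator {?a..t} s *\<^sub>R (2 * h s * h' s)"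
    have fc: "continuous_on {?a..t} (\<lambda>s. 2 * h s * h' s)"
      by (intro continuous_intros continuous_on_subset[OF hc] continuous_on_subset[OF h(2)]) auto
    have "integral\<^sup>L lborel ?F = (h t)\<^sup>2 - (h ?a)\<^sup>2"
    proof (rule integral_FTC_atLeastAtMost[OF True _ fc])
      fix x
      have "((\<lambda>s. (h s)\<^sup>2) has_real_derivative 2 * h x * h' x) (at x within {?a..t})"
        by (auto intro!: derivative_eq_intros has_field_derivative_at_within[OF h(1)])
      then show "((\<lambda>s. (h s)\<^sup>2) has_vector_derivative 2 * h x * h' x) (at x within {?a..t})"
        by (simp add: has_real_derivative_iff_has_vector_derivative)
    qed
    moreover have "h ?a = 0" by (rule supp) simp
    ultimately have "ennreal ((h t)\<^sup>2) = ennreal (norm (integral\<^sup>L lborel ?F))" by simp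
    also have "\<dots> \<le> (\<integral>\<^sup>+s. ennreal (norm (?F s)) \<partial>lborel)"
      by (rule integral_norm_bound_ennreal) (use borel_integrable_compact[OF compact_Icc fc] in simp)
    also have "\<dots> \<le> (\<integral>\<^sup>+s. ennreal (2 * (\<bar>h s\<bar> * \<bar>h' s\<bar>)) \<partial>lborel)"
      by (intro nn_integral_mono ennreal_leI) (auto simp: indicator_def abs_mult)
    finally show ?thesis .
  next
    case False
    then have "h t = 0" by (intro supp) auto
    then show ?thesis by simp
  qed
qed

text \<open>Ladyzhenskaya's argument: on each horizontal plane the square of the function is bounded by
  a function of one coordinate and by a function of the other, so the integral of its fourth power
  over the plane factorizes.  The remaining coordinate bounds the mass of every plane.\<close>

lemma ladyzhenskaya:
  fixes \<phi> :: "real^3 \<Rightarrow> real"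
  assumes t: "test_fun \<Omega> \<phi>"
  defines "M \<equiv> \<integral>\<^sup>+x. ennreal ((\<phi> x)\<^sup>2) \<partial>lborel" and "D \<equiv> \<integral>\<^sup>+x. ennreal ((norm (grad \<phi> x))\<^sup>2) \<partial>lborel"
  shows "(\<integral>\<^sup>+x. ennreal ((\<phi> x)^4) \<partial>lborel) \<le> 4 * ((M + D) * D)"
proof -
  have sm: "smooth_on UNIV \<phi>" using t by (rule test_fun_smooth)
  have cont: "continuous_on UNIV \<phi>" "continuous_on UNIV (grad \<phi>)"
    using sm by (auto intro: smooth_on_continuous continuous_grad)
  have [measurable]: "\<phi> \<in> borel_measurable borel" "grad \<phi> \<in> borel_measurable borel"
    using cont by (auto intro: borel_measurable_continuous_onI)
  have r3 [measurable]: "real3 \<in> borel_measurable borel"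
    by (intro borel_measurable_continuous_onI continuous_real3)
  obtain K where K: "compact K" "\<And>x. x \<notin> K \<Longrightarrow> \<phi> x = 0" using test_fun_support[OF t] by metis
  obtain R where R: "\<And>x. x \<in> K \<Longrightarrow> norm x \<le> R" using compact_imp_bounded[OF K(1)] by (auto simp: bounded_iff)
  \<comment> \<open>The integrand that dominates the square of \<open>\<phi>\<close> along each of the three coordinate lines.\<close>
  define q where "q v = ennreal (2 * (\<bar>\<phi> v\<bar> * norm (grad \<phi> v)))" for v
  have [measurable]: "q \<in> borel_measurable borel" unfolding q_def by measurable
  define e where "e = (\<lambda>v. ennreal ((\<phi> v)\<^sup>2))"
  define d where "d = (\<lambda>v. ennreal ((norm (grad \<phi> v))\<^sup>2))"
  have [measurable]: "e \<in> borel_measurable borel" "d \<in> borel_measurable borel" unfolding e_def d_def by measurable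
  have line: "e v \<le> (\<integral>\<^sup>+s. q (v + (s - v $ i) *\<^sub>R axis i 1) \<partial>lborel)" for v i
  proof -
    let ?p = "\<lambda>s. v + (s - v $ i) *\<^sub>R axis i (1::real)"
    have pi: "?p s $ i = s" for s by simp
    have "ennreal ((\<phi> (?p (v $ i)))\<^sup>2) \<le> (\<integral>\<^sup>+s. ennreal (2 * (\<bar>\<phi> (?p s)\<bar> * \<bar>grad \<phi> (?p s) \<bullet> axis i 1\<bar>)) \<partial>lborel)"
    proof (rule square_le_line_integral)
      fix s
      have "((\<lambda>s. \<phi> (?p s)) has_derivative (\<lambda>k. grad \<phi> (?p s) \<bullet> (k *\<^sub>R axis i 1))) (at s)"
        by (rule has_derivative_compose[of ?p _ s UNIV \<phi>, simplified])
          (auto intro!: derivative_eq_intros simp: smooth_has_derivative_grad[OF sm])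
      then show "((\<lambda>s. \<phi> (?p s)) has_real_derivative grad \<phi> (?p s) \<bullet> axis i 1) (at s)"
        unfolding has_field_derivative_def by (rule has_derivative_eq_rhs) (simp add: fun_eq_iff)
      show "\<phi> (?p s) = 0" if "\<bar>s\<bar> > R"
      proof (rule K(2), rule notI)
        assume "?p s \<in> K"
        then show False using R component_le_norm_cart[of "?p s" i] that unfolding pi by force
      qed
    next
      show "continuous_on UNIV (\<lambda>s. grad \<phi> (?p s) \<bullet> axis i 1)"
        by (intro continuous_intros continuous_on_compose2[OF cont(2)]) auto
    qed
    also have "\<dots> \<le> (\<integral>\<^sup>+s. q (?p s) \<partial>lborel)"
      unfolding q_def
    proof (intro nn_integral_mono ennreal_leI mult_left_mono)
      show "\<bar>grad \<phi> (?p s) \<bullet> axis i 1\<bar> \<le> norm (grad \<phi> (?p s))" for s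
        using component_le_norm_cart[of "grad \<phi> (?p s)" i] by (simp add: inner_axis)
    qed auto
    finally show ?thesis by (simp add: e_def)
  qed
  have line_x: "e (real3 (z, y, x)) \<le> (\<integral>\<^sup>+s. q (real3 (z, y, s)) \<partial>lborel)" for x y z
  proof -
    have "real3 (z, y, x) + (s - real3 (z, y, x) $ 1) *\<^sub>R axis 1 1 = real3 (z, y, s)" for s
      by (simp add: vec_eq_iff forall_3 axis_def)
    then show ?thesis using line[of "real3 (z, y, x)" 1] by simp
  qed
  have line_y: "e (real3 (z, y, x)) \<le> (\<integral>\<^sup>+s. q (real3 (z, s, x)) \<partial>lborel)" for x y z
  proof -
    have "real3 (z, y, x) + (s - real3 (z, y, x) $ 2) *\<^sub>R axis 2 1 = real3 (z, s, x)" for s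
      by (simp add: vec_eq_iff forall_3 axis_def)
    then show ?thesis using line[of "real3 (z, y, x)" 2] by simp
  qed
  have line_z: "e (real3 (z, w)) \<le> (\<integral>\<^sup>+s. q (real3 (s, w)) \<partial>lborel)" for z w
  proof -
    obtain y x where w: "w = (y, x)" by (cases w)
    have "real3 (z, y, x) + (s - real3 (z, y, x) $ 3) *\<^sub>R axis 3 1 = real3 (s, y, x)" for s
      by (simp add: vec_eq_iff forall_3 axis_def)
    then show ?thesis using line[of "real3 (z, y, x)" 3] by (simp add: w)
  qed
  define m where "m z = (\<integral>\<^sup>+w. e (real3 (z, w)) \<partial>lborel)" for z
  define dd where "dd z = (\<integral>\<^sup>+w. d (real3 (z, w)) \<partial>lborel)" for z
  define Q where "Q z = (\<integral>\<^sup>+w. q (real3 (z, w)) \<partial>lborel)" for z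
  have pm [measurable]: "(\<lambda>w. f (real3 (z, w))) \<in> borel_measurable borel" if [measurable]: "f \<in> borel_measurable borel"
    for f :: "real^3 \<Rightarrow> ennreal" and z
  proof (rule measurable_compose[OF _ that])
    show "(\<lambda>w. real3 (z, w)) \<in> borel_measurable borel"
      by (intro borel_measurable_continuous_onI continuous_on_compose2[OF continuous_real3[of UNIV]] continuous_intros) auto
  qed
  have plane: "(\<integral>\<^sup>+w. e (real3 (z, w)) * e (real3 (z, w)) \<partial>lborel) \<le> 4 * (m z * dd z)" for z
  proof -
    let ?A = "\<lambda>y. \<integral>\<^sup>+s. q (real3 (z, y, s)) \<partial>lborel" and ?B = "\<lambda>x. \<integral>\<^sup>+s. q (real3 (z, s, x)) \<partial>lborel"
    have mA: "?A \<in> borel_measurable borel" "?B \<in> borel_measurable borel"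
      by measurable
    have "(\<integral>\<^sup>+w. e (real3 (z, w)) * e (real3 (z, w)) \<partial>lborel)
        = (\<integral>\<^sup>+y. \<integral>\<^sup>+x. e (real3 (z, y, x)) * e (real3 (z, y, x)) \<partial>lborel \<partial>lborel)"
      by (rule nn_integral_real2(1)) measurable
    also have "\<dots> \<le> (\<integral>\<^sup>+y. \<integral>\<^sup>+x. ?A y * ?B x \<partial>lborel \<partial>lborel)"
      by (intro nn_integral_mono mult_mono line_x line_y) auto
    also have "\<dots> = (\<integral>\<^sup>+y. ?A y * (\<integral>\<^sup>+x. ?B x \<partial>lborel) \<partial>lborel)"
      using mA by (intro nn_integral_cong nn_integral_cmult) simp
    also have "\<dots> = (\<integral>\<^sup>+y. ?A y \<partial>lborel) * (\<integral>\<^sup>+x. ?B x \<partial>lborel)"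
      using mA by (intro nn_integral_multc) simp
    also have "(\<integral>\<^sup>+y. ?A y \<partial>lborel) = Q z"
      unfolding Q_def by (rule nn_integral_real2(1)[symmetric]) measurable
    also have "(\<integral>\<^sup>+x. ?B x \<partial>lborel) = Q z"
      unfolding Q_def by (rule nn_integral_real2(2)[symmetric]) measurable
    also have "Q z * Q z \<le> 4 * (m z * dd z)"
    proof -
      have "Q z = 2 * (\<integral>\<^sup>+w. ennreal \<bar>\<phi> (real3 (z, w))\<bar> * ennreal (norm (grad \<phi> (real3 (z, w)))) \<partial>lborel)"
        unfolding Q_def q_def
        by (subst nn_integral_cmult[symmetric]) (auto simp: ennreal_mult)
      then have "Q z * Q z = 2\<^sup>2 * (\<integral>\<^sup>+w. ennreal \<bar>\<phi> (real3 (z, w))\<bar> * ennreal (norm (grad \<phi> (real3 (z, w)))) \<partial>lborel)\<^sup>2"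
        by (simp only: power2_eq_square[symmetric] power_mult_distrib)
      also have "(2::ennreal)\<^sup>2 = 4" by simp
      also have "4 * (\<integral>\<^sup>+w. ennreal \<bar>\<phi> (real3 (z, w))\<bar> * ennreal (norm (grad \<phi> (real3 (z, w)))) \<partial>lborel)\<^sup>2 \<le> 4 * ((\<integral>\<^sup>+w. (ennreal \<bar>\<phi> (real3 (z, w))\<bar>)\<^sup>2 \<partial>lborel) * (\<integral>\<^sup>+w. (ennreal (norm (grad \<phi> (real3 (z, w)))))\<^sup>2 \<partial>lborel))"
        by (intro mult_left_mono Cauchy_Schwarz_nn_integral) auto
      also have "\<dots> = 4 * (m z * dd z)"
        by (simp add: m_def dd_def e_def d_def ennreal_power)
      finally show ?thesis .
    qed
    finally show ?thesis .
  qed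
  have m_le: "m z \<le> M + D" for z
  proof -
    have "m z \<le> (\<integral>\<^sup>+w. \<integral>\<^sup>+s. q (real3 (s, w)) \<partial>lborel \<partial>lborel)"
      unfolding m_def by (intro nn_integral_mono line_z)
    also have "\<dots> = (\<integral>\<^sup>+s. \<integral>\<^sup>+w. q (real3 (s, w)) \<partial>lborel \<partial>lborel)"
      by (rule lborel_pair.Fubini') (simp add: lborel_prod case_prod_unfold)
    also have "\<dots> = (\<integral>\<^sup>+v. q v \<partial>lborel)"
      by (rule nn_integral_real3[symmetric]) simp
    also have "\<dots> \<le> (\<integral>\<^sup>+v. e v + d v \<partial>lborel)"
    proof (rule nn_integral_mono)
      fix v
      have "2 * (\<bar>\<phi> v\<bar> * norm (grad \<phi> v)) \<le> (\<phi> v)\<^sup>2 + (norm (grad \<phi> v))\<^sup>2"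
        using sum_squares_bound[of "\<bar>\<phi> v\<bar>" "norm (grad \<phi> v)"] by simp
      then show "q v \<le> e v + d v" by (simp add: q_def e_def d_def ennreal_plus[symmetric] ennreal_leI del: ennreal_plus)
    qed
    also have "\<dots> = M + D" unfolding M_def D_def e_def[symmetric] d_def[symmetric]
      by (subst nn_integral_add) (auto simp: e_def d_def)
    finally show ?thesis .
  qed
  have "(\<integral>\<^sup>+x. ennreal ((\<phi> x)^4) \<partial>lborel) = (\<integral>\<^sup>+v. e v * e v \<partial>lborel)"
    by (intro nn_integral_cong) (simp add: e_def ennreal_mult[symmetric] power2_eq_square power4_eq_xxxx mult.assoc)
  also have "\<dots> = (\<integral>\<^sup>+z. \<integral>\<^sup>+w. e (real3 (z, w)) * e (real3 (z, w)) \<partial>lborel \<partial>lborel)"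
    by (rule nn_integral_real3) measurable
  also have "\<dots> \<le> (\<integral>\<^sup>+z. 4 * ((M + D) * dd z) \<partial>lborel)"
    by (intro nn_integral_mono order_trans[OF plane] mult_left_mono mult_right_mono m_le) auto
  also have "\<dots> = 4 * ((M + D) * (\<integral>\<^sup>+z. dd z \<partial>lborel))"
  proof -
    have "(\<lambda>p. d (real3 p)) \<in> borel_measurable (lborel \<Otimes>\<^sub>M lborel)" by (simp add: lborel_prod)
    then have [measurable]: "dd \<in> borel_measurable borel"
      using lborel.borel_measurable_nn_integral_fst[of "\<lambda>p. d (real3 p)" lborel] by (simp add: dd_def[abs_def])
    show ?thesis by (simp add: nn_integral_cmult)
  qed
  also have "(\<integral>\<^sup>+z. dd z \<partial>lborel) = D"
    unfolding dd_def D_def d_def[symmetric] by (rule nn_integral_real3[symmetric]) simp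
  finally show ?thesis .
qed

text \<open>The bound is uniform along approximating test functions, and Fatou's lemma carries it to the
  limit.\<close>

lemma H10_pair_integrable_power4:
  fixes \<Omega> :: "(real^3) set"
  assumes \<Omega>: "open \<Omega>" and u: "H10_pair \<Omega> u g"
  shows "integrable (lebesgue_on \<Omega>) (\<lambda>x. (u x)^4)"
proof -
  obtain \<phi> :: "nat \<Rightarrow> real^3 \<Rightarrow> real" where 1: "\<And>m. test_fun \<Omega> (\<phi> m)"
    "L2_lim \<Omega> sequentially \<phi> u" "L2_lim \<Omega> sequentially (\<lambda>m. grad (\<phi> m)) g"
    using H10_pairE[OF u] by metis
  let ?M = "lebesgue_on \<Omega>"
  have L: "L2 \<Omega> u" using u by (rule H10_pair_L2)
  have Lm: "L2 \<Omega> (\<phi> m)" for m using 1(1) \<Omega> by (auto intro: test_fun_L2)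
  obtain r :: "nat \<Rightarrow> nat" where r: "AE x in ?M. (\<lambda>n. \<phi> (r n) x) \<longlonglongrightarrow> u x"
    by (rule L2_lim_AE_subseq[OF 1(2) Lm])
  have conv: "AE x in ?M. (\<lambda>n. (\<phi> (r n) x)^4) \<longlonglongrightarrow> (u x)^4"
    using r by eventually_elim (rule tendsto_power)
  have cM: "(\<lambda>m. \<integral>x. 1 * (norm (\<phi> m x))\<^sup>2 \<partial>?M) \<longlonglongrightarrow> (\<integral>x. 1 * (norm (u x))\<^sup>2 \<partial>?M)"
    by (rule L2_lim_weighted_sq[OF 1(2), where A=1]) auto
  have cD: "(\<lambda>m. \<integral>x. 1 * (norm (grad (\<phi> m) x))\<^sup>2 \<partial>?M) \<longlonglongrightarrow> (\<integral>x. 1 * (norm (g x))\<^sup>2 \<partial>?M)"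
    by (rule L2_lim_weighted_sq[OF 1(3), where A=1]) auto
  obtain BM where BM: "\<And>m. (\<integral>x. (norm (\<phi> m x))\<^sup>2 \<partial>?M) \<le> BM"
    using convergent_imp_Bseq[OF convergentI[OF cM]] by (auto simp: Bseq_def)
  obtain BD where BD: "\<And>m. (\<integral>x. (norm (grad (\<phi> m) x))\<^sup>2 \<partial>?M) \<le> BD"
    using convergent_imp_Bseq[OF convergentI[OF cD]] by (auto simp: Bseq_def)
  define B where "B = 4 * ((ennreal BM + ennreal BD) * ennreal BD)"
  have Bfin: "B < \<infinity>" by (auto simp: B_def ennreal_mult_less_top)
  have bound: "(\<integral>\<^sup>+x. ennreal ((\<phi> m x)^4) \<partial>?M) \<le> B" for m
  proof -
    have sm: "smooth_on UNIV (\<phi> m)" using 1(1) by (rule test_fun_smooth)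
    have [measurable]: "\<phi> m \<in> borel_measurable borel" "grad (\<phi> m) \<in> borel_measurable borel"
      using sm by (auto intro: borel_measurable_continuous_onI smooth_on_continuous continuous_grad)
    have restr: "(\<integral>\<^sup>+x. ennreal (f x) \<partial>?M) = (\<integral>\<^sup>+x. ennreal (f x) \<partial>lborel)"
      if "\<And>x. x \<notin> \<Omega> \<Longrightarrow> f x = 0" for f
    proof -
      have "(\<integral>\<^sup>+x. ennreal (f x) \<partial>?M) = (\<integral>\<^sup>+x. ennreal (f x) * indicator \<Omega> x \<partial>lebesgue)"
        using \<Omega> by (intro nn_integral_restrict_space) simp
      also have "\<dots> = (\<integral>\<^sup>+x. ennreal (f x) \<partial>lebesgue)"
        using that by (intro nn_integral_cong) (auto simp: indicator_def)
      finally show ?thesis by (simp add: nn_integral_completion)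
    qed
    have z: "\<phi> m x = 0" "grad (\<phi> m) x = 0" if "x \<notin> \<Omega>" for x
      using test_fun_zero_outside[OF 1(1) that] grad_zero_outside[OF 1(1) that] by auto
    have eM: "(\<integral>\<^sup>+x. ennreal ((\<phi> m x)\<^sup>2) \<partial>lborel) \<le> ennreal BM"
      using L2_integrable_sq[OF Lm[of m]] BM[of m] z by (subst restr[symmetric]) (auto simp: nn_integral_eq_integral ennreal_leI)
    have eD: "(\<integral>\<^sup>+x. ennreal ((norm (grad (\<phi> m) x))\<^sup>2) \<partial>lborel) \<le> ennreal BD"
      using L2_integrable_sq[OF test_fun_L2(2)[OF 1(1)[of m]]] \<Omega> BD[of m] z by (subst restr[symmetric]) (auto simp: nn_integral_eq_integral ennreal_leI)
    have "(\<integral>\<^sup>+x. ennreal ((\<phi> m x)^4) \<partial>?M) = (\<integral>\<^sup>+x. ennreal ((\<phi> m x)^4) \<partial>lborel)" using z by (intro restr) simp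
    also have "\<dots> \<le> B" unfolding B_def
      by (rule order_trans[OF ladyzhenskaya[OF 1(1)]]) (intro mult_left_mono mult_mono add_mono eM eD, auto)
    finally show ?thesis .
  qed
  have "(\<integral>\<^sup>+x. ennreal ((u x)^4) \<partial>?M) = (\<integral>\<^sup>+x. liminf (\<lambda>n. ennreal ((\<phi> (r n) x)^4)) \<partial>?M)"
  proof (rule nn_integral_cong_AE)
    show "AE x in ?M. ennreal ((u x)^4) = liminf (\<lambda>n. ennreal ((\<phi> (r n) x)^4))"
      using conv
    proof eventually_elim
      case (elim x)
      have "(\<lambda>n. ennreal ((\<phi> (r n) x)^4)) \<longlonglongrightarrow> ennreal ((u x)^4)" using elim by (rule tendsto_ennrealI)
      then show ?case by (rule lim_imp_Liminf[OF sequentially_bot, symmetric])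
    qed
  qed
  also have "\<dots> \<le> liminf (\<lambda>n. \<integral>\<^sup>+x. ennreal ((\<phi> (r n) x)^4) \<partial>?M)"
    using L2_measurable[OF Lm] by (intro nn_integral_liminf) measurable
  also have "\<dots> \<le> B" using bound by (intro Liminf_le) auto
  finally have "(\<integral>\<^sup>+x. ennreal ((u x)^4) \<partial>?M) < \<infinity>" using Bfin by (rule order_le_less_trans)
  then show ?thesis using L2_measurable[OF L] by (intro integrableI_nonneg) auto
qed

section \<open>The second variation of the energy\<close>

lemma integrable_four_product:
  fixes a b c d :: "'a \<Rightarrow> real"
  assumes [measurable]: "a \<in> borel_measurable M" "b \<in> borel_measurable M" "c \<in> borel_measurable M" "d \<in> borel_measurable M"
    and i: "integrable M (\<lambda>x. (a x)^4)" "integrable M (\<lambda>x. (b x)^4)" "integrable M (\<lambda>x. (c x)^4)" "integrable M (\<lambda>x. (d x)^4)"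
  shows "integrable M (\<lambda>x. a x * b x * c x * d x)"
proof (rule Bochner_Integration.integrable_bound)
  show "integrable M (\<lambda>x. (a x)^4 + (b x)^4 + (c x)^4 + (d x)^4)"
    using i by (intro Bochner_Integration.integrable_add)
  have "\<bar>p * q * r * s\<bar> \<le> p^4 + q^4 + r^4 + s^4" for p q r s :: real
  proof -
    have sq: "2 * \<bar>y * z\<bar> \<le> y\<^sup>2 + z\<^sup>2" for y z :: real
      using sum_squares_bound[of "\<bar>y\<bar>" "\<bar>z\<bar>"] by (simp add: abs_mult)
    have "2 * \<bar>(p * q) * (r * s)\<bar> \<le> (p * q)\<^sup>2 + (r * s)\<^sup>2" by (rule sq)
    also have "\<dots> = p\<^sup>2 * q\<^sup>2 + r\<^sup>2 * s\<^sup>2" by (simp add: power_mult_distrib)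
    finally have "2 * \<bar>p * q * r * s\<bar> \<le> p\<^sup>2 * q\<^sup>2 + r\<^sup>2 * s\<^sup>2" by (simp add: mult.assoc)
    moreover have "2 * (p\<^sup>2 * q\<^sup>2) \<le> p^4 + q^4" "2 * (r\<^sup>2 * s\<^sup>2) \<le> r^4 + s^4"
      using sq[of "p\<^sup>2" "q\<^sup>2"] sq[of "r\<^sup>2" "s\<^sup>2"] by (simp_all add: abs_mult)
    moreover have "0 \<le> p^4 + q^4 + r^4 + s^4" by simp
    ultimately show ?thesis by linarith
  qed
  then show "AE x in M. norm (a x * b x * c x * d x) \<le> norm ((a x)^4 + (b x)^4 + (c x)^4 + (d x)^4)"
    by (intro AE_I2) (simp add: abs_of_nonneg)
qed measurable

lemma integral_polynomial_eq:
  fixes f0 f1 f2 f3 f4 :: "'a \<Rightarrow> real"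
  assumes "integrable M f0" "integrable M f1" "integrable M f2" "integrable M f3" "integrable M f4"
    and "\<And>x. F x = f0 x + a * f1 x + b * f2 x + c * f3 x + d * f4 x"
  shows "integral\<^sup>L M F = integral\<^sup>L M f0 + a * integral\<^sup>L M f1 + b * integral\<^sup>L M f2
    + c * integral\<^sup>L M f3 + d * integral\<^sup>L M f4"
proof -
  have "F = (\<lambda>x. f0 x + a * f1 x + b * f2 x + c * f3 x + d * f4 x)" using assms(6) by (rule ext)
  then show ?thesis using assms(1-5) by simp
qed

text \<open>Along the line \<open>w + t h\<close> both directional derivatives are derivatives in \<open>t\<close>.\<close>

lemma dir_deriv2_polynomial:
  fixes F :: "'a::real_vector \<Rightarrow> real"
  assumes "\<And>t. F (w + t *\<^sub>R h) = c0 + c1 * t + c2 * t^2 + c3 * t^3 + c4 * t^4"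
  shows "dir_deriv2 F w h h = 2 * c2"
proof -
  have eq: "F ((w + s *\<^sub>R h) + t *\<^sub>R h) = c0 + c1 * (s + t) + c2 * (s + t)^2 + c3 * (s + t)^3 + c4 * (s + t)^4" for s t
    using assms[of "s + t"] by (simp add: scaleR_add_left add.assoc)
  have "dir_deriv F (w + s *\<^sub>R h) h = c1 + 2 * c2 * s + 3 * c3 * s^2 + 4 * c4 * s^3" for s
    unfolding dir_deriv_def eq
    by (rule DERIV_imp_deriv) (auto intro!: derivative_eq_intros simp: eval_nat_numeral)
  moreover have "((\<lambda>s. c1 + 2 * c2 * s + 3 * c3 * s^2 + 4 * c4 * s^3) has_real_derivative 2 * c2) (at 0)"
    by (auto intro!: derivative_eq_intros)
  ultimately show ?thesis
    unfolding dir_deriv2_def dir_deriv_def[of "\<lambda>w'. dir_deriv F w' h"] by (simp add: DERIV_imp_deriv)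
qed

lemma second_variation:
  fixes \<Omega> :: "(real^3) set"
  assumes \<Omega>: "open \<Omega>" and u: "H10_pair \<Omega> u gu" and v: "H10_pair \<Omega> v gv"
    and p: "H10_pair \<Omega> p gp" and q: "H10_pair \<Omega> q gq"
  shows "dir_deriv2 (energy \<Omega> lam \<beta>) (u, v) (p, q) (p, q) =
    (\<integral>x. (norm (gp x))\<^sup>2 + (norm (gq x))\<^sup>2 + lam * (p x)\<^sup>2 + lam * (q x)\<^sup>2 \<partial>lebesgue_on \<Omega>)
    - 3 * (\<integral>x. (u x)\<^sup>2 * (p x)\<^sup>2 + (v x)\<^sup>2 * (q x)\<^sup>2 \<partial>lebesgue_on \<Omega>)
    + \<beta> * (\<integral>x. (u x)\<^sup>2 * (q x)\<^sup>2 + (v x)\<^sup>2 * (p x)\<^sup>2 + 4 * (u x * v x * p x * q x) \<partial>lebesgue_on \<Omega>)"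
proof -
  let ?M = "lebesgue_on \<Omega>"
  note L = H10_pair_L2[OF u] H10_pair_L2[OF v] H10_pair_L2[OF p] H10_pair_L2[OF q]
  note [measurable] = L[THEN L2_measurable]
  note i4 = H10_pair_integrable_power4[OF \<Omega> u] H10_pair_integrable_power4[OF \<Omega> v]
    H10_pair_integrable_power4[OF \<Omega> p] H10_pair_integrable_power4[OF \<Omega> q]
  define good where "good f \<longleftrightarrow> f \<in> borel_measurable ?M \<and> integrable ?M (\<lambda>x. (f x)^4)" for f :: "real^3 \<Rightarrow> real"
  have good [simp]: "good u" "good v" "good p" "good q"
    using i4 by (simp_all add: good_def)
  have g4: "integrable ?M (\<lambda>x. a x * b x * c x * d x)" if "good a" "good b" "good c" "good d" for a b c d
    using that by (intro integrable_four_product) (simp_all add: good_def)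
  have g2: "integrable ?M (\<lambda>x. (a x)\<^sup>2 * (b x)\<^sup>2)" if "good a" "good b" for a b
    using g4[OF that(1) that(1) that(2) that(2)] by (simp add: power2_eq_square mult.assoc)
  note sq = L2_integrable_sq[OF L(2)] L2_integrable_sq[OF L(4)] L2_integrable_sq[OF L(6)] L2_integrable_sq[OF L(8)]
    L2_integrable_sq_real[OF L(1)] L2_integrable_sq_real[OF L(3)] L2_integrable_sq_real[OF L(5)] L2_integrable_sq_real[OF L(7)]
  note inn = integrable_L2_inner[OF L(2) L(6)] integrable_L2_inner[OF L(4) L(8)]
    integrable_L2_mult[OF L(1) L(5)] integrable_L2_mult[OF L(3) L(7)]
  have poly: "energy \<Omega> lam \<beta> ((u, v) + t *\<^sub>R (p, q)) =
    (1/2 * (\<integral>x. (norm (gu x))\<^sup>2 + (norm (gv x))\<^sup>2 + lam * (u x)\<^sup>2 + lam * (v x)\<^sup>2 \<partial>?M)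
       - 1/4 * (\<integral>x. (u x)^4 + (v x)^4 \<partial>?M) + \<beta>/2 * (\<integral>x. (u x)\<^sup>2 * (v x)\<^sup>2 \<partial>?M))
    + ((\<integral>x. gu x \<bullet> gp x + gv x \<bullet> gq x + lam * (u x * p x) + lam * (v x * q x) \<partial>?M)
       - (\<integral>x. u x * u x * u x * p x + v x * v x * v x * q x \<partial>?M)
       + \<beta> * (\<integral>x. u x * p x * v x * v x + u x * u x * v x * q x \<partial>?M)) * t
    + (1/2 * (\<integral>x. (norm (gp x))\<^sup>2 + (norm (gq x))\<^sup>2 + lam * (p x)\<^sup>2 + lam * (q x)\<^sup>2 \<partial>?M)
       - 3/2 * (\<integral>x. (u x)\<^sup>2 * (p x)\<^sup>2 + (v x)\<^sup>2 * (q x)\<^sup>2 \<partial>?M)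
       + \<beta>/2 * (\<integral>x. (u x)\<^sup>2 * (q x)\<^sup>2 + (v x)\<^sup>2 * (p x)\<^sup>2 + 4 * (u x * v x * p x * q x) \<partial>?M)) * t^2
    + (- (\<integral>x. u x * p x * p x * p x + v x * q x * q x * q x \<partial>?M)
       + \<beta> * (\<integral>x. u x * p x * q x * q x + v x * q x * p x * p x \<partial>?M)) * t^3
    + (- 1/4 * (\<integral>x. (p x)^4 + (q x)^4 \<partial>?M) + \<beta>/2 * (\<integral>x. (p x)\<^sup>2 * (q x)\<^sup>2 \<partial>?M)) * t^4" for t
  proof -
    have U: "H10_pair \<Omega> (u + t *\<^sub>R p) (\<lambda>x. gu x + t *\<^sub>R gp x)"
      unfolding plus_fun_def scaleR_fun_def real_scaleR_def by (intro H10_pair_add H10_pair_scale \<Omega> u p)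
    have V: "H10_pair \<Omega> (v + t *\<^sub>R q) (\<lambda>x. gv x + t *\<^sub>R gq x)"
      unfolding plus_fun_def scaleR_fun_def real_scaleR_def by (intro H10_pair_add H10_pair_scale \<Omega> v q)
    have mw: "wgrad \<Omega> (u + t *\<^sub>R p) \<in> borel_measurable ?M" "wgrad \<Omega> (v + t *\<^sub>R q) \<in> borel_measurable ?M"
      using H10_pair_L2(2)[OF H10_imp_H10_pair[OF \<Omega> H10_pair_imp_H10[OF \<Omega> U]]]
        H10_pair_L2(2)[OF H10_imp_H10_pair[OF \<Omega> H10_pair_imp_H10[OF \<Omega> V]]] by (auto dest: L2_measurable)
    have nsq: "(norm (a + t *\<^sub>R b))\<^sup>2 = (norm a)\<^sup>2 + 2 * t * (a \<bullet> b) + t\<^sup>2 * (norm b)\<^sup>2" for a b :: "real^3"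
      by (simp only: power2_norm_eq_inner)
        (simp add: inner_add_left inner_add_right inner_commute[of b a] algebra_simps power2_eq_square)
    have I1: "(\<integral>x. (norm (wgrad \<Omega> (u + t *\<^sub>R p) x))\<^sup>2 + (norm (wgrad \<Omega> (v + t *\<^sub>R q) x))\<^sup>2
           + lam * ((u + t *\<^sub>R p) x)\<^sup>2 + lam * ((v + t *\<^sub>R q) x)\<^sup>2 \<partial>?M)
        = (\<integral>x. (norm (gu x))\<^sup>2 + (norm (gv x))\<^sup>2 + lam * (u x)\<^sup>2 + lam * (v x)\<^sup>2 \<partial>?M)
        + 2 * t * (\<integral>x. gu x \<bullet> gp x + gv x \<bullet> gq x + lam * (u x * p x) + lam * (v x * q x) \<partial>?M)
        + t\<^sup>2 * (\<integral>x. (norm (gp x))\<^sup>2 + (norm (gq x))\<^sup>2 + lam * (p x)\<^sup>2 + lam * (q x)\<^sup>2 \<partial>?M)"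
      (is "_ = integral\<^sup>L ?M ?a0 + 2 * t * integral\<^sup>L ?M ?a1 + t\<^sup>2 * integral\<^sup>L ?M ?a2")
    proof -
      have ia: "integrable ?M ?a0" "integrable ?M ?a1" "integrable ?M ?a2"
        by (intro Bochner_Integration.integrable_add integrable_mult_right sq inn)+
      have "(\<integral>x. (norm (wgrad \<Omega> (u + t *\<^sub>R p) x))\<^sup>2 + (norm (wgrad \<Omega> (v + t *\<^sub>R q) x))\<^sup>2
           + lam * ((u + t *\<^sub>R p) x)\<^sup>2 + lam * ((v + t *\<^sub>R q) x)\<^sup>2 \<partial>?M)
         = (\<integral>x. ?a0 x + 2 * t * ?a1 x + t\<^sup>2 * ?a2 x \<partial>?M)"
      proof (rule integral_cong_AE)
        show "AE x in ?M. (norm (wgrad \<Omega> (u + t *\<^sub>R p) x))\<^sup>2 + (norm (wgrad \<Omega> (v + t *\<^sub>R q) x))\<^sup>2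
           + lam * ((u + t *\<^sub>R p) x)\<^sup>2 + lam * ((v + t *\<^sub>R q) x)\<^sup>2 = ?a0 x + 2 * t * ?a1 x + t\<^sup>2 * ?a2 x"
          using H10_pair_wgrad_AE[OF \<Omega> U] H10_pair_wgrad_AE[OF \<Omega> V]
        proof eventually_elim
          case (elim x)
          show ?case
            unfolding elim nsq
            by (simp add: scaleR_fun_def algebra_simps power2_eq_square)
        qed
        show "(\<lambda>x. (norm (wgrad \<Omega> (u + t *\<^sub>R p) x))\<^sup>2 + (norm (wgrad \<Omega> (v + t *\<^sub>R q) x))\<^sup>2
           + lam * ((u + t *\<^sub>R p) x)\<^sup>2 + lam * ((v + t *\<^sub>R q) x)\<^sup>2) \<in> borel_measurable ?M"
          using mw H10_pair_L2(1)[OF U, THEN L2_measurable] H10_pair_L2(1)[OF V, THEN L2_measurable] by measurable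
      qed measurable
      also have "\<dots> = integral\<^sup>L ?M ?a0 + 2 * t * integral\<^sup>L ?M ?a1 + t\<^sup>2 * integral\<^sup>L ?M ?a2"
        using ia by simp
      finally show ?thesis .
    qed
    have I2: "(\<integral>x. ((u + t *\<^sub>R p) x)^4 + ((v + t *\<^sub>R q) x)^4 \<partial>?M)
        = (\<integral>x. (u x)^4 + (v x)^4 \<partial>?M) + 4 * t * (\<integral>x. u x * u x * u x * p x + v x * v x * v x * q x \<partial>?M)
        + 6 * t\<^sup>2 * (\<integral>x. (u x)\<^sup>2 * (p x)\<^sup>2 + (v x)\<^sup>2 * (q x)\<^sup>2 \<partial>?M)
        + 4 * t^3 * (\<integral>x. u x * p x * p x * p x + v x * q x * q x * q x \<partial>?M)
        + t^4 * (\<integral>x. (p x)^4 + (q x)^4 \<partial>?M)"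
    proof (rule integral_polynomial_eq)
      show "((u + t *\<^sub>R p) x)^4 + ((v + t *\<^sub>R q) x)^4 = ((u x)^4 + (v x)^4)
        + 4 * t * (u x * u x * u x * p x + v x * v x * v x * q x)
        + 6 * t\<^sup>2 * ((u x)\<^sup>2 * (p x)\<^sup>2 + (v x)\<^sup>2 * (q x)\<^sup>2)
        + 4 * t^3 * (u x * p x * p x * p x + v x * q x * q x * q x) + t^4 * ((p x)^4 + (q x)^4)" for x
        by (simp add: scaleR_fun_def) algebra
    qed (intro Bochner_Integration.integrable_add g4 g2 i4 good)+
    have I3: "(\<integral>x. ((u + t *\<^sub>R p) x)\<^sup>2 * ((v + t *\<^sub>R q) x)\<^sup>2 \<partial>?M)
        = (\<integral>x. (u x)\<^sup>2 * (v x)\<^sup>2 \<partial>?M) + 2 * t * (\<integral>x. u x * p x * v x * v x + u x * u x * v x * q x \<partial>?M)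
        + t\<^sup>2 * (\<integral>x. (u x)\<^sup>2 * (q x)\<^sup>2 + (v x)\<^sup>2 * (p x)\<^sup>2 + 4 * (u x * v x * p x * q x) \<partial>?M)
        + 2 * t^3 * (\<integral>x. u x * p x * q x * q x + v x * q x * p x * p x \<partial>?M)
        + t^4 * (\<integral>x. (p x)\<^sup>2 * (q x)\<^sup>2 \<partial>?M)"
    proof (rule integral_polynomial_eq)
      show "((u + t *\<^sub>R p) x)\<^sup>2 * ((v + t *\<^sub>R q) x)\<^sup>2 = (u x)\<^sup>2 * (v x)\<^sup>2
        + 2 * t * (u x * p x * v x * v x + u x * u x * v x * q x)
        + t\<^sup>2 * ((u x)\<^sup>2 * (q x)\<^sup>2 + (v x)\<^sup>2 * (p x)\<^sup>2 + 4 * (u x * v x * p x * q x))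
        + 2 * t^3 * (u x * p x * q x * q x + v x * q x * p x * p x) + t^4 * ((p x)\<^sup>2 * (q x)\<^sup>2)" for x
        by (simp add: scaleR_fun_def) algebra
    qed (intro Bochner_Integration.integrable_add integrable_mult_right g4 g2 good)+
    have "energy \<Omega> lam \<beta> ((u, v) + t *\<^sub>R (p, q)) =
      1/2 * (\<integral>x. (norm (wgrad \<Omega> (u + t *\<^sub>R p) x))\<^sup>2 + (norm (wgrad \<Omega> (v + t *\<^sub>R q) x))\<^sup>2
           + lam * ((u + t *\<^sub>R p) x)\<^sup>2 + lam * ((v + t *\<^sub>R q) x)\<^sup>2 \<partial>?M)
      - 1/4 * (\<integral>x. ((u + t *\<^sub>R p) x)^4 + ((v + t *\<^sub>R q) x)^4 \<partial>?M)
      + \<beta>/2 * (\<integral>x. ((u + t *\<^sub>R p) x)\<^sup>2 * ((v + t *\<^sub>R q) x)\<^sup>2 \<partial>?M)"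
      unfolding energy_def by simp
    then show ?thesis unfolding I1 I2 I3 by (simp add: algebra_simps)
  qed
  show ?thesis
    unfolding dir_deriv2_polynomial[OF poly] by (simp add: algebra_simps)
qed

text \<open>Testing the equation with \<open>A\<^sup>2 U\<close> and completing the square: the gradient of \<open>A U\<close> has square
  \<open>U\<^sup>2 |grad A|\<^sup>2\<close> plus the inner product of the gradients of \<open>U\<close> and of \<open>A\<^sup>2 U\<close>.\<close>

lemma weak_solution_test_square:
  fixes \<Omega> :: "(real^3) set"
  assumes \<Omega>: "open \<Omega>" and U: "H10_pair \<Omega> U gU" and V: "V \<in> borel_measurable (lebesgue_on \<Omega>)" "integrable (lebesgue_on \<Omega>) (\<lambda>x. (V x)^4)"
    and A: "test_fun \<Omega>' A"
    and eq: "\<And>\<phi>. \<phi> \<in> H10 \<Omega> \<Longrightarrow>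
      (\<integral>x. wgrad \<Omega> U x \<bullet> wgrad \<Omega> \<phi> x + lam * U x * \<phi> x \<partial>lebesgue_on \<Omega>) =
      (\<integral>x. ((U x)^3 - \<beta> * U x * (V x)\<^sup>2) * \<phi> x \<partial>lebesgue_on \<Omega>)"
  shows "(\<integral>x. (norm (A x *\<^sub>R gU x + U x *\<^sub>R grad A x))\<^sup>2 + lam * (A x * U x)\<^sup>2 \<partial>lebesgue_on \<Omega>) =
    (\<integral>x. (U x)\<^sup>2 * (norm (grad A x))\<^sup>2 \<partial>lebesgue_on \<Omega>) + (\<integral>x. (U x)^4 * (A x)\<^sup>2 \<partial>lebesgue_on \<Omega>)
    - \<beta> * (\<integral>x. (U x)\<^sup>2 * (V x)\<^sup>2 * (A x)\<^sup>2 \<partial>lebesgue_on \<Omega>)"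
proof -
  let ?M = "lebesgue_on \<Omega>"
  note L = H10_pair_L2[OF U]
  have smA: "smooth_on UNIV A" using A by (rule test_fun_smooth)
  have A2: "test_fun \<Omega>' (\<lambda>x. A x * A x)" using A A by (rule test_fun_mult)
  have gA2: "grad (\<lambda>x. A x * A x) x = (2 * A x) *\<^sub>R grad A x" for x
    by (simp add: grad_mult[OF smA smA] scaleR_2[symmetric] mult.commute)
  have P: "H10_pair \<Omega> (\<lambda>x. A x * A x * U x) (\<lambda>x. (A x * A x) *\<^sub>R gU x + U x *\<^sub>R ((2 * A x) *\<^sub>R grad A x))"
    using H10_pair_mult_test[OF \<Omega> U A2] unfolding gA2 .
  have Q: "H10_pair \<Omega> (\<lambda>x. A x * U x) (\<lambda>x. A x *\<^sub>R gU x + U x *\<^sub>R grad A x)"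
    by (rule H10_pair_mult_test[OF \<Omega> U A])
  note LP = H10_pair_L2[OF P] and LQ = H10_pair_L2[OF Q]
  note [measurable] = L[THEN L2_measurable] LP[THEN L2_measurable] LQ[THEN L2_measurable] V(1)
  have mA [measurable]: "A \<in> borel_measurable ?M" "grad A \<in> borel_measurable ?M"
    using smA by (auto intro: smooth_measurable grad_measurable)
  have mw [measurable]: "wgrad \<Omega> U \<in> borel_measurable ?M" "wgrad \<Omega> (\<lambda>x. A x * A x * U x) \<in> borel_measurable ?M"
    using H10_pair_L2(2)[OF H10_imp_H10_pair[OF \<Omega> H10_pair_imp_H10[OF \<Omega> U]]]
      H10_pair_L2(2)[OF H10_imp_H10_pair[OF \<Omega> H10_pair_imp_H10[OF \<Omega> P]]] by (auto dest: L2_measurable)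
  obtain a b where ab: "\<And>x. \<bar>A x\<bar> \<le> a" "\<And>x. norm (grad A x) \<le> b"
    using test_fun_bounded[OF A] grad_bounded[OF A] by blast
  have bdA: "\<bar>(A x)\<^sup>2\<bar> \<le> a\<^sup>2" for x using power_mono[OF ab(1)[of x], of 2] by simp
  have Ui4: "integrable ?M (\<lambda>x. (U x)^4)" by (rule H10_pair_integrable_power4[OF \<Omega> U])
  have i1: "integrable ?M (\<lambda>x. (U x)\<^sup>2 * (norm (grad A x))\<^sup>2)"
    using L2_integrable_sq[OF L2_mult_bounded_vector[OF L(1) mA(2) ab(2)]] by (simp add: power_mult_distrib)
  have bi: "integrable ?M (\<lambda>x. f x * (A x)\<^sup>2)" if "integrable ?M f" for f :: "real^3 \<Rightarrow> real"
  proof (rule Bochner_Integration.integrable_bound)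
    show "integrable ?M (\<lambda>x. a\<^sup>2 * f x)" using that by (rule integrable_mult_right)
    show "(\<lambda>x. f x * (A x)\<^sup>2) \<in> borel_measurable ?M" using that by measurable
    show "AE x in ?M. norm (f x * (A x)\<^sup>2) \<le> norm (a\<^sup>2 * f x)"
    proof (intro AE_I2)
      fix x show "norm (f x * (A x)\<^sup>2) \<le> norm (a\<^sup>2 * f x)"
        using mult_right_mono[OF bdA[of x], of "\<bar>f x\<bar>"] by (simp add: abs_mult mult.commute)
    qed
  qed
  have i2: "integrable ?M (\<lambda>x. (U x)^4 * (A x)\<^sup>2)" by (rule bi[OF Ui4])
  have i3: "integrable ?M (\<lambda>x. (U x)\<^sup>2 * (V x)\<^sup>2 * (A x)\<^sup>2)"
    using bi[OF integrable_four_product[OF L2_measurable[OF L(1)] L2_measurable[OF L(1)] V(1) V(1) Ui4 Ui4 V(2) V(2)]]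
    by (simp add: power2_eq_square mult.assoc)
  have "(\<integral>x. (norm (A x *\<^sub>R gU x + U x *\<^sub>R grad A x))\<^sup>2 + lam * (A x * U x)\<^sup>2 \<partial>?M)
      = (\<integral>x. (U x)\<^sup>2 * (norm (grad A x))\<^sup>2 + (gU x \<bullet> ((A x * A x) *\<^sub>R gU x + U x *\<^sub>R ((2 * A x) *\<^sub>R grad A x)) + lam * U x * (A x * A x * U x)) \<partial>?M)"
  proof (intro Bochner_Integration.integral_cong refl)
    fix x
    have "(norm (A x *\<^sub>R gU x + U x *\<^sub>R grad A x))\<^sup>2 = (U x)\<^sup>2 * (norm (grad A x))\<^sup>2
        + gU x \<bullet> ((A x * A x) *\<^sub>R gU x + U x *\<^sub>R ((2 * A x) *\<^sub>R grad A x))"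
      by (simp only: power2_norm_eq_inner)
        (simp add: inner_add_left inner_add_right inner_commute[of "grad A x" "gU x"] power2_eq_square algebra_simps)
    then show "(norm (A x *\<^sub>R gU x + U x *\<^sub>R grad A x))\<^sup>2 + lam * (A x * U x)\<^sup>2 = (U x)\<^sup>2 * (norm (grad A x))\<^sup>2
        + (gU x \<bullet> ((A x * A x) *\<^sub>R gU x + U x *\<^sub>R ((2 * A x) *\<^sub>R grad A x)) + lam * U x * (A x * A x * U x))"
      by (simp add: power2_eq_square algebra_simps)
  qed
  also have "\<dots> = (\<integral>x. (U x)\<^sup>2 * (norm (grad A x))\<^sup>2 \<partial>?M)
      + (\<integral>x. gU x \<bullet> ((A x * A x) *\<^sub>R gU x + U x *\<^sub>R ((2 * A x) *\<^sub>R grad A x)) + lam * U x * (A x * A x * U x) \<partial>?M)"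
  proof (rule Bochner_Integration.integral_add[OF i1])
    have "integrable ?M (\<lambda>x. lam * (U x * (A x * A x * U x)))"
      by (intro integrable_mult_right integrable_L2_mult L(1) LP(1))
    then show "integrable ?M (\<lambda>x. gU x \<bullet> ((A x * A x) *\<^sub>R gU x + U x *\<^sub>R ((2 * A x) *\<^sub>R grad A x)) + lam * U x * (A x * A x * U x))"
      by (intro Bochner_Integration.integrable_add integrable_L2_inner L(2) LP(2)) (simp add: mult.assoc)
  qed
  also have "(\<integral>x. gU x \<bullet> ((A x * A x) *\<^sub>R gU x + U x *\<^sub>R ((2 * A x) *\<^sub>R grad A x)) + lam * U x * (A x * A x * U x) \<partial>?M)
      = (\<integral>x. wgrad \<Omega> U x \<bullet> wgrad \<Omega> (\<lambda>x. A x * A x * U x) x + lam * U x * (A x * A x * U x) \<partial>?M)"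
  proof (rule integral_cong_AE)
    show "AE x in ?M. gU x \<bullet> ((A x * A x) *\<^sub>R gU x + U x *\<^sub>R ((2 * A x) *\<^sub>R grad A x)) + lam * U x * (A x * A x * U x)
      = wgrad \<Omega> U x \<bullet> wgrad \<Omega> (\<lambda>x. A x * A x * U x) x + lam * U x * (A x * A x * U x)"
      using H10_pair_wgrad_AE[OF \<Omega> U] H10_pair_wgrad_AE[OF \<Omega> P] by eventually_elim simp
  qed measurable
  also have "\<dots> = (\<integral>x. ((U x)^3 - \<beta> * U x * (V x)\<^sup>2) * (A x * A x * U x) \<partial>?M)"
    by (rule eq[OF H10_pair_imp_H10[OF \<Omega> P]])
  also have "\<dots> = (\<integral>x. (U x)^4 * (A x)\<^sup>2 - \<beta> * ((U x)\<^sup>2 * (V x)\<^sup>2 * (A x)\<^sup>2) \<partial>?M)"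
    by (intro Bochner_Integration.integral_cong refl) algebra
  also have "\<dots> = (\<integral>x. (U x)^4 * (A x)\<^sup>2 \<partial>?M) - \<beta> * (\<integral>x. (U x)\<^sup>2 * (V x)\<^sup>2 * (A x)\<^sup>2 \<partial>?M)"
    using i2 i3 by simp
  finally show ?thesis by simp
qed

text \<open>The form bounding the second variation; it does not depend on the coupling.\<close>

definition cutoff_form ::
    "(real^'n) set \<Rightarrow> (real^'n \<Rightarrow> real) \<Rightarrow> (real^'n \<Rightarrow> real) \<Rightarrow> (real^'n \<Rightarrow> real) \<Rightarrow> real" where
  "cutoff_form \<Omega> u v A = (\<integral>x. ((u x)\<^sup>2 + (v x)\<^sup>2) * (norm (grad A x))\<^sup>2 - 2 * (((u x)^4 + (v x)^4) * (A x)\<^sup>2) \<partial>lebesgue_on \<Omega>)"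

lemma integrable_cutoff_form:
  fixes \<Omega> :: "(real^3) set"
  assumes \<Omega>: "open \<Omega>" and u: "H10_pair \<Omega> u gu" and A: "test_fun \<Omega>' A"
  shows "integrable (lebesgue_on \<Omega>) (\<lambda>x. (u x)\<^sup>2 * (norm (grad A x))\<^sup>2)"
    "integrable (lebesgue_on \<Omega>) (\<lambda>x. (u x)^4 * (A x)\<^sup>2)"
proof -
  have sm: "smooth_on UNIV A" using A by (rule test_fun_smooth)
  note [measurable] = smooth_measurable[OF sm] grad_measurable[OF sm] H10_pair_L2(1)[OF u, THEN L2_measurable]
  obtain a b where ab: "\<And>x. \<bar>A x\<bar> \<le> a" "\<And>x. norm (grad A x) \<le> b"
    using test_fun_bounded[OF A] grad_bounded[OF A] by blast
  show "integrable (lebesgue_on \<Omega>) (\<lambda>x. (u x)\<^sup>2 * (norm (grad A x))\<^sup>2)"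
    using L2_integrable_sq[OF L2_mult_bounded_vector[OF H10_pair_L2(1)[OF u] grad_measurable[OF sm] ab(2)]]
    by (simp add: power_mult_distrib)
  show "integrable (lebesgue_on \<Omega>) (\<lambda>x. (u x)^4 * (A x)\<^sup>2)"
  proof (rule Bochner_Integration.integrable_bound)
    show "integrable (lebesgue_on \<Omega>) (\<lambda>x. a\<^sup>2 * (u x)^4)"
      using H10_pair_integrable_power4[OF \<Omega> u] by (rule integrable_mult_right)
    show "AE x in lebesgue_on \<Omega>. norm ((u x)^4 * (A x)\<^sup>2) \<le> norm (a\<^sup>2 * (u x)^4)"
    proof (intro AE_I2)
      fix x
      have "(A x)\<^sup>2 \<le> a\<^sup>2" using power_mono[OF ab(1)[of x], of 2] by simp
      then show "norm ((u x)^4 * (A x)\<^sup>2) \<le> norm (a\<^sup>2 * (u x)^4)"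
        using mult_right_mono[of "(A x)\<^sup>2" "a\<^sup>2" "(u x)^4"] by (simp add: abs_mult mult.commute)
    qed
  qed measurable
qed

lemma cutoff_form_split:
  fixes \<Omega> :: "(real^3) set"
  assumes \<Omega>: "open \<Omega>" and u: "H10_pair \<Omega> u gu" and v: "H10_pair \<Omega> v gv" and A: "test_fun \<Omega>' A"
  shows "cutoff_form \<Omega> u v A = (\<integral>x. (u x)\<^sup>2 * (norm (grad A x))\<^sup>2 \<partial>lebesgue_on \<Omega>) + (\<integral>x. (v x)\<^sup>2 * (norm (grad A x))\<^sup>2 \<partial>lebesgue_on \<Omega>)
    - 2 * ((\<integral>x. (u x)^4 * (A x)\<^sup>2 \<partial>lebesgue_on \<Omega>) + (\<integral>x. (v x)^4 * (A x)\<^sup>2 \<partial>lebesgue_on \<Omega>))"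
  unfolding cutoff_form_def
  using integrable_cutoff_form[OF \<Omega> u A] integrable_cutoff_form[OF \<Omega> v A] by (simp add: distrib_right)

text \<open>Testing the equations with \<open>A\<^sup>2\<close> times the solution cancels the gradients of the solution
  and the two coupling terms that involve one component of the direction only.  The opposite signs of
  the two components make the mixed coupling term nonpositive.\<close>

lemma second_variation_le_cutoff_form:
  fixes \<Omega> :: "(real^3) set"
  assumes \<Omega>: "open \<Omega>" and sol: "weak_solution \<Omega> lam \<beta> U V" and \<beta>: "\<beta> \<ge> 0" and A: "test_fun \<Omega>' A"
  shows "dir_deriv2 (energy \<Omega> lam \<beta>) (U, V) ((\<lambda>x. A x * U x), (\<lambda>x. - (A x * V x))) ((\<lambda>x. A x * U x), (\<lambda>x. - (A x * V x)))
    \<le> cutoff_form \<Omega> U V A"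
proof -
  let ?M = "lebesgue_on \<Omega>"
  have H: "U \<in> H10 \<Omega>" "V \<in> H10 \<Omega>" using sol by (auto simp: weak_solution_def)
  define gU where "gU = wgrad \<Omega> U"
  define gV where "gV = wgrad \<Omega> V"
  have U: "H10_pair \<Omega> U gU" and V: "H10_pair \<Omega> V gV"
    unfolding gU_def gV_def using H by (auto intro: H10_imp_H10_pair[OF \<Omega>])
  have P: "H10_pair \<Omega> (\<lambda>x. A x * U x) (\<lambda>x. A x *\<^sub>R gU x + U x *\<^sub>R grad A x)"
    by (rule H10_pair_mult_test[OF \<Omega> U A])
  have Q0: "H10_pair \<Omega> (\<lambda>x. A x * V x) (\<lambda>x. A x *\<^sub>R gV x + V x *\<^sub>R grad A x)"
    by (rule H10_pair_mult_test[OF \<Omega> V A])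
  have Q: "H10_pair \<Omega> (\<lambda>x. - (A x * V x)) (\<lambda>x. - (A x *\<^sub>R gV x + V x *\<^sub>R grad A x))"
    using H10_pair_scale[OF \<Omega> Q0, of "-1"] by simp
  note U4 = H10_pair_integrable_power4[OF \<Omega> U] and V4 = H10_pair_integrable_power4[OF \<Omega> V]
  note mU = H10_pair_L2(1)[OF U, THEN L2_measurable] and mV = H10_pair_L2(1)[OF V, THEN L2_measurable]
  have tU: "(\<integral>x. (norm (A x *\<^sub>R gU x + U x *\<^sub>R grad A x))\<^sup>2 + lam * (A x * U x)\<^sup>2 \<partial>?M) =
    (\<integral>x. (U x)\<^sup>2 * (norm (grad A x))\<^sup>2 \<partial>?M) + (\<integral>x. (U x)^4 * (A x)\<^sup>2 \<partial>?M)
    - \<beta> * (\<integral>x. (U x)\<^sup>2 * (V x)\<^sup>2 * (A x)\<^sup>2 \<partial>?M)"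
    using sol by (intro weak_solution_test_square[OF \<Omega> U mV V4 A]) (simp add: weak_solution_def)
  have tV: "(\<integral>x. (norm (A x *\<^sub>R gV x + V x *\<^sub>R grad A x))\<^sup>2 + lam * (A x * V x)\<^sup>2 \<partial>?M) =
    (\<integral>x. (V x)\<^sup>2 * (norm (grad A x))\<^sup>2 \<partial>?M) + (\<integral>x. (V x)^4 * (A x)\<^sup>2 \<partial>?M)
    - \<beta> * (\<integral>x. (V x)\<^sup>2 * (U x)\<^sup>2 * (A x)\<^sup>2 \<partial>?M)"
    using sol by (intro weak_solution_test_square[OF \<Omega> V mU U4 A]) (simp add: weak_solution_def)
  have comm: "(\<integral>x. (V x)\<^sup>2 * (U x)\<^sup>2 * (A x)\<^sup>2 \<partial>?M) = (\<integral>x. (U x)\<^sup>2 * (V x)\<^sup>2 * (A x)\<^sup>2 \<partial>?M)"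
    by (simp add: mult.commute mult.left_commute)
  have "(\<integral>x. (norm (A x *\<^sub>R gU x + U x *\<^sub>R grad A x))\<^sup>2 + (norm (- (A x *\<^sub>R gV x + V x *\<^sub>R grad A x)))\<^sup>2
        + lam * (A x * U x)\<^sup>2 + lam * (- (A x * V x))\<^sup>2 \<partial>?M)
      = (\<integral>x. ((norm (A x *\<^sub>R gU x + U x *\<^sub>R grad A x))\<^sup>2 + lam * (A x * U x)\<^sup>2)
        + ((norm (A x *\<^sub>R gV x + V x *\<^sub>R grad A x))\<^sup>2 + lam * (A x * V x)\<^sup>2) \<partial>?M)"
    unfolding norm_minus_cancel power2_minus by (simp only: add.assoc add.left_commute)
  also have "\<dots> = (\<integral>x. (norm (A x *\<^sub>R gU x + U x *\<^sub>R grad A x))\<^sup>2 + lam * (A x * U x)\<^sup>2 \<partial>?M)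
        + (\<integral>x. (norm (A x *\<^sub>R gV x + V x *\<^sub>R grad A x))\<^sup>2 + lam * (A x * V x)\<^sup>2 \<partial>?M)"
    by (intro Bochner_Integration.integral_add Bochner_Integration.integrable_add integrable_mult_right
      L2_integrable_sq L2_integrable_sq_real H10_pair_L2[OF P] H10_pair_L2[OF Q0])
  finally have T1: "(\<integral>x. (norm (A x *\<^sub>R gU x + U x *\<^sub>R grad A x))\<^sup>2 + (norm (- (A x *\<^sub>R gV x + V x *\<^sub>R grad A x)))\<^sup>2
        + lam * (A x * U x)\<^sup>2 + lam * (- (A x * V x))\<^sup>2 \<partial>?M) = \<dots>" .
  have T2: "(\<integral>x. (U x)\<^sup>2 * (A x * U x)\<^sup>2 + (V x)\<^sup>2 * (- (A x * V x))\<^sup>2 \<partial>?M)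
      = (\<integral>x. (U x)^4 * (A x)\<^sup>2 \<partial>?M) + (\<integral>x. (V x)^4 * (A x)\<^sup>2 \<partial>?M)"
  proof -
    have "(U x)\<^sup>2 * (A x * U x)\<^sup>2 + (V x)\<^sup>2 * (- (A x * V x))\<^sup>2 = (U x)^4 * (A x)\<^sup>2 + (V x)^4 * (A x)\<^sup>2" for x by algebra
    then show ?thesis
      using integrable_cutoff_form(2)[OF \<Omega> U A] integrable_cutoff_form(2)[OF \<Omega> V A] by simp
  qed
  have T3: "(\<integral>x. (U x)\<^sup>2 * (- (A x * V x))\<^sup>2 + (V x)\<^sup>2 * (A x * U x)\<^sup>2 + 4 * (U x * V x * (A x * U x) * - (A x * V x)) \<partial>?M)
      = - 2 * (\<integral>x. (U x)\<^sup>2 * (V x)\<^sup>2 * (A x)\<^sup>2 \<partial>?M)"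
  proof -
    have "(U x)\<^sup>2 * (- (A x * V x))\<^sup>2 + (V x)\<^sup>2 * (A x * U x)\<^sup>2 + 4 * (U x * V x * (A x * U x) * - (A x * V x))
      = - 2 * ((U x)\<^sup>2 * (V x)\<^sup>2 * (A x)\<^sup>2)" for x by algebra
    then show ?thesis by (simp only: integral_mult_right_zero)
  qed
  have nn: "0 \<le> (\<integral>x. (U x)\<^sup>2 * (V x)\<^sup>2 * (A x)\<^sup>2 \<partial>?M)" by (intro Bochner_Integration.integral_nonneg) simp
  have "dir_deriv2 (energy \<Omega> lam \<beta>) (U, V) ((\<lambda>x. A x * U x), (\<lambda>x. - (A x * V x))) ((\<lambda>x. A x * U x), (\<lambda>x. - (A x * V x)))
     = cutoff_form \<Omega> U V A - 4 * (\<beta> * (\<integral>x. (U x)\<^sup>2 * (V x)\<^sup>2 * (A x)\<^sup>2 \<partial>?M))"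
    unfolding second_variation[OF \<Omega> U V P Q] T1 T2 T3 tU tV comm cutoff_form_split[OF \<Omega> U V A]
    by (simp add: algebra_simps)
  then show ?thesis using mult_nonneg_nonneg[OF \<beta> nn] by simp
qed

section \<open>Cutoffs adapted to a component\<close>

lemma open_AE_notin_empty:
  fixes S :: "(real^'n) set"
  assumes "open S" "S \<subseteq> \<Omega>" "open \<Omega>" "AE x in lebesgue_on \<Omega>. x \<notin> S"
  shows "S = {}"
proof (rule ccontr)
  assume "S \<noteq> {}"
  have "AE x in lebesgue. x \<in> \<Omega> \<longrightarrow> x \<notin> S"
    using assms(3,4) by (subst (asm) AE_restrict_space_iff) auto
  then have "AE x in lebesgue. x \<notin> S" by eventually_elim (use assms(2) in auto)
  then have "S \<in> null_sets lebesgue" using assms(1) by (subst AE_iff_null_sets) auto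
  then show False using open_not_negligible[OF assms(1) \<open>S \<noteq> {}\<close>] by (simp add: negligible_iff_null_sets)
qed

text \<open>A limit of points of the superlevel set cannot lie on the boundary of the domain, where
  \<open>w\<close> vanishes, and cannot leave the component, which is relatively closed.\<close>

lemma compact_superlevel_in_component:
  fixes w :: "real^'n \<Rightarrow> real"
  assumes \<Omega>: "open \<Omega>" "bounded \<Omega>" and w: "continuous_on (closure \<Omega>) w" "\<And>x. x \<in> frontier \<Omega> \<Longrightarrow> w x = 0"
    and \<omega>: "\<omega> \<in> components {x \<in> \<Omega>. w x > 0}" and \<epsilon>: "\<epsilon> > 0"
  shows "compact {x \<in> \<omega>. \<epsilon> \<le> w x}"
proof -
  let ?P = "{x \<in> \<Omega>. w x > 0}" and ?K = "{x \<in> \<omega>. \<epsilon> \<le> w x}"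
  have sub: "\<omega> \<subseteq> ?P" using \<omega> by (rule in_components_subset)
  obtain T where T: "closed T" "\<omega> = ?P \<inter> T"
    using closedin_component[OF \<omega>] by (auto simp: closedin_closed)
  have "closed ?K"
  proof (unfold closed_sequential_limits, intro allI impI)
    fix y x assume "(\<forall>n. y n \<in> ?K) \<and> y \<longlonglongrightarrow> x"
    then have y: "\<And>n. y n \<in> \<omega>" "\<And>n. \<epsilon> \<le> w (y n)" "y \<longlonglongrightarrow> x" by auto
    have ycl: "y n \<in> closure \<Omega>" for n using y(1)[of n] sub closure_subset[of \<Omega>] by auto
    have xcl: "x \<in> closure \<Omega>" by (rule closed_sequentially[OF closed_closure ycl y(3)])
    have "(\<lambda>n. w (y n)) \<longlonglongrightarrow> w x"
      using w(1) xcl ycl y(3) unfolding continuous_on_sequentially comp_def by blast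
    then have wx: "\<epsilon> \<le> w x" using y(2) by (intro LIMSEQ_le_const) auto
    then have "x \<notin> frontier \<Omega>" using w(2) \<epsilon> by force
    then have "x \<in> \<Omega>" using xcl \<Omega>(1) by (auto simp: frontier_def interior_open)
    moreover have "x \<in> T" using T y(1) by (intro closed_sequentially[OF T(1) _ y(3)]) auto
    ultimately show "x \<in> ?K" using wx \<epsilon> T(2) by auto
  qed
  moreover have "bounded ?K" by (rule bounded_subset[OF \<Omega>(2)]) (use sub in auto)
  ultimately show ?thesis by (simp add: compact_eq_bounded_closed)
qed

text \<open>The cutoff is a step function of \<open>w = u + v\<close> that rises between the levels \<open>\<epsilon>\<close> and \<open>2 * \<epsilon>\<close>,
  restricted to the component.  Its gradient is bounded by a multiple of \<open>norm (grad w) / \<epsilon>\<close> and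
  lives where \<open>u\<^sup>2 + v\<^sup>2 \<le> 4 * \<epsilon>\<^sup>2\<close>, so the gradient part of the form is at most a multiple of the
  Dirichlet integral of \<open>w\<close> over \<open>{0 < w < 2 * \<epsilon>}\<close>, which tends to 0.  The quartic part tends to a
  positive number.  To obtain a test function, \<open>w\<close> is replaced by test functions converging to it
  and the restriction to the component is done by a smooth \<open>\<theta>\<close> that equals 1 near the superlevel set
  \<open>{w \<ge> \<epsilon>}\<close> of the component; the gradient of \<open>\<theta>\<close> disappears in the limit because the step
  vanishes wherever \<open>\<theta>\<close> is not locally constant.\<close>

lemma component_cutoff:
  fixes \<Omega> :: "(real^3) set"
  assumes \<Omega>: "open \<Omega>" "bounded \<Omega>" and u: "H10_pair \<Omega> u gu" and v: "H10_pair \<Omega> v gv"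
    and bd: "\<And>x. 0 \<le> u x" "\<And>x. u x \<le> B" "\<And>x. 0 \<le> v x" "\<And>x. v x \<le> B"
    and \<omega>: "open \<omega>" "\<omega> \<subseteq> \<Omega>" "\<omega> \<noteq> {}" "\<And>x. x \<in> \<omega> \<Longrightarrow> u x + v x > 0"
    and comp: "\<And>\<epsilon>. \<epsilon> > 0 \<Longrightarrow> compact {x \<in> \<omega>. \<epsilon> \<le> u x + v x}"
  shows "\<exists>\<eta>. test_fun \<omega> \<eta> \<and> cutoff_form \<Omega> u v \<eta> < 0"
proof -
  let ?M = "lebesgue_on \<Omega>"
  define w where "w x = u x + v x" for x
  define gw where "gw x = gu x + gv x" for x
  have W: "H10_pair \<Omega> w gw" unfolding w_def[abs_def] gw_def[abs_def] by (rule H10_pair_add[OF u v])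
  note [measurable] = H10_pair_L2(1)[OF u, THEN L2_measurable] H10_pair_L2(1)[OF v, THEN L2_measurable]
    H10_pair_L2(1)[OF W, THEN L2_measurable] H10_pair_L2(2)[OF W, THEN L2_measurable]
  have [measurable]: "\<omega> \<in> sets ?M" using \<omega>(1,2) \<Omega>(1) by (simp add: sets_restrict_space_iff)
  have [measurable]: "step \<in> borel_measurable borel" "step_deriv \<in> borel_measurable borel"
    by (intro borel_measurable_continuous_onI continuous_step continuous_step_deriv)+
  obtain S where S: "S \<ge> 0" "\<And>t. \<bar>step_deriv t\<bar> \<le> S" using step_deriv_bounded by blast
  have B: "B \<ge> 0" using bd(1,2) order_trans by blast
  obtain \<xi> :: "nat \<Rightarrow> real^3 \<Rightarrow> real" where \<xi>: "\<And>m. test_fun \<Omega> (\<xi> m)"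
    "L2_lim \<Omega> sequentially \<xi> w" "L2_lim \<Omega> sequentially (\<lambda>m. grad (\<xi> m)) gw"
    using H10_pairE[OF W] by metis
  have L\<xi>: "L2 \<Omega> (\<xi> m)" for m using \<xi>(1) \<Omega>(1) by (auto intro: test_fun_L2)
  obtain r :: "nat \<Rightarrow> nat" where r: "strict_mono r" "AE x in ?M. (\<lambda>n. \<xi> (r n) x) \<longlonglongrightarrow> w x"
    by (rule L2_lim_AE_subseq[OF \<xi>(2) L\<xi>])
  define \<zeta> where "\<zeta> n = \<xi> (r n)" for n
  have \<zeta>: "\<And>m. test_fun \<Omega> (\<zeta> m)" "AE x in ?M. (\<lambda>n. \<zeta> n x) \<longlonglongrightarrow> w x"
    "L2_lim \<Omega> sequentially (\<lambda>m. grad (\<zeta> m)) gw"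
    using \<xi>(1) r(2) L2_lim_subseq[OF \<xi>(3) r(1)] by (auto simp: \<zeta>_def)
  have sm\<zeta>: "smooth_on UNIV (\<zeta> m)" for m using \<zeta>(1) by (rule test_fun_smooth)
  have [measurable]: "\<zeta> m \<in> borel_measurable ?M" for m using sm\<zeta> by (rule smooth_measurable)
  define a1 where "a1 x = (u x)\<^sup>2 + (v x)\<^sup>2" for x
  define a2 where "a2 x = (u x)^4 + (v x)^4" for x
  have [measurable]: "a1 \<in> borel_measurable ?M" "a2 \<in> borel_measurable ?M"
    unfolding a1_def[abs_def] a2_def[abs_def] by measurable
  have a1b: "\<bar>a1 x\<bar> \<le> 2 * B\<^sup>2" and a2b: "\<bar>a2 x\<bar> \<le> 2 * B^4" for x
    using power_mono[OF bd(2) bd(1), of x 2] power_mono[OF bd(4) bd(3), of x 2]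
      power_mono[OF bd(2) bd(1), of x 4] power_mono[OF bd(4) bd(3), of x 4]
    by (simp_all add: a1_def a2_def)
  have a1w: "a1 x \<le> (w x)\<^sup>2" for x
    using mult_nonneg_nonneg[OF bd(1)[of x] bd(3)[of x]] by (simp add: a1_def w_def power2_sum)
  have w0: "0 \<le> w x" for x using bd by (simp add: w_def)
  \<comment> \<open>Bounds, as \<open>\<epsilon>\<close> varies, for the two parts of the form at the limiting cutoff.\<close>
  define T1 where "T1 \<epsilon> = (\<integral>x. 4 * S\<^sup>2 * (indicator {x. 0 < w x \<and> w x < 2 * \<epsilon>} x * (norm (gw x))\<^sup>2) \<partial>?M)" for \<epsilon>
  define T2 where "T2 \<epsilon> = (\<integral>x. a2 x * (indicator \<omega> x * (step (w x / \<epsilon> - 1))\<^sup>2) \<partial>?M)" for \<epsilon>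
  have gwi: "integrable ?M (\<lambda>x. (norm (gw x))\<^sup>2)" by (rule L2_integrable_sq[OF H10_pair_L2(2)[OF W]])
  have i1: "integrable ?M (\<lambda>x. 4 * S\<^sup>2 * (indicator {x. 0 < w x \<and> w x < 2 * \<epsilon>} x * (norm (gw x))\<^sup>2))" for \<epsilon>
    by (rule Bochner_Integration.integrable_bound[OF integrable_mult_right[OF gwi, of "4 * S\<^sup>2"]])
      (auto simp: indicator_def)
  have fin: "finite_measure ?M"
    using \<Omega> bounded_set_imp_lmeasurable[OF \<Omega>(2)] by (intro finite_measureI) (auto simp: emeasure_restrict_space fmeasurable_def)
  interpret finite_measure ?M by (rule fin)
  have approx: "\<exists>\<eta>. test_fun \<omega> \<eta> \<and> cutoff_form \<Omega> u v \<eta> < 0" if \<epsilon>: "\<epsilon> > 0" and neg: "T1 \<epsilon> - 2 * T2 \<epsilon> < 0" for \<epsilon>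
  proof -
    have sub: "{x \<in> \<omega>. \<epsilon> \<le> u x + v x} \<subseteq> \<omega>" by auto
    obtain \<theta> N where \<theta>: "test_fun \<omega> \<theta>" "open N" "{x \<in> \<omega>. \<epsilon> \<le> u x + v x} \<subseteq> N" "\<And>x. x \<in> N \<Longrightarrow> \<theta> x = 1"
      by (rule smooth_cutoff[OF comp[OF \<epsilon>] \<omega>(1) sub]) (rule that)
    have \<theta>\<Omega>: "test_fun \<Omega> \<theta>" by (rule test_fun_mono[OF \<theta>(1) \<omega>(2)])
    have sm\<theta>: "smooth_on UNIV \<theta>" by (rule test_fun_smooth[OF \<theta>(1)])
    have [measurable]: "\<theta> \<in> borel_measurable ?M" "grad \<theta> \<in> borel_measurable ?M"
      using sm\<theta> by (auto intro: smooth_measurable grad_measurable)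
    have grad1: "grad \<theta> x = 0" if "x \<in> N" for x
    proof (rule grad_eqI)
      have "((\<lambda>_::real^3. 1::real) has_derivative (\<bullet>) 0) (at x)"
        by (rule has_derivative_eq_rhs[OF has_derivative_const]) (rule ext, rule inner_zero_left[symmetric])
      then show "(\<theta> has_derivative (\<bullet>) 0) (at x)"
        by (rule has_derivative_transform_within_open[OF _ \<theta>(2) that]) (simp add: \<theta>(4))
    qed
    obtain T where T: "T \<ge> 0" "\<And>x. \<bar>\<theta> x\<bar> \<le> T" using test_fun_bounded[OF \<theta>(1)] by blast
    define \<eta> where "\<eta> m x = \<theta> x * step (\<zeta> m x / \<epsilon> - 1)" for m x
    have smst: "smooth_on UNIV (\<lambda>x. step (\<zeta> m x / \<epsilon> - 1))" for m
      using smooth_step[OF smooth_on_diff[OF smooth_on_mult[OF smooth_on_const[of "1 / \<epsilon>"] sm\<zeta>[of m]] smooth_on_const[of 1]]] by simp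
    have t\<eta>: "test_fun \<omega> (\<eta> m)" for m
      unfolding \<eta>_def by (rule test_fun_mult_smooth[OF \<theta>(1) smst])
    have gst: "grad (\<lambda>x. step (\<zeta> m x / \<epsilon> - 1)) x = (step_deriv (\<zeta> m x / \<epsilon> - 1) / \<epsilon>) *\<^sub>R grad (\<zeta> m) x" for m x
    proof (rule grad_compose[OF _ sm\<zeta>])
      fix t
      have "((\<lambda>t. t / \<epsilon> - 1) has_real_derivative 1 / \<epsilon>) (at t)"
        using \<epsilon> by (auto intro!: derivative_eq_intros)
      from DERIV_chain2[OF step_has_deriv this]
      show "((\<lambda>t. step (t / \<epsilon> - 1)) has_real_derivative step_deriv (t / \<epsilon> - 1) / \<epsilon>) (at t)"
        by simp
    qed
    have g\<eta>: "grad (\<eta> m) x = (\<theta> x * (step_deriv (\<zeta> m x / \<epsilon> - 1) / \<epsilon>)) *\<^sub>R grad (\<zeta> m) x + step (\<zeta> m x / \<epsilon> - 1) *\<^sub>R grad \<theta> x" for m x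
      unfolding \<eta>_def by (subst grad_mult[OF sm\<theta> smst]) (simp add: gst)
    have cst: "isCont step t" "isCont step_deriv t" for t
      using continuous_step[of UNIV] continuous_step_deriv[of UNIV] by (simp_all add: continuous_on_eq_continuous_at)
    have c1: "AE x in ?M. (\<lambda>m. step (\<zeta> m x / \<epsilon> - 1)) \<longlonglongrightarrow> step (w x / \<epsilon> - 1)"
      using \<zeta>(2) by eventually_elim (intro isCont_tendsto_compose[OF cst(1)] tendsto_intros, use \<epsilon> in auto)
    have c2: "AE x in ?M. (\<lambda>m. \<theta> x * (step_deriv (\<zeta> m x / \<epsilon> - 1) / \<epsilon>)) \<longlonglongrightarrow> \<theta> x * (step_deriv (w x / \<epsilon> - 1) / \<epsilon>)"
      using \<zeta>(2) by eventually_elim (intro tendsto_mult tendsto_divide isCont_tendsto_compose[OF cst(2)] tendsto_intros, use \<epsilon> in auto)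
    \<comment> \<open>The limit in the mean of the gradients of the cutoffs built from test functions.\<close>
    define G where "G x = (\<theta> x * (step_deriv (w x / \<epsilon> - 1) / \<epsilon>)) *\<^sub>R gw x + step (w x / \<epsilon> - 1) *\<^sub>R grad \<theta> x" for x
    have sb: "\<bar>step t\<bar> \<le> 1" for t using step_bounds[of t] by simp
    have sdb: "\<bar>\<theta> x * (step_deriv t / \<epsilon>)\<bar> \<le> T * (S / \<epsilon>)" for x t
      unfolding abs_mult using T S \<epsilon> by (intro mult_mono) (auto simp: divide_right_mono)
    have l1: "L2_lim \<Omega> sequentially (\<lambda>m x. (\<theta> x * (step_deriv (\<zeta> m x / \<epsilon> - 1) / \<epsilon>)) *\<^sub>R grad (\<zeta> m) x)
        (\<lambda>x. (\<theta> x * (step_deriv (w x / \<epsilon> - 1) / \<epsilon>)) *\<^sub>R gw x)"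
      by (rule L2_lim_mult_dominated[OF \<zeta>(3) _ _ sdb sdb c2]) measurable
    have l2: "L2_lim \<Omega> sequentially (\<lambda>m x. step (\<zeta> m x / \<epsilon> - 1) *\<^sub>R grad \<theta> x) (\<lambda>x. step (w x / \<epsilon> - 1) *\<^sub>R grad \<theta> x)"
      using test_fun_L2(2)[OF \<theta>\<Omega>] \<Omega>(1) by (intro L2_lim_mult_dominated[OF L2_lim_const _ _ sb sb c1]) (simp, measurable)
    have l3: "L2_lim \<Omega> sequentially (\<lambda>m x. step (\<zeta> m x / \<epsilon> - 1) *\<^sub>R \<theta> x) (\<lambda>x. step (w x / \<epsilon> - 1) *\<^sub>R \<theta> x)"
      using test_fun_L2(1)[OF \<theta>\<Omega>] \<Omega>(1) by (intro L2_lim_mult_dominated[OF L2_lim_const _ _ sb sb c1]) (simp, measurable)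
    have lG: "L2_lim \<Omega> sequentially (\<lambda>m. grad (\<eta> m)) G"
      using L2_lim_add[OF l1 l2] unfolding G_def[abs_def] g\<eta>[abs_def] .
    have lim1: "(\<lambda>m. \<integral>x. a1 x * (norm (grad (\<eta> m) x))\<^sup>2 \<partial>?M) \<longlonglongrightarrow> (\<integral>x. a1 x * (norm (G x))\<^sup>2 \<partial>?M)"
      by (rule L2_lim_weighted_sq[OF lG _ a1b]) measurable
    have "(\<lambda>m. \<integral>x. a2 x * (norm (step (\<zeta> m x / \<epsilon> - 1) *\<^sub>R \<theta> x))\<^sup>2 \<partial>?M) \<longlonglongrightarrow> (\<integral>x. a2 x * (norm (step (w x / \<epsilon> - 1) *\<^sub>R \<theta> x))\<^sup>2 \<partial>?M)"
      by (rule L2_lim_weighted_sq[OF l3 _ a2b]) measurable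
    then have lim2: "(\<lambda>m. \<integral>x. a2 x * (\<eta> m x)\<^sup>2 \<partial>?M) \<longlonglongrightarrow> (\<integral>x. a2 x * (step (w x / \<epsilon> - 1) * \<theta> x)\<^sup>2 \<partial>?M)"
      by (simp add: \<eta>_def mult.commute)
    have form: "cutoff_form \<Omega> u v (\<eta> m) = (\<integral>x. a1 x * (norm (grad (\<eta> m) x))\<^sup>2 \<partial>?M) - 2 * (\<integral>x. a2 x * (\<eta> m x)\<^sup>2 \<partial>?M)" for m
      using integrable_cutoff_form[OF \<Omega>(1) u t\<eta>] integrable_cutoff_form[OF \<Omega>(1) v t\<eta>]
      by (simp add: cutoff_form_split[OF \<Omega>(1) u v t\<eta>] a1_def a2_def distrib_right)
    have lim: "(\<lambda>m. cutoff_form \<Omega> u v (\<eta> m)) \<longlonglongrightarrow> (\<integral>x. a1 x * (norm (G x))\<^sup>2 \<partial>?M) - 2 * (\<integral>x. a2 x * (step (w x / \<epsilon> - 1) * \<theta> x)\<^sup>2 \<partial>?M)"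
      unfolding form by (intro tendsto_intros lim1 lim2)
    have b0: "step (w x / \<epsilon> - 1) = 0" "step_deriv (w x / \<epsilon> - 1) = 0" if "w x < \<epsilon>" for x
      using that \<epsilon> by (auto intro!: step_le_0 step_deriv_outside simp: field_simps)
    have inN: "x \<in> N" if "x \<in> \<omega>" "\<epsilon> \<le> w x" for x using that \<theta>(3) by (auto simp: w_def)
    have out: "\<theta> x = 0" "grad \<theta> x = 0" if "x \<notin> \<omega>" for x
      using test_fun_zero_outside[OF \<theta>(1) that] grad_zero_outside[OF \<theta>(1) that] by auto
    have "(\<integral>x. a1 x * (norm (G x))\<^sup>2 \<partial>?M) \<le> T1 \<epsilon>"
      unfolding T1_def
    proof (rule integral_mono'[OF i1])
      fix x
      show "a1 x * (norm (G x))\<^sup>2 \<le> 4 * S\<^sup>2 * (indicator {x. 0 < w x \<and> w x < 2 * \<epsilon>} x * (norm (gw x))\<^sup>2)"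
      proof (cases "x \<in> \<omega> \<and> \<epsilon> \<le> w x \<and> w x < 2 * \<epsilon>")
        case True
        let ?s = "step_deriv (w x / \<epsilon> - 1)"
        have G: "G x = (?s / \<epsilon>) *\<^sub>R gw x" using True \<theta>(4)[OF inN] grad1[OF inN] by (simp add: G_def)
        have 1: "a1 x \<le> 4 * \<epsilon>\<^sup>2"
          using order_trans[OF a1w power_mono[of "w x" "2 * \<epsilon>" 2]] True w0 by (simp add: power_mult_distrib)
        have 2: "?s\<^sup>2 \<le> S\<^sup>2" using power_mono[OF S(2), of "w x / \<epsilon> - 1" 2] by simp
        have "a1 x * (norm (G x))\<^sup>2 = (a1 x / \<epsilon>\<^sup>2) * ?s\<^sup>2 * (norm (gw x))\<^sup>2"
          by (simp add: G power_mult_distrib power_divide)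
        also have "\<dots> \<le> 4 * S\<^sup>2 * (norm (gw x))\<^sup>2"
          using 1 2 \<epsilon> by (intro mult_right_mono mult_mono) (auto simp: field_simps)
        finally show ?thesis using True \<epsilon> by simp
      next
        case False
        have "G x = 0"
        proof (cases "x \<in> \<omega>")
          case xo: True
          show ?thesis
          proof (cases "w x < \<epsilon>")
            case True
            then show ?thesis using b0[of x] by (simp add: G_def)
          next
            case nl: False
            then have "w x / \<epsilon> - 1 \<ge> 1" using xo False \<epsilon> by (simp add: field_simps)
            then have "step_deriv (w x / \<epsilon> - 1) = 0" by (intro step_deriv_outside) simp
            then show ?thesis using grad1[OF inN[of x]] xo nl by (simp add: G_def)
          qed
        next
          case xo: False
          then show ?thesis using out by (simp add: G_def)
        qed
        then show ?thesis by simp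
      qed
    qed simp
    moreover have "(\<integral>x. a2 x * (step (w x / \<epsilon> - 1) * \<theta> x)\<^sup>2 \<partial>?M) = T2 \<epsilon>"
      unfolding T2_def
    proof (intro Bochner_Integration.integral_cong refl)
      fix x
      show "a2 x * (step (w x / \<epsilon> - 1) * \<theta> x)\<^sup>2 = a2 x * (indicator \<omega> x * (step (w x / \<epsilon> - 1))\<^sup>2)"
        using \<theta>(4)[OF inN[of x]] b0[of x] out[of x] by (cases "x \<in> \<omega>"; cases "w x < \<epsilon>") auto
    qed
    ultimately have "(\<integral>x. a1 x * (norm (G x))\<^sup>2 \<partial>?M) - 2 * (\<integral>x. a2 x * (step (w x / \<epsilon> - 1) * \<theta> x)\<^sup>2 \<partial>?M) < 0"
      using neg by simp
    then have "eventually (\<lambda>m. cutoff_form \<Omega> u v (\<eta> m) < 0) sequentially" using lim by (rule order_tendstoD(2)[rotated])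
    then obtain m where "cutoff_form \<Omega> u v (\<eta> m) < 0" by (auto simp: eventually_sequentially)
    then show ?thesis using t\<eta> by blast
  qed
  define \<epsilon> where "\<epsilon> n = inverse (real (Suc n))" for n
  have \<epsilon>: "\<epsilon> n > 0" "\<epsilon> \<longlonglongrightarrow> 0" for n
    using LIMSEQ_inverse_real_of_nat by (simp_all add: \<epsilon>_def[abs_def] del: of_nat_Suc)
  have small: "eventually (\<lambda>n. 2 * \<epsilon> n < t) sequentially" if "t > 0" for t
    using order_tendstoD(2)[OF tendsto_mult_right_zero[OF \<epsilon>(2), of 2] that] .
  have "(\<lambda>n. T1 (\<epsilon> n)) \<longlonglongrightarrow> (\<integral>x. 0 \<partial>?M)"
    unfolding T1_def
  proof (rule integral_dominated_convergence[where w="\<lambda>x. 4 * S\<^sup>2 * (norm (gw x))\<^sup>2"])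
    show "integrable ?M (\<lambda>x. 4 * S\<^sup>2 * (norm (gw x))\<^sup>2)" using gwi by (rule integrable_mult_right)
    show "AE x in ?M. (\<lambda>n. 4 * S\<^sup>2 * (indicator {x. 0 < w x \<and> w x < 2 * \<epsilon> n} x * (norm (gw x))\<^sup>2)) \<longlonglongrightarrow> 0"
    proof (intro AE_I2)
      fix x
      have "eventually (\<lambda>n. 0 = 4 * S\<^sup>2 * (indicator {x. 0 < w x \<and> w x < 2 * \<epsilon> n} x * (norm (gw x))\<^sup>2)) sequentially"
      proof (cases "w x > 0")
        case True
        show ?thesis using small[OF True] by eventually_elim simp
      qed simp
      then show "(\<lambda>n. 4 * S\<^sup>2 * (indicator {x. 0 < w x \<and> w x < 2 * \<epsilon> n} x * (norm (gw x))\<^sup>2)) \<longlonglongrightarrow> 0"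
        by (rule Lim_transform_eventually[OF tendsto_const])
    qed
  qed (use i1 in \<open>auto intro!: AE_I2 borel_measurable_integrable simp: indicator_def\<close>)
  then have lT1: "(\<lambda>n. T1 (\<epsilon> n)) \<longlonglongrightarrow> 0" by simp
  define P where "P = (\<integral>x. a2 x * (indicator \<omega> x * step_top\<^sup>2) \<partial>?M)"
  have a20: "a2 x \<ge> 0" for x by (simp add: a2_def)
  have st1: "step_top \<le> 1" using step_bounds(2)[of 1] step_ge_1[of 1] by simp
  have Pi: "integrable ?M (\<lambda>x. a2 x * (indicator \<omega> x * step_top\<^sup>2))"
  proof (rule integrable_const_bound[where B="2 * B^4"])
    show "AE x in ?M. norm (a2 x * (indicator \<omega> x * step_top\<^sup>2)) \<le> 2 * B^4"
    proof (intro AE_I2)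
      fix x
      have "a2 x * (indicator \<omega> x * step_top\<^sup>2) \<le> 2 * B^4 * 1"
        using a2b[of x] st1 step_top_pos a20[of x]
        by (intro mult_mono) (auto simp: indicator_def power_le_one)
      then show "norm (a2 x * (indicator \<omega> x * step_top\<^sup>2)) \<le> 2 * B^4"
        using a20[of x] by (simp add: abs_of_nonneg)
    qed
  qed measurable
  have lT2: "(\<lambda>n. T2 (\<epsilon> n)) \<longlonglongrightarrow> P"
    unfolding T2_def P_def
  proof (rule integral_dominated_convergence[where w="\<lambda>x. 2 * B^4"])
    show "AE x in ?M. (\<lambda>n. a2 x * (indicator \<omega> x * (step (w x / \<epsilon> n - 1))\<^sup>2)) \<longlonglongrightarrow> a2 x * (indicator \<omega> x * step_top\<^sup>2)"
    proof (intro AE_I2)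
      fix x
      have "eventually (\<lambda>n. a2 x * (indicator \<omega> x * step_top\<^sup>2) = a2 x * (indicator \<omega> x * (step (w x / \<epsilon> n - 1))\<^sup>2)) sequentially"
      proof (cases "x \<in> \<omega>")
        case True
        then have "w x > 0" using \<omega>(4) by (simp add: w_def)
        from small[OF this] show ?thesis
        proof eventually_elim
          case (elim n)
          then have "w x / \<epsilon> n - 1 \<ge> 1" using \<epsilon>(1)[of n] by (simp add: field_simps)
          then show ?case by (simp add: step_ge_1)
        qed
      qed simp
      then show "(\<lambda>n. a2 x * (indicator \<omega> x * (step (w x / \<epsilon> n - 1))\<^sup>2)) \<longlonglongrightarrow> a2 x * (indicator \<omega> x * step_top\<^sup>2)"
        by (rule Lim_transform_eventually[OF tendsto_const])
    qed
    show "AE x in ?M. norm (a2 x * (indicator \<omega> x * (step (w x / \<epsilon> n - 1))\<^sup>2)) \<le> 2 * B^4" for n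
    proof (intro AE_I2)
      fix x
      have "a2 x * (indicator \<omega> x * (step (w x / \<epsilon> n - 1))\<^sup>2) \<le> 2 * B^4 * 1"
        using a2b[of x] step_bounds[of "w x / \<epsilon> n - 1"] a20[of x]
        by (intro mult_mono) (auto simp: indicator_def power_le_one)
      then show "norm (a2 x * (indicator \<omega> x * (step (w x / \<epsilon> n - 1))\<^sup>2)) \<le> 2 * B^4"
        using a20[of x] by (simp add: abs_of_nonneg)
    qed
  qed (simp, measurable)
  have "P \<noteq> 0"
  proof
    assume "P = 0"
    then have "AE x in ?M. a2 x * (indicator \<omega> x * step_top\<^sup>2) = 0"
      unfolding P_def using a20 by (subst (asm) integral_nonneg_eq_0_iff_AE[OF Pi]) (auto intro!: AE_I2 mult_nonneg_nonneg)
    then have "AE x in ?M. x \<notin> \<omega>"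
    proof eventually_elim
      case (elim x)
      show ?case
      proof
        assume x: "x \<in> \<omega>"
        then have "u x > 0 \<or> v x > 0" using \<omega>(4)[OF x] by linarith
        then have "a2 x > 0" by (auto simp: a2_def intro: add_pos_nonneg add_nonneg_pos)
        then show False using elim x step_top_pos by simp
      qed
    qed
    then show False using open_AE_notin_empty[OF \<omega>(1,2) \<Omega>(1)] \<omega>(3) by blast
  qed
  moreover have "P \<ge> 0" unfolding P_def using a20 by (intro Bochner_Integration.integral_nonneg mult_nonneg_nonneg) auto
  ultimately have P: "0 - 2 * P < 0" by simp
  have "(\<lambda>n. T1 (\<epsilon> n) - 2 * T2 (\<epsilon> n)) \<longlonglongrightarrow> 0 - 2 * P" by (intro tendsto_intros lT1 lT2)
  then have "eventually (\<lambda>n. T1 (\<epsilon> n) - 2 * T2 (\<epsilon> n) < 0) sequentially" using P by (rule order_tendstoD(2))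
  then obtain n where "T1 (\<epsilon> n) - 2 * T2 (\<epsilon> n) < 0" by (auto simp: eventually_sequentially)
  then show ?thesis using approx[OF \<epsilon>(1)] by blast
qed

section \<open>Passing to the limit\<close>

lemma L2_lim_of_H10_norm:
  fixes \<Omega> :: "(real^'n) set"
  assumes \<Omega>: "open \<Omega>" "bounded \<Omega>" and U: "eventually (\<lambda>\<beta>. U \<beta> \<in> H10 \<Omega>) F" and u: "u \<in> H10 \<Omega>"
    and lim: "((\<lambda>\<beta>. H10_norm \<Omega> (U \<beta> - u)) \<longlongrightarrow> 0) F"
  shows "L2_lim \<Omega> F U u"
proof -
  obtain C where C: "C \<ge> 0" "\<And>p g. H10_pair \<Omega> p g \<Longrightarrow>
    (\<integral>x. (p x)\<^sup>2 \<partial>lebesgue_on \<Omega>) \<le> C * (\<integral>x. (norm (g x))\<^sup>2 \<partial>lebesgue_on \<Omega>)"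
    using poincare[OF \<Omega>] by blast
  note hu = H10_imp_H10_pair[OF \<Omega>(1) u]
  show ?thesis
  proof (rule L2_limI_bound)
    show "eventually (\<lambda>\<beta>. L2 \<Omega> (U \<beta>)) F"
      using U by eventually_elim (rule H10_pair_L2(1)[OF H10_imp_H10_pair[OF \<Omega>(1)]])
    show "L2 \<Omega> u" by (rule H10_pair_L2(1)[OF hu])
    show "eventually (\<lambda>\<beta>. (\<integral>x. (norm (U \<beta> x - u x))\<^sup>2 \<partial>lebesgue_on \<Omega>) \<le> C * (H10_norm \<Omega> (U \<beta> - u))\<^sup>2) F"
      using U
    proof eventually_elim
      case (elim \<beta>)
      have d: "H10_pair \<Omega> (U \<beta> - u) (\<lambda>x. wgrad \<Omega> (U \<beta>) x - wgrad \<Omega> u x)"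
        unfolding fun_diff_def by (rule H10_pair_diff[OF \<Omega>(1) H10_imp_H10_pair[OF \<Omega>(1) elim] hu])
      show ?case using C(2)[OF d] unfolding H10_norm_sq[OF \<Omega>(1) d] by (simp add: fun_diff_def)
    qed
    show "((\<lambda>\<beta>. C * (H10_norm \<Omega> (U \<beta> - u))\<^sup>2) \<longlongrightarrow> 0) F"
      using tendsto_mult[OF tendsto_const tendsto_power[OF lim, of 2], of C] by simp
  qed
qed

text \<open>Where the limit is negative, its distance from a nonnegative function is at least its absolute
  value, so its negative part is controlled by the mean square distance.\<close>

lemma L2_lim_nonneg:
  fixes f :: "'a \<Rightarrow> real^'n \<Rightarrow> real"
  assumes lim: "L2_lim \<Omega> F f l" and F: "F \<noteq> bot"
    and nn: "eventually (\<lambda>m. AE x in lebesgue_on \<Omega>. 0 \<le> f m x) F"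
  shows "AE x in lebesgue_on \<Omega>. 0 \<le> l x"
proof -
  let ?M = "lebesgue_on \<Omega>"
  note L = L2_limD[OF lim]
  have [measurable]: "l \<in> borel_measurable ?M" using L(2) by (rule L2_measurable)
  have i: "integrable ?M (\<lambda>x. (min (l x) 0)\<^sup>2)"
    by (rule Bochner_Integration.integrable_bound[OF L2_integrable_sq_real[OF L(2)]])
      (auto simp: min_def)
  have "eventually (\<lambda>m. (\<integral>x. (min (l x) 0)\<^sup>2 \<partial>?M) \<le> (\<integral>x. (norm (f m x - l x))\<^sup>2 \<partial>?M)) F"
    using L(1) nn
  proof eventually_elim
    case (elim m)
    show ?case
    proof (rule integral_mono_AE[OF i])
      show "integrable ?M (\<lambda>x. (norm (f m x - l x))\<^sup>2)" using elim(1) L(2) by (intro L2_integrable_sq L2_diff)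
      show "AE x in ?M. (min (l x) 0)\<^sup>2 \<le> (norm (f m x - l x))\<^sup>2"
        using elim(2)
      proof eventually_elim
        case (elim x)
        have "\<bar>min (l x) 0\<bar> \<le> \<bar>f m x - l x\<bar>" using elim by (auto simp: min_def)
        then show ?case using power_mono[of "\<bar>min (l x) 0\<bar>" "\<bar>f m x - l x\<bar>" 2] by simp
      qed
    qed
  qed
  then have "(\<integral>x. (min (l x) 0)\<^sup>2 \<partial>?M) \<le> 0"
    by (rule tendsto_lowerbound[OF L(3) _ F])
  moreover have "0 \<le> (\<integral>x. (min (l x) 0)\<^sup>2 \<partial>?M)" by (intro Bochner_Integration.integral_nonneg) simp
  ultimately have "AE x in ?M. (min (l x) 0)\<^sup>2 = 0"
    using integral_nonneg_eq_0_iff_AE[OF i] by simp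
  then show ?thesis by eventually_elim (auto simp: min_def split: if_splits)
qed

lemma continuous_AE_nonneg:
  fixes \<Omega> :: "(real^'n) set" and f :: "real^'n \<Rightarrow> real"
  assumes "open \<Omega>" "continuous_on \<Omega> f" "AE x in lebesgue_on \<Omega>. 0 \<le> f x" "x \<in> \<Omega>"
  shows "0 \<le> f x"
proof -
  have "\<Omega> \<inter> f -` {..<0} = {}"
  proof (rule open_AE_notin_empty[OF _ _ assms(1)])
    show "open (\<Omega> \<inter> f -` {..<0})" using assms by (intro continuous_open_preimage) auto
    show "AE x in lebesgue_on \<Omega>. x \<notin> \<Omega> \<inter> f -` {..<0}" using assms(3) by eventually_elim auto
  qed auto
  then show ?thesis using assms(4) by (auto simp: not_less[symmetric])
qed

text \<open>The tangent inequality \<open>s\<^sup>2 \<ge> 2 r s - r\<^sup>2\<close> with \<open>r = u\<^sup>2\<close> bounds the quartic term from below by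
  a quadratic one with a bounded weight, so that convergence in the mean is enough.\<close>

lemma eventually_cutoff_form_neg:
  fixes \<Omega> :: "(real^3) set"
  assumes \<Omega>: "open \<Omega>" and lim: "L2_lim \<Omega> F U u" "L2_lim \<Omega> F V v"
    and UV: "eventually (\<lambda>\<beta>. U \<beta> \<in> H10 \<Omega> \<and> V \<beta> \<in> H10 \<Omega>) F"
    and u: "H10_pair \<Omega> u gu" "\<And>x. \<bar>u x\<bar> \<le> B" and v: "H10_pair \<Omega> v gv" "\<And>x. \<bar>v x\<bar> \<le> B"
    and A: "test_fun \<Omega>' A" and neg: "cutoff_form \<Omega> u v A < 0"
  shows "eventually (\<lambda>\<beta>. cutoff_form \<Omega> (U \<beta>) (V \<beta>) A < 0) F"
proof -
  let ?M = "lebesgue_on \<Omega>"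
  have sm: "smooth_on UNIV A" using A by (rule test_fun_smooth)
  note [measurable] = smooth_measurable[OF sm] grad_measurable[OF sm]
  obtain a b where ab: "\<And>x. \<bar>A x\<bar> \<le> a" "\<And>x. norm (grad A x) \<le> b"
    using test_fun_bounded[OF A] grad_bounded[OF A] by blast
  define half where "half p = (\<integral>x. (p x)\<^sup>2 * (norm (grad A x))\<^sup>2 \<partial>?M) - 2 * (\<integral>x. (p x)^4 * (A x)\<^sup>2 \<partial>?M)" for p
  have split: "cutoff_form \<Omega> p q A = half p + half q" if "H10_pair \<Omega> p gp" "H10_pair \<Omega> q gq" for p q gp gq
    by (simp add: cutoff_form_split[OF \<Omega> that A] half_def)
  \<comment> \<open>\<open>E\<close> is quadratic in \<open>P \<beta>\<close> with a bounded weight; it agrees with \<open>half\<close> at the limit \<open>p\<close>.\<close>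
  have one: "\<exists>E. (E \<longlongrightarrow> half p) F \<and> eventually (\<lambda>\<beta>. half (P \<beta>) \<le> E \<beta>) F"
    if P: "L2_lim \<Omega> F P p" "eventually (\<lambda>\<beta>. P \<beta> \<in> H10 \<Omega>) F" and p: "H10_pair \<Omega> p gp" "\<And>x. \<bar>p x\<bar> \<le> B" for P p gp
  proof -
    note [measurable] = H10_pair_L2(1)[OF p(1), THEN L2_measurable]
    define wt where "wt x = (norm (grad A x))\<^sup>2 - 4 * ((p x)\<^sup>2 * (A x)\<^sup>2)" for x
    have [measurable]: "wt \<in> borel_measurable ?M" unfolding wt_def[abs_def] by measurable
    have wtb: "\<bar>wt x\<bar> \<le> b\<^sup>2 + 4 * (B\<^sup>2 * a\<^sup>2)" for x
    proof -
      have "(norm (grad A x))\<^sup>2 \<le> b\<^sup>2" using power_mono[OF ab(2)[of x], of 2] by simp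
      moreover have "(p x)\<^sup>2 * (A x)\<^sup>2 \<le> B\<^sup>2 * a\<^sup>2"
        using power_mono[OF p(2)[of x], of 2] power_mono[OF ab(1)[of x], of 2] by (intro mult_mono) auto
      moreover have "0 \<le> (norm (grad A x))\<^sup>2" "0 \<le> (p x)\<^sup>2 * (A x)\<^sup>2" by simp_all
      ultimately show ?thesis unfolding wt_def by linarith
    qed
    have wi: "integrable ?M (\<lambda>x. wt x * (q x)\<^sup>2)" if "L2 \<Omega> q" for q
    proof (rule Bochner_Integration.integrable_bound)
      show "integrable ?M (\<lambda>x. (b\<^sup>2 + 4 * (B\<^sup>2 * a\<^sup>2)) * (q x)\<^sup>2)"
        using L2_integrable_sq_real[OF that] by (rule integrable_mult_right)
      show "(\<lambda>x. wt x * (q x)\<^sup>2) \<in> borel_measurable ?M" using L2_measurable[OF that] by measurable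
      show "AE x in ?M. norm (wt x * (q x)\<^sup>2) \<le> norm ((b\<^sup>2 + 4 * (B\<^sup>2 * a\<^sup>2)) * (q x)\<^sup>2)"
      proof (intro AE_I2)
        fix x
        have "\<bar>wt x\<bar> * (q x)\<^sup>2 \<le> (b\<^sup>2 + 4 * (B\<^sup>2 * a\<^sup>2)) * (q x)\<^sup>2" using wtb[of x] by (rule mult_right_mono) simp
        then show "norm (wt x * (q x)\<^sup>2) \<le> norm ((b\<^sup>2 + 4 * (B\<^sup>2 * a\<^sup>2)) * (q x)\<^sup>2)" by (simp add: abs_mult)
      qed
    qed
    note ip = integrable_cutoff_form[OF \<Omega> p(1) A]
    define K where "K = 2 * (\<integral>x. (p x)^4 * (A x)\<^sup>2 \<partial>?M)"
    have "((\<lambda>\<beta>. \<integral>x. wt x * (norm (P \<beta> x))\<^sup>2 \<partial>?M) \<longlongrightarrow> (\<integral>x. wt x * (norm (p x))\<^sup>2 \<partial>?M)) F"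
      by (rule L2_lim_weighted_sq[OF P(1) _ wtb]) measurable
    then have "((\<lambda>\<beta>. (\<integral>x. wt x * (P \<beta> x)\<^sup>2 \<partial>?M) + K) \<longlongrightarrow> (\<integral>x. wt x * (p x)\<^sup>2 \<partial>?M) + K) F"
      by (intro tendsto_add tendsto_const) simp
    moreover have "(\<integral>x. wt x * (p x)\<^sup>2 \<partial>?M) + K = half p"
    proof -
      have "(\<integral>x. wt x * (p x)\<^sup>2 \<partial>?M) = (\<integral>x. (p x)\<^sup>2 * (norm (grad A x))\<^sup>2 - 4 * ((p x)^4 * (A x)\<^sup>2) \<partial>?M)"
        unfolding wt_def by (intro Bochner_Integration.integral_cong refl) algebra
      then show ?thesis using ip by (simp add: half_def K_def)
    qed
    moreover have "eventually (\<lambda>\<beta>. half (P \<beta>) \<le> (\<integral>x. wt x * (P \<beta> x)\<^sup>2 \<partial>?M) + K) F"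
      using P(2)
    proof eventually_elim
      case (elim \<beta>)
      note hp = H10_imp_H10_pair[OF \<Omega> elim]
      note iP = integrable_cutoff_form[OF \<Omega> hp A]
      have "half (P \<beta>) = (\<integral>x. (P \<beta> x)\<^sup>2 * (norm (grad A x))\<^sup>2 - 2 * ((P \<beta> x)^4 * (A x)\<^sup>2) \<partial>?M)"
        using iP by (simp add: half_def)
      also have "\<dots> \<le> (\<integral>x. wt x * (P \<beta> x)\<^sup>2 + 2 * ((p x)^4 * (A x)\<^sup>2) \<partial>?M)"
      proof (rule integral_mono)
        fix x
        have "0 \<le> 2 * ((P \<beta> x)\<^sup>2 - (p x)\<^sup>2)\<^sup>2 * (A x)\<^sup>2" by simp
        also have "\<dots> = wt x * (P \<beta> x)\<^sup>2 + 2 * ((p x)^4 * (A x)\<^sup>2) - ((P \<beta> x)\<^sup>2 * (norm (grad A x))\<^sup>2 - 2 * ((P \<beta> x)^4 * (A x)\<^sup>2))"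
          unfolding wt_def by algebra
        finally show "(P \<beta> x)\<^sup>2 * (norm (grad A x))\<^sup>2 - 2 * ((P \<beta> x)^4 * (A x)\<^sup>2) \<le> wt x * (P \<beta> x)\<^sup>2 + 2 * ((p x)^4 * (A x)\<^sup>2)" by simp
      qed (intro Bochner_Integration.integrable_diff Bochner_Integration.integrable_add integrable_mult_right iP ip wi H10_pair_L2(1)[OF hp])+
      also have "\<dots> = (\<integral>x. wt x * (P \<beta> x)\<^sup>2 \<partial>?M) + K"
        using wi[OF H10_pair_L2(1)[OF hp]] ip by (simp add: K_def)
      finally show ?case .
    qed
    ultimately show ?thesis by (intro exI[of _ "\<lambda>\<beta>. (\<integral>x. wt x * (P \<beta> x)\<^sup>2 \<partial>?M) + K"]) simp
  qed
  have ev: "eventually (\<lambda>\<beta>. U \<beta> \<in> H10 \<Omega>) F" "eventually (\<lambda>\<beta>. V \<beta> \<in> H10 \<Omega>) F"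
    using UV by (auto elim: eventually_mono)
  obtain E1 where E1: "(E1 \<longlongrightarrow> half u) F" "eventually (\<lambda>\<beta>. half (U \<beta>) \<le> E1 \<beta>) F" using one[OF lim(1) ev(1) u] by blast
  obtain E2 where E2: "(E2 \<longlongrightarrow> half v) F" "eventually (\<lambda>\<beta>. half (V \<beta>) \<le> E2 \<beta>) F" using one[OF lim(2) ev(2) v] by blast
  have "((\<lambda>\<beta>. E1 \<beta> + E2 \<beta>) \<longlongrightarrow> cutoff_form \<Omega> u v A) F"
    unfolding split[OF u(1) v(1)] by (intro tendsto_add E1 E2)
  then have "eventually (\<lambda>\<beta>. E1 \<beta> + E2 \<beta> < 0) F" using neg by (rule order_tendstoD(2))
  then show ?thesis using E1(2) E2(2) UV
  proof eventually_elim
    case (elim \<beta>)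
    then have "cutoff_form \<Omega> (U \<beta>) (V \<beta>) A = half (U \<beta>) + half (V \<beta>)"
      using split[OF H10_imp_H10_pair[OF \<Omega>] H10_imp_H10_pair[OF \<Omega>]] by blast
    then show ?case using elim by linarith
  qed
qed

section \<open>Counting components\<close>

text \<open>At each point at most one of the cutoffs and of their gradients is nonzero.\<close>

lemma cutoff_form_disjoint_sum:
  fixes \<Omega> :: "(real^3) set" and \<eta> :: "(real^3) set \<Rightarrow> real^3 \<Rightarrow> real"
  assumes \<Omega>: "open \<Omega>" and C: "finite C" "\<And>X Y. X \<in> C \<Longrightarrow> Y \<in> C \<Longrightarrow> X \<noteq> Y \<Longrightarrow> X \<inter> Y = {}"
    and \<eta>: "\<And>X. X \<in> C \<Longrightarrow> test_fun X (\<eta> X)" and u: "H10_pair \<Omega> u gu" and v: "H10_pair \<Omega> v gv"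
  shows "cutoff_form \<Omega> u v (\<lambda>x. \<Sum>X\<in>C. c X * \<eta> X x) = (\<Sum>X\<in>C. (c X)\<^sup>2 * cutoff_form \<Omega> u v (\<eta> X))"
proof -
  let ?M = "lebesgue_on \<Omega>"
  define F where "F A x = ((u x)\<^sup>2 + (v x)\<^sup>2) * (norm (grad A x))\<^sup>2 - 2 * (((u x)^4 + (v x)^4) * (A x)\<^sup>2)" for A x
  have sm: "smooth_on UNIV (\<eta> X)" if "X \<in> C" for X using \<eta>[OF that] by (rule test_fun_smooth)
  have g: "grad (\<lambda>x. \<Sum>X\<in>C. c X * \<eta> X x) x = (\<Sum>X\<in>C. c X *\<^sub>R grad (\<eta> X) x)" for x
  proof -
    have "grad (\<lambda>x. \<Sum>X\<in>C. c X * \<eta> X x) x = (\<Sum>X\<in>C. grad (\<lambda>x. c X * \<eta> X x) x)"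
      by (intro grad_sum smooth_on_mult smooth_on_const sm)
    also have "\<dots> = (\<Sum>X\<in>C. c X *\<^sub>R grad (\<eta> X) x)" by (intro sum.cong refl grad_cmult sm)
    finally show ?thesis .
  qed
  have pt: "F (\<lambda>x. \<Sum>X\<in>C. c X * \<eta> X x) x = (\<Sum>X\<in>C. (c X)\<^sup>2 * F (\<eta> X) x)" for x
  proof (cases "\<exists>X\<in>C. x \<in> X")
    case True
    then obtain X where X: "X \<in> C" "x \<in> X" by blast
    have z: "\<eta> Y x = 0" "grad (\<eta> Y) x = 0" if "Y \<in> C - {X}" for Y
    proof -
      have "x \<notin> Y" using C(2)[OF X(1), of Y] that X(2) by auto
      then show "\<eta> Y x = 0" "grad (\<eta> Y) x = 0"
        using test_fun_zero_outside[OF \<eta>[of Y]] grad_zero_outside[OF \<eta>[of Y]] that by auto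
    qed
    have "(\<Sum>Y\<in>C. c Y * \<eta> Y x) = c X * \<eta> X x"
      using z by (subst sum.remove[OF C(1) X(1)]) simp
    moreover have "(\<Sum>Y\<in>C. c Y *\<^sub>R grad (\<eta> Y) x) = c X *\<^sub>R grad (\<eta> X) x"
      using z by (subst sum.remove[OF C(1) X(1)]) simp
    moreover have "(\<Sum>Y\<in>C. (c Y)\<^sup>2 * F (\<eta> Y) x) = (c X)\<^sup>2 * F (\<eta> X) x"
      using z by (subst sum.remove[OF C(1) X(1)]) (simp add: F_def)
    ultimately show ?thesis
      by (simp add: F_def g power_mult_distrib algebra_simps)
  next
    case False
    have z: "\<eta> Y x = 0" "grad (\<eta> Y) x = 0" if "Y \<in> C" for Y
      using False that test_fun_zero_outside[OF \<eta>[of Y]] grad_zero_outside[OF \<eta>[of Y]] by auto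
    then show ?thesis by (simp add: F_def g)
  qed
  have i: "integrable ?M (F (\<eta> X))" if "X \<in> C" for X
    unfolding F_def[abs_def] distrib_right
    by (intro Bochner_Integration.integrable_diff Bochner_Integration.integrable_add integrable_mult_right
      integrable_cutoff_form[OF \<Omega> u \<eta>[OF that]] integrable_cutoff_form[OF \<Omega> v \<eta>[OF that]])
  have "cutoff_form \<Omega> u v (\<lambda>x. \<Sum>X\<in>C. c X * \<eta> X x) = (\<integral>x. F (\<lambda>x. \<Sum>X\<in>C. c X * \<eta> X x) x \<partial>?M)"
    by (simp add: cutoff_form_def F_def)
  also have "\<dots> = (\<integral>x. (\<Sum>X\<in>C. (c X)\<^sup>2 * F (\<eta> X) x) \<partial>?M)" by (simp only: pt)
  also have "\<dots> = (\<Sum>X\<in>C. \<integral>x. (c X)\<^sup>2 * F (\<eta> X) x \<partial>?M)"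
    by (intro Bochner_Integration.integral_sum integrable_mult_right i)
  also have "\<dots> = (\<Sum>X\<in>C. (c X)\<^sup>2 * cutoff_form \<Omega> u v (\<eta> X))"
    by (simp add: cutoff_form_def F_def)
  finally show ?thesis .
qed

lemma sum_fun_apply: "(\<Sum>i\<in>I. f i) x = (\<Sum>i\<in>I. f i x :: 'b::ab_group_add)"
  by (induction I rule: infinite_finite_induct) auto

lemma dir_deriv2_zero: "dir_deriv2 F w 0 0 = 0"
  using dir_deriv2_polynomial[of F w 0 "F w" 0 0 0 0] by simp

text \<open>Every nontrivial combination of the directions has negative second variation.  The zero
  direction has second variation zero, so this also shows that the directions are linearly
  independent.\<close>

lemma morse_index_ge_cutoffs:
  fixes \<Omega> :: "(real^3) set" and \<eta> :: "(real^3) set \<Rightarrow> real^3 \<Rightarrow> real"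
  assumes \<Omega>: "open \<Omega>" and sol: "weak_solution \<Omega> lam \<beta> U V" and \<beta>: "\<beta> \<ge> 0"
    and C: "finite C" "\<And>X Y. X \<in> C \<Longrightarrow> Y \<in> C \<Longrightarrow> X \<noteq> Y \<Longrightarrow> X \<inter> Y = {}" "\<And>X. X \<in> C \<Longrightarrow> X \<subseteq> \<Omega>"
    and \<eta>: "\<And>X. X \<in> C \<Longrightarrow> test_fun X (\<eta> X)" and neg: "\<And>X. X \<in> C \<Longrightarrow> cutoff_form \<Omega> U V (\<eta> X) < 0"
  shows "enat (card C) \<le> morse_index (H10 \<Omega> \<times> H10 \<Omega>) (energy \<Omega> lam \<beta>) (U, V)"
proof -
  have H: "U \<in> H10 \<Omega>" "V \<in> H10 \<Omega>" using sol by (auto simp: weak_solution_def)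
  note hU = H10_imp_H10_pair[OF \<Omega> H(1)] and hV = H10_imp_H10_pair[OF \<Omega> H(2)]
  define h where "h X = ((\<lambda>x. \<eta> X x * U x), (\<lambda>x. - (\<eta> X x * V x)))" for X
  define A where "A c x = (\<Sum>X\<in>C. c X * \<eta> X x)" for c x
  have comb: "(\<Sum>X\<in>C. c X *\<^sub>R h X) = ((\<lambda>x. A c x * U x), (\<lambda>x. - (A c x * V x)))" for c
  proof (rule prod_eqI)
    show "fst (\<Sum>X\<in>C. c X *\<^sub>R h X) = fst ((\<lambda>x. A c x * U x), (\<lambda>x. - (A c x * V x)))"
      by (simp add: fst_sum h_def fun_eq_iff sum_fun_apply scaleR_fun_def A_def sum_distrib_right mult.assoc)
    show "snd (\<Sum>X\<in>C. c X *\<^sub>R h X) = snd ((\<lambda>x. A c x * U x), (\<lambda>x. - (A c x * V x)))"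
      by (simp add: snd_sum h_def fun_eq_iff sum_fun_apply scaleR_fun_def A_def sum_distrib_right mult.assoc sum_negf)
  qed
  have tA: "test_fun \<Omega> (A c)" for c
    unfolding A_def[abs_def] using \<eta> C(3) by (intro test_fun_sum test_fun_cmult) (auto intro: test_fun_mono)
  let ?D = "\<lambda>d. dir_deriv2 (energy \<Omega> lam \<beta>) (U, V) d d"
  have D: "?D (\<Sum>X\<in>C. c X *\<^sub>R h X) < 0" if X: "X \<in> C" "c X \<noteq> 0" for c X
  proof -
    have "?D (\<Sum>X\<in>C. c X *\<^sub>R h X) \<le> cutoff_form \<Omega> U V (A c)"
      unfolding comb by (rule second_variation_le_cutoff_form[OF \<Omega> sol \<beta> tA])
    also have "\<dots> = (\<Sum>X\<in>C. (c X)\<^sup>2 * cutoff_form \<Omega> U V (\<eta> X))"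
      unfolding A_def[abs_def] by (rule cutoff_form_disjoint_sum[OF \<Omega> C(1,2) \<eta> hU hV])
    also have "\<dots> < 0"
    proof -
      have "0 < (\<Sum>X\<in>C. (c X)\<^sup>2 * - cutoff_form \<Omega> U V (\<eta> X))"
        using X neg by (intro sum_pos2[OF C(1) X(1)] mult_pos_pos mult_nonneg_nonneg) (auto simp: less_imp_le)
      then show ?thesis by (simp add: sum_negf)
    qed
    finally show ?thesis .
  qed
  have ne0: "(\<Sum>X\<in>C. c X *\<^sub>R h X) \<noteq> 0" if "X \<in> C" "c X \<noteq> 0" for c X
    using D[where c=c and X=X, OF that] dir_deriv2_zero[of "energy \<Omega> lam \<beta>" "(U, V)"] by (metis less_irrefl)
  have inj: "inj_on h C"
  proof (rule inj_onI, rule ccontr)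
    fix X Y assume XY: "X \<in> C" "Y \<in> C" "h X = h Y" "X \<noteq> Y"
    define c where "c Z = (if Z = X then 1 else 0) - (if Z = Y then 1 else (0::real))" for Z
    have "(\<Sum>Z\<in>C. c Z *\<^sub>R h Z) = (\<Sum>Z\<in>C. (if Z = X then h Z else 0) - (if Z = Y then h Z else 0))"
      by (intro sum.cong refl) (simp add: c_def)
    also have "\<dots> = 0" using XY C(1) by (simp add: sum_subtractf)
    finally show False using ne0[where c=c and X=X, OF XY(1)] XY(4) by (simp add: c_def)
  qed
  have ind: "independent (h ` C)"
  proof
    assume "dependent (h ` C)"
    then have "\<exists>a. (\<exists>d\<in>h ` C. a d \<noteq> 0) \<and> (\<Sum>d\<in>h ` C. a d *\<^sub>R d) = 0"
      using dependent_finite[of "h ` C"] C(1) by simp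
    then obtain a where d: "\<exists>X\<in>C. a (h X) \<noteq> 0" "(\<Sum>d\<in>h ` C. a d *\<^sub>R d) = 0" by blast
    from d(1) obtain X where X: "X \<in> C" "a (h X) \<noteq> 0" by blast
    have "(\<Sum>X\<in>C. a (h X) *\<^sub>R h X) = 0" using d(2) by (simp add: sum.reindex[OF inj])
    then show False using ne0[where c="\<lambda>X. a (h X)" and X=X, OF X(1)] X(2) by simp
  qed
  have repr: "\<exists>c. d = (\<Sum>X\<in>C. c X *\<^sub>R h X)" if "d \<in> span (h ` C)" for d
  proof -
    obtain a where "d = (\<Sum>d\<in>h ` C. a d *\<^sub>R d)" using \<open>d \<in> span (h ` C)\<close> C(1) by (auto simp: span_finite)
    then have "d = (\<Sum>X\<in>C. a (h X) *\<^sub>R h X)" by (simp add: sum.reindex[OF inj])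
    then show ?thesis by (rule exI[where x="\<lambda>X. a (h X)"])
  qed
  have "enat (dim (span (h ` C))) \<le> morse_index (H10 \<Omega> \<times> H10 \<Omega>) (energy \<Omega> lam \<beta>) (U, V)"
    unfolding morse_index_def
  proof (rule Sup_upper, rule CollectI, rule exI[of _ "span (h ` C)"], intro conjI ballI impI)
    show "subspace (span (h ` C))" by (rule subspace_span)
    show "\<exists>B. finite B \<and> span (h ` C) = span B" using C(1) by blast
    show "span (h ` C) \<subseteq> H10 \<Omega> \<times> H10 \<Omega>"
    proof
      fix d assume "d \<in> span (h ` C)"
      then obtain c where "d = (\<Sum>X\<in>C. c X *\<^sub>R h X)" using repr by blast
      then have d: "d = ((\<lambda>x. A c x * U x), (\<lambda>x. - (A c x * V x)))" unfolding comb .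
      have "(\<lambda>x. A c x * U x) \<in> H10 \<Omega>" by (rule H10_pair_imp_H10[OF \<Omega> H10_pair_mult_test[OF \<Omega> hU tA]])
      moreover have "(\<lambda>x. - 1 * (A c x * V x)) \<in> H10 \<Omega>"
        by (rule H10_pair_imp_H10[OF \<Omega> H10_pair_scale[OF \<Omega> H10_pair_mult_test[OF \<Omega> hV tA]]])
      ultimately show "d \<in> H10 \<Omega> \<times> H10 \<Omega>" by (simp add: d)
    qed
    fix d assume d: "d \<in> span (h ` C)" "d \<noteq> 0"
    obtain c where c: "d = (\<Sum>X\<in>C. c X *\<^sub>R h X)" using repr[OF d(1)] by blast
    have "\<exists>X\<in>C. c X \<noteq> 0"
    proof (rule ccontr)
      assume "\<not> (\<exists>X\<in>C. c X \<noteq> 0)"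
      then have "d = 0" unfolding c by (intro sum.neutral) simp
      then show False using d(2) by simp
    qed
    then show "?D d < 0" unfolding c using D[where c=c] by blast
  qed simp
  also have "dim (span (h ` C)) = card C"
    using dim_span dim_eq_card_independent[OF ind] card_image[OF inj] by simp
  finally show ?thesis .
qed

theorem theorem1p3:
  fixes \<Omega> :: "(real^3) set" and lam \<beta>\<^sub>0 C :: real and k :: nat
    and U V :: "real \<Rightarrow> real^3 \<Rightarrow> real" and u v uc vc :: "real^3 \<Rightarrow> real"
  assumes "smooth_bounded_domain \<Omega>" and "\<beta>\<^sub>0 > 0" and "C > 0"
    and "\<And>\<beta>. \<beta> \<ge> \<beta>\<^sub>0 \<Longrightarrow> weak_solution \<Omega> lam \<beta> (U \<beta>) (V \<beta>)"
    and "\<And>\<beta>. \<beta> \<ge> \<beta>\<^sub>0 \<Longrightarrow> AE x in lebesgue_on \<Omega>. U \<beta> x > 0 \<and> V \<beta> x > 0"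
    and "\<And>\<beta>. \<beta> \<ge> \<beta>\<^sub>0 \<Longrightarrow> \<not> (AE x in lebesgue_on \<Omega>. U \<beta> x = V \<beta> x)"
    and "\<And>\<beta>. \<beta> \<ge> \<beta>\<^sub>0 \<Longrightarrow>
           morse_index (H10 \<Omega> \<times> H10 \<Omega>) (energy \<Omega> lam \<beta>) (U \<beta>, V \<beta>) \<le> enat k"
    and "\<And>\<beta>. \<beta> \<ge> \<beta>\<^sub>0 \<Longrightarrow> H10_norm \<Omega> (U \<beta>) + H10_norm \<Omega> (V \<beta>) \<le> C"
    and "u \<in> H10 \<Omega>" and "v \<in> H10 \<Omega>"
    and "((\<lambda>\<beta>. H10_norm \<Omega> (U \<beta> - u)) \<longlongrightarrow> 0) at_top"
    and "((\<lambda>\<beta>. H10_norm \<Omega> (V \<beta> - v)) \<longlongrightarrow> 0) at_top"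
    and "continuous_rep \<Omega> u uc" and "continuous_rep \<Omega> v vc"
  shows "finite (components {x \<in> \<Omega>. uc x + vc x > 0}) \<and>
         card (components {x \<in> \<Omega>. uc x + vc x > 0}) \<le> k"
proof (rule ccontr)
  let ?M = "lebesgue_on \<Omega>"
  let ?P = "{x \<in> \<Omega>. uc x + vc x > 0}"
  assume contra: "\<not> (finite (components ?P) \<and> card (components ?P) \<le> k)"
  have \<Omega>: "open \<Omega>" "bounded \<Omega>" "smooth_boundary \<Omega>"
    using assms(1) by (auto simp: smooth_bounded_domain_def)
  have ev0: "eventually (\<lambda>\<beta>. \<beta> \<ge> \<beta>\<^sub>0) (at_top :: real filter)" by (rule eventually_ge_at_top)
  have evH: "eventually (\<lambda>\<beta>. U \<beta> \<in> H10 \<Omega> \<and> V \<beta> \<in> H10 \<Omega>) at_top"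
    using ev0 by eventually_elim (use assms(4) in \<open>auto simp: weak_solution_def\<close>)
  \<comment> \<open>Extending the continuous representative by 0 makes its bounds valid everywhere without changing
    its class.\<close>
  have rep: "\<exists>ub gb B. H10_pair \<Omega> ub gb \<and> L2_lim \<Omega> at_top P ub \<and> (\<forall>x. 0 \<le> ub x \<and> ub x \<le> B) \<and>
      (\<forall>x\<in>\<Omega>. ub x = pc x) \<and> continuous_on (closure \<Omega>) pc \<and> (\<forall>x\<in>frontier \<Omega>. pc x = 0)"
    if p: "p \<in> H10 \<Omega>" and lim: "((\<lambda>\<beta>. H10_norm \<Omega> (P \<beta> - p)) \<longlongrightarrow> 0) at_top"
      and pc: "continuous_rep \<Omega> p pc" and PH: "eventually (\<lambda>\<beta>. P \<beta> \<in> H10 \<Omega>) at_top"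
      and pos: "eventually (\<lambda>\<beta>. AE x in ?M. 0 \<le> P \<beta> x) at_top" for p pc and P :: "real \<Rightarrow> real^3 \<Rightarrow> real"
  proof -
    define pb where "pb x = (if x \<in> \<Omega> then pc x else 0)" for x
    have cpc: "continuous_on (closure \<Omega>) pc" and AEp: "AE x in ?M. pc x = p x"
      using pc by (auto simp: continuous_rep_def)
    have cO: "continuous_on \<Omega> pc" using cpc closure_subset by (rule continuous_on_subset)
    have mpc: "pc \<in> borel_measurable ?M"
      using \<Omega>(1) by (intro continuous_imp_measurable_on_sets_lebesgue cO) simp
    have mpb: "pb \<in> borel_measurable ?M"
      using mpc by (rule measurable_cong[THEN iffD1, rotated]) (simp add: pb_def)
    have AEpb: "AE x in ?M. pb x = p x"
      using AEp AE_space by eventually_elim (simp add: pb_def)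
    have L: "L2_lim \<Omega> at_top P p" by (rule L2_lim_of_H10_norm[OF \<Omega>(1,2) PH p lim])
    have "AE x in ?M. 0 \<le> p x" by (rule L2_lim_nonneg[OF L _ pos]) simp
    then have "AE x in ?M. 0 \<le> pc x" using AEp by eventually_elim simp
    then have nn: "0 \<le> pc x" if "x \<in> \<Omega>" for x by (rule continuous_AE_nonneg[OF \<Omega>(1) cO _ that])
    have cpt: "compact (pc ` closure \<Omega>)"
      using \<Omega>(2) by (intro compact_continuous_image cpc) (simp add: compact_closure)
    obtain B where B: "\<forall>y\<in>pc ` closure \<Omega>. \<bar>y\<bar> \<le> B"
      using compact_imp_bounded[OF cpt] by (auto simp: bounded_iff)
    have bd: "0 \<le> pb x \<and> pb x \<le> max B 0" for x
    proof (cases "x \<in> \<Omega>")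
      case True
      then have "\<bar>pc x\<bar> \<le> B" using B closure_subset by blast
      then show ?thesis using True nn[OF True] by (simp add: pb_def)
    qed (simp add: pb_def)
    have hp: "H10_pair \<Omega> p (wgrad \<Omega> p)" by (rule H10_imp_H10_pair[OF \<Omega>(1) p])
    obtain \<phi> :: "nat \<Rightarrow> real^3 \<Rightarrow> real" where \<phi>: "\<And>m. test_fun \<Omega> (\<phi> m)"
      "L2_lim \<Omega> sequentially \<phi> p" "L2_lim \<Omega> sequentially (\<lambda>m. grad (\<phi> m)) (wgrad \<Omega> p)"
      using H10_pairE[OF hp] by metis
    have "H10_pair \<Omega> pb (wgrad \<Omega> p)"
      unfolding H10_pair_def using \<phi>(1,3) L2_lim_cong_AE[OF \<phi>(2) AEpb mpb] by blast
    moreover have "L2_lim \<Omega> at_top P pb" by (rule L2_lim_cong_AE[OF L AEpb mpb])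
    moreover have "\<forall>x\<in>frontier \<Omega>. pc x = 0"
      using continuous_rep_boundary_zero[OF \<Omega>(1,3) hp pc] by blast
    ultimately show ?thesis using bd cpc
      by (intro exI[of _ pb] exI[of _ "wgrad \<Omega> p"] exI[of _ "max B 0"]) (simp add: pb_def)
  qed
  have evUV: "eventually (\<lambda>\<beta>. U \<beta> \<in> H10 \<Omega>) at_top" "eventually (\<lambda>\<beta>. V \<beta> \<in> H10 \<Omega>) at_top"
    using evH by (auto elim: eventually_mono)
  have posU: "eventually (\<lambda>\<beta>. AE x in ?M. 0 \<le> U \<beta> x) at_top"
    using ev0
  proof eventually_elim
    case (elim \<beta>)
    show ?case using assms(5)[OF elim] by eventually_elim simp
  qed
  have posV: "eventually (\<lambda>\<beta>. AE x in ?M. 0 \<le> V \<beta> x) at_top"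
    using ev0
  proof eventually_elim
    case (elim \<beta>)
    show ?case using assms(5)[OF elim] by eventually_elim simp
  qed
  obtain ub gu B1 where ub: "H10_pair \<Omega> ub gu" "L2_lim \<Omega> at_top U ub" "\<forall>x. 0 \<le> ub x \<and> ub x \<le> B1"
    "\<forall>x\<in>\<Omega>. ub x = uc x" "continuous_on (closure \<Omega>) uc" "\<forall>x\<in>frontier \<Omega>. uc x = 0"
    using rep[OF assms(9,11,13) evUV(1) posU] by blast
  obtain vb gv B2 where vb: "H10_pair \<Omega> vb gv" "L2_lim \<Omega> at_top V vb" "\<forall>x. 0 \<le> vb x \<and> vb x \<le> B2"
    "\<forall>x\<in>\<Omega>. vb x = vc x" "continuous_on (closure \<Omega>) vc" "\<forall>x\<in>frontier \<Omega>. vc x = 0"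
    using rep[OF assms(10,12,14) evUV(2) posV] by blast
  define B where "B = max B1 B2"
  have bd: "0 \<le> ub x" "ub x \<le> B" "0 \<le> vb x" "vb x \<le> B" for x
    using ub(3) vb(3) by (auto simp: B_def le_max_iff_disj)
  have wcont: "continuous_on (closure \<Omega>) (\<lambda>x. uc x + vc x)" using ub(5) vb(5) by (intro continuous_intros)
  have Popen: "open ?P"
  proof -
    have "open (\<Omega> \<inter> (\<lambda>x. uc x + vc x) -` {0<..})"
      using wcont closure_subset \<Omega>(1) by (intro continuous_open_preimage) (auto intro: continuous_on_subset)
    then show ?thesis by (simp add: vimage_def Int_def)
  qed
  have "\<exists>Cs. Cs \<subseteq> components ?P \<and> finite Cs \<and> card Cs = Suc k"
  proof (cases "finite (components ?P)")
    case True
    then have "Suc k \<le> card (components ?P)" using contra by simp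
    then obtain Cs where "Cs \<subseteq> components ?P" "card Cs = Suc k" "finite Cs"
      by (rule obtain_subset_with_card_n)
    then show ?thesis by (intro exI[of _ Cs] conjI)
  next
    case False
    from infinite_arbitrarily_large[OF this, of "Suc k"]
    obtain Cs where "finite Cs" "card Cs = Suc k" "Cs \<subseteq> components ?P" by (elim exE conjE)
    then show ?thesis by (intro exI[of _ Cs] conjI)
  qed
  then obtain Cs where Cs: "Cs \<subseteq> components ?P" "finite Cs" "card Cs = Suc k" by (elim exE conjE)
  have "\<exists>\<eta>. test_fun X \<eta> \<and> cutoff_form \<Omega> ub vb \<eta> < 0" if X: "X \<in> Cs" for X
  proof -
    have Xc: "X \<in> components ?P" using X Cs(1) by blast
    have XP: "X \<subseteq> ?P" by (rule in_components_subset[OF Xc])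
    show ?thesis
    proof (rule component_cutoff[OF \<Omega>(1,2) ub(1) vb(1) bd])
      show "open X" by (rule open_components[OF Popen Xc])
      show "X \<subseteq> \<Omega>" using XP by auto
      show "X \<noteq> {}" by (rule in_components_nonempty[OF Xc])
      show "ub x + vb x > 0" if "x \<in> X" for x using XP that ub(4) vb(4) by auto
      show "compact {x \<in> X. \<epsilon> \<le> ub x + vb x}" if "\<epsilon> > 0" for \<epsilon>
      proof -
        have "{x \<in> X. \<epsilon> \<le> ub x + vb x} = {x \<in> X. \<epsilon> \<le> uc x + vc x}" using XP ub(4) vb(4) by auto
        moreover have "compact {x \<in> X. \<epsilon> \<le> uc x + vc x}"
          using ub(6) vb(6) by (intro compact_superlevel_in_component[OF \<Omega>(1,2) wcont _ Xc that]) auto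
        ultimately show ?thesis by simp
      qed
    qed
  qed
  then obtain \<eta> where \<eta>: "\<And>X. X \<in> Cs \<Longrightarrow> test_fun X (\<eta> X)" "\<And>X. X \<in> Cs \<Longrightarrow> cutoff_form \<Omega> ub vb (\<eta> X) < 0" by metis
  have "\<forall>X\<in>Cs. eventually (\<lambda>\<beta>. cutoff_form \<Omega> (U \<beta>) (V \<beta>) (\<eta> X) < 0) at_top"
  proof
    fix X assume X: "X \<in> Cs"
    have ab: "\<bar>ub x\<bar> \<le> B" "\<bar>vb x\<bar> \<le> B" for x using bd[of x] by simp_all
    show "eventually (\<lambda>\<beta>. cutoff_form \<Omega> (U \<beta>) (V \<beta>) (\<eta> X) < 0) at_top"
      by (rule eventually_cutoff_form_neg[OF \<Omega>(1) ub(2) vb(2) evH ub(1) ab(1) vb(1) ab(2) \<eta>(1)[OF X] \<eta>(2)[OF X]])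
  qed
  then have "eventually (\<lambda>\<beta>. \<forall>X\<in>Cs. cutoff_form \<Omega> (U \<beta>) (V \<beta>) (\<eta> X) < 0) at_top"
    using Cs(2) by (intro eventually_ball_finite)
  from eventually_happens'[OF _ eventually_conj[OF this ev0]]
  obtain \<beta> where \<beta>: "\<And>X. X \<in> Cs \<Longrightarrow> cutoff_form \<Omega> (U \<beta>) (V \<beta>) (\<eta> X) < 0" "\<beta> \<ge> \<beta>\<^sub>0" by auto
  have "enat (card Cs) \<le> morse_index (H10 \<Omega> \<times> H10 \<Omega>) (energy \<Omega> lam \<beta>) (U \<beta>, V \<beta>)"
  proof (rule morse_index_ge_cutoffs[OF \<Omega>(1) assms(4)[OF \<beta>(2)] _ Cs(2) _ _ \<eta>(1) \<beta>(1)])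
    show "0 \<le> \<beta>" using \<beta>(2) assms(2) by simp
    show "X \<inter> Y = {}" if "X \<in> Cs" "Y \<in> Cs" "X \<noteq> Y" for X Y
      using components_nonoverlap[of X ?P Y] that Cs(1) by blast
    show "X \<subseteq> \<Omega>" if "X \<in> Cs" for X using in_components_subset[of X ?P] that Cs(1) by blast
  qed
  also have "\<dots> \<le> enat k" by (rule assms(7)[OF \<beta>(2)])
  finally show False using Cs(3) by simp
qed

end
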